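(* Let $A$ be a general Gorenstein algebra with Hilbert function $(1,3,h_2,\dots,h_e)$ such that the g-vector of $A$ is not of decreasing type. Then the non-Lefschetz locus of conics $\mathcal{C}_A$ has codimension $1$ in $\mathbb{P}^5$.
   Context: $\Bbbk$ is an algebraically closed field of characteristic $0$ and $R=\Bbbk[x_1,x_2,x_3]$ with the standard grading; Gorenstein algebras here are graded Artinian Gorenstein quotients of $R$. The Hilbert functions $(1,3,h_2,\dots,h_e)$ of such algebras of height $3$ are exactly the SI-sequences: symmetric sequences of positive integers whose first difference up to degree $\lfloor e/2\rfloor$ satisfies Macaulay's growth condition. The g-vector is $(1,2,g_2,\dots,g_{\lfloor e/2\rfloor})=(1,2,h_2-h_1,\dots,h_{\lfloor e/2\rfloor}-h_{\lfloor e/2\rfloor-1})$ (with $h_1=3$). It is of decreasing type if it begins with $(1,2,3,\dots)$, then is possibly constant, then is strictly decreasing. The graded Artinian Gorenstein quotients of $R$ with fixed Hilbert function form an irreducible family; "general" means for all members of some nonempty Zariski-open subset of this family. Non-Lefschetz locus of conics of $A$: let $S=\Bbbk[a_1,\dots,a_6]$ be the coordinate ring of $\mathbb{P}^5=\mathbb{P}([R]_2)$, with $a_1,\dots,a_6$ the coefficients of a generic quadratic form $C$. For each $i$, multiplication $\times C:S\otimes_\Bbbk[A]_i\to S\otimes_\Bbbk[A]_{i+2}$ is represented by an $h_{i+2}\times h_i$ matrix of linear forms in $S$; let $I(\mathcal{C}_{A,i})$ be the ideal of its maximal minors. $\mathcal{C}_A\subseteq\mathbb{P}^5$ is the subscheme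 defined by $I(\mathcal{C}_A)=\bigcap_{0\le i\le e-2}I(\mathcal{C}_{A,i})$; its points are the quadratic forms $C$ for which $\times C:[A]_i\to[A]_{i+2}$ is neither injective nor surjective for some $i$. *)

theory Defs
  imports
    "HOL-Library.Poly_Mapping"
    "HOL-Library.Numeral_Type"
    "HOL-Library.Extended_Nat"
    "HOL-Computational_Algebra.Polynomial"
    "HOL-Analysis.Abstract_Topology"
    "Jordan_Normal_Form.Determinant"
    "Jordan_Normal_Form.DL_Submatrix"
begin

section \<open>Polynomial rings and their ideals\<close>

text \<open>
  Polynomials in variables indexed by the type \<open>'v\<close>: finitely supported functions from exponent
  vectors to coefficients, with the convolution product of \<^theory>\<open>HOL-Library.Poly_Mapping\<close>.
\<close>

type_synonym ('v, 'k) mpoly = "('v \<Rightarrow>\<^sub>0 nat) \<Rightarrow>\<^sub>0 'k"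

definition Var :: "'v \<Rightarrow> ('v, 'k::comm_ring_1) mpoly" where
  "Var v = Poly_Mapping.single (Poly_Mapping.single v 1) 1"

definition Const :: "'k \<Rightarrow> ('v, 'k::comm_ring_1) mpoly" where
  "Const c = Poly_Mapping.single 0 c"

definition mdeg :: "('v \<Rightarrow>\<^sub>0 nat) \<Rightarrow> nat" where
  "mdeg m = (\<Sum>v\<in>Poly_Mapping.keys m. Poly_Mapping.lookup m v)"

definition homog :: "nat \<Rightarrow> ('v, 'k::comm_ring_1) mpoly set" where
  "homog d = {f. \<forall>m\<in>Poly_Mapping.keys f. mdeg m = d}"

definition hcomp :: "nat \<Rightarrow> ('v, 'k::comm_ring_1) mpoly \<Rightarrow> ('v, 'k) mpoly" where
  "hcomp d f = (\<Sum>m\<in>{m\<in>Poly_Mapping.keys f. mdeg m = d}. Poly_Mapping.single m (Poly_Mapping.lookup f m))"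

definition eval_mpoly :: "('v \<Rightarrow> 'k) \<Rightarrow> ('v, 'k::comm_ring_1) mpoly \<Rightarrow> 'k" where
  "eval_mpoly a p = (\<Sum>m\<in>Poly_Mapping.keys p. Poly_Mapping.lookup p m * (\<Prod>v\<in>Poly_Mapping.keys m. a v ^ Poly_Mapping.lookup m v))"

text \<open>Ideals are the submodules of the ring regarded as a module over itself.\<close>

definition is_ideal :: "'a::comm_ring_1 set \<Rightarrow> bool" where
  "is_ideal = Modules.module.subspace (*)"

definition ideal_generated :: "'a::comm_ring_1 set \<Rightarrow> 'a set" where
  "ideal_generated = Modules.module.span (*)"

definition homog_ideal :: "('v, 'k::comm_ring_1) mpoly set \<Rightarrow> bool" where
  "homog_ideal I \<longleftrightarrow> is_ideal I \<and> (\<forall>f\<in>I. \<forall>d. hcomp d f \<in> I)"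

definition prime_ideal :: "'a::comm_ring_1 set \<Rightarrow> bool" where
  "prime_ideal P \<longleftrightarrow> is_ideal P \<and> 1 \<notin> P \<and> (\<forall>a b. a * b \<in> P \<longrightarrow> a \<in> P \<or> b \<in> P)"


section \<open>Graded Artinian Gorenstein quotients\<close>

text \<open>
  A graded quotient \<open>A = R/I\<close> is represented by its defining ideal \<open>I\<close>. Subspaces of \<open>A\<close> are
  represented by subspaces of \<open>R\<close>: \<open>V\<close> stands for \<open>(V + I)/I\<close>, so that \<open>[A]\<^sub>d\<close> is given by
  \<open>homog d\<close>. The predicate \<open>quot_basis V I bs\<close> says that the classes modulo \<open>I\<close> of the elements
  of the list \<open>bs\<close> form a basis of the vector space \<open>(V + I)/I\<close>.
\<close>

definition quot_basis ::
    "('v, 'k::field) mpoly set \<Rightarrow> ('v, 'k) mpoly set \<Rightarrow> ('v, 'k) mpoly list \<Rightarrow> bool" where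
  "quot_basis V I bs \<longleftrightarrow>
     set bs \<subseteq> V \<and>
     (\<forall>c. (\<Sum>j<length bs. Const (c j) * bs ! j) \<in> I \<longrightarrow> (\<forall>j<length bs. c j = 0)) \<and>
     (\<forall>f\<in>V. \<exists>c. f - (\<Sum>j<length bs. Const (c j) * bs ! j) \<in> I)"

definition quot_dim :: "('v, 'k::field) mpoly set \<Rightarrow> ('v, 'k) mpoly set \<Rightarrow> nat" where
  "quot_dim V I = (THE n. \<exists>bs. quot_basis V I bs \<and> length bs = n)"

definition hilbert_fun :: "('v, 'k::field) mpoly set \<Rightarrow> nat \<Rightarrow> nat" where
  "hilbert_fun I d = quot_dim (homog d) I"

text \<open>Descending chain condition for the ideals of \<open>R/I\<close>, i.e. the ideals of \<open>R\<close> containing \<open>I\<close>.\<close>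

definition artinian_quotient :: "'a::comm_ring_1 set \<Rightarrow> bool" where
  "artinian_quotient I \<longleftrightarrow>
     \<not> (\<exists>J :: nat \<Rightarrow> 'a set. \<forall>n. is_ideal (J n) \<and> I \<subseteq> J n \<and> J (Suc n) \<subset> J n)"

text \<open>Preimage in \<open>R\<close> of the socle of \<open>R/I\<close>, the annihilator of the irrelevant maximal ideal.\<close>

definition socle :: "('v, 'k::comm_ring_1) mpoly set \<Rightarrow> ('v, 'k) mpoly set" where
  "socle I = {f. \<forall>v. Var v * f \<in> I}"

definition artinian_gorenstein :: "('v, 'k::field) mpoly set \<Rightarrow> bool" where
  "artinian_gorenstein I \<longleftrightarrow>
     homog_ideal I \<and> artinian_quotient I \<and> quot_dim (socle I) I = 1"

definition gorenstein_family :: "(nat \<Rightarrow> nat) \<Rightarrow> (3, 'k::field) mpoly set set" where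
  "gorenstein_family h = {I. artinian_gorenstein I \<and> (\<forall>d. hilbert_fun I d = h d)}"

text \<open>
  If \<open>R/I\<close> is graded Artinian Gorenstein of socle degree \<open>e\<close>, then \<open>[I]\<^sub>e\<close> is a hyperplane in
  \<open>[R]\<^sub>e\<close> which determines \<open>I\<close> (Macaulay duality), so the family with fixed Hilbert function is a
  subset of the projective space of hyperplanes in \<open>[R]\<^sub>e\<close>; its Zariski topology is the one induced
  from there. The homogeneous coordinates of the hyperplane are the values, at the monomials of
  degree \<open>e\<close>, of a linear form on \<open>[R]\<^sub>e\<close> with kernel \<open>[I]\<^sub>e\<close>; they are unique up to a common
  nonzero factor.
\<close>

definition dual_coords ::
    "nat \<Rightarrow> ('v, 'k::field) mpoly set \<Rightarrow> (('v \<Rightarrow>\<^sub>0 nat) \<Rightarrow> 'k) \<Rightarrow> bool" where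
  "dual_coords e I \<phi> \<longleftrightarrow>
     (\<forall>m. mdeg m \<noteq> e \<longrightarrow> \<phi> m = 0) \<and>
     (\<forall>f\<in>homog e. f \<in> I \<longleftrightarrow> (\<Sum>m\<in>Poly_Mapping.keys f. Poly_Mapping.lookup f m * \<phi> m) = 0)"

definition zariski_open_in_family ::
    "nat \<Rightarrow> (nat \<Rightarrow> nat) \<Rightarrow> (3, 'k::field) mpoly set set \<Rightarrow> bool" where
  "zariski_open_in_family e h U \<longleftrightarrow>
     U \<subseteq> gorenstein_family h \<and>
     (\<exists>B :: ((3 \<Rightarrow>\<^sub>0 nat), 'k) mpoly set. B \<subseteq> (\<Union>d. homog d) \<and>
        (\<forall>I\<in>gorenstein_family h. \<forall>\<phi>. dual_coords e I \<phi> \<longrightarrow>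
           (I \<in> U \<longleftrightarrow> (\<exists>p\<in>B. eval_mpoly \<phi> p \<noteq> 0))))"

definition g_vector :: "(nat \<Rightarrow> nat) \<Rightarrow> nat \<Rightarrow> int" where
  "g_vector h i = (if i = 0 then int (h 0) else int (h i) - int (h (i - 1)))"

text \<open>
  The finite sequence \<open>g 0, \<dots>, g k\<close> equals \<open>1, 2, \<dots>, s + 1\<close> up to index \<open>s\<close>, is constant from
  \<open>s\<close> to \<open>t\<close> and strictly decreasing from \<open>t\<close> to \<open>k\<close>. The last two parts may be empty.
\<close>

definition decreasing_type :: "nat \<Rightarrow> (nat \<Rightarrow> int) \<Rightarrow> bool" where
  "decreasing_type k g \<longleftrightarrow>
     (\<exists>s t. 1 \<le> s \<and> s \<le> t \<and> t \<le> k \<and>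
        (\<forall>i\<le>s. g i = int i + 1) \<and>
        (\<forall>i. s \<le> i \<and> i \<le> t \<longrightarrow> g i = g s) \<and>
        (\<forall>i. t \<le> i \<and> i < k \<longrightarrow> g (Suc i) < g i))"


section \<open>Projective space and codimension\<close>

text \<open>
  Points of \<open>Proj\<close> of the polynomial ring: homogeneous primes not containing the irrelevant
  ideal.
\<close>

definition proj_points :: "('v, 'k::comm_ring_1) mpoly set set" where
  "proj_points = {P. prime_ideal P \<and> homog_ideal P \<and> (\<exists>v. Var v \<notin> P)}"

definition proj_vanishing :: "('v, 'k::comm_ring_1) mpoly set \<Rightarrow> ('v, 'k) mpoly set set" where
  "proj_vanishing J = {P\<in>proj_points. J \<subseteq> P}"

definition proj_space :: "('v, 'k::comm_ring_1) mpoly set topology" where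
  "proj_space = topology (\<lambda>U. \<exists>J. homog_ideal J \<and> U = proj_points - proj_vanishing J)"

lemma lookup_hcomp:
  "Poly_Mapping.lookup (hcomp d f) m = (if mdeg m = d then Poly_Mapping.lookup f m else 0)"
proof -
  have "Poly_Mapping.lookup (hcomp d f) m =
      (\<Sum>n\<in>{n\<in>Poly_Mapping.keys f. mdeg n = d}. if n = m then Poly_Mapping.lookup f n else 0)"
    unfolding hcomp_def by (simp add: lookup_sum lookup_single when_def)
  also have "\<dots> = (if mdeg m = d then Poly_Mapping.lookup f m else 0)"
    by (simp add: in_keys_iff)
  finally show ?thesis .
qed

lemma hcomp_sum: "hcomp d (\<Sum>x\<in>T. g x) = (\<Sum>x\<in>T. hcomp d (g x))"
  by (rule poly_mapping_eqI) (simp add: lookup_hcomp lookup_sum)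

lemma module_times: "Modules.module ((*) :: 'a::comm_ring_1 \<Rightarrow> 'a \<Rightarrow> 'a)"
  by unfold_locales (simp_all add: algebra_simps)

lemma openin_proj_space:
  "openin (proj_space :: ('v, 'k::comm_ring_1) mpoly set topology) U \<longleftrightarrow>
     (\<exists>J. homog_ideal J \<and> U = proj_points - proj_vanishing J)"
proof -
  let ?O = "\<lambda>U :: ('v, 'k) mpoly set set.
    \<exists>J. homog_ideal J \<and> U = proj_points - proj_vanishing J"
  note sub = module.subspaceI[OF module_times] module.subspace_0[OF module_times]
    module.subspace_add[OF module_times] module.subspace_scale[OF module_times]
  have inter: "?O (S \<inter> T)" if "?O S" "?O T" for S T
  proof -
    from that obtain J K where J: "homog_ideal J" "S = proj_points - proj_vanishing J"
      and K: "homog_ideal K" "T = proj_points - proj_vanishing K" by blast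
    have id: "is_ideal (J \<inter> K)"
      using J K unfolding homog_ideal_def is_ideal_def
      by (auto intro: module.subspace_inter[OF module_times])
    then have "homog_ideal (J \<inter> K)"
      using J K unfolding homog_ideal_def by auto
    moreover have "P \<in> proj_vanishing (J \<inter> K) \<longleftrightarrow> P \<in> proj_vanishing J \<or> P \<in> proj_vanishing K"
      if P: "P \<in> proj_points" for P
    proof -
      have "J \<subseteq> P \<or> K \<subseteq> P" if sb: "J \<inter> K \<subseteq> P"
      proof (rule ccontr)
        assume "\<not> (J \<subseteq> P \<or> K \<subseteq> P)"
        then obtain a b where ab: "a \<in> J" "a \<notin> P" "b \<in> K" "b \<notin> P" by blast
        have "b * a \<in> J" "a * b \<in> K"
          using ab J K sub(4) unfolding homog_ideal_def is_ideal_def by blast+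
        then have "a * b \<in> P" using sb by (auto simp: mult.commute)
        with ab P show False unfolding proj_points_def prime_ideal_def by blast
      qed
      then show ?thesis using P unfolding proj_vanishing_def by blast
    qed
    then have "S \<inter> T = proj_points - proj_vanishing (J \<inter> K)" using J K by blast
    ultimately show ?thesis by blast
  qed
  have union: "?O (\<Union>\<K>)" if "\<forall>S\<in>\<K>. ?O S" for \<K>
  proof -
    from that obtain J where J: "\<And>S. S \<in> \<K> \<Longrightarrow> homog_ideal (J S)"
      "\<And>S. S \<in> \<K> \<Longrightarrow> S = proj_points - proj_vanishing (J S)" by metis
    define L where "L = Modules.module.span (*) (\<Union>S\<in>\<K>. J S)"
    have id: "is_ideal L"
      unfolding L_def is_ideal_def by (rule module.subspace_span[OF module_times])
    have supL: "J S \<subseteq> L" if "S \<in> \<K>" for S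
      unfolding L_def using module.span_superset[OF module_times] that by blast
    have "hcomp d f \<in> L" if "f \<in> L" for d f
    proof -
      from that obtain T r where T: "finite T" "T \<subseteq> (\<Union>S\<in>\<K>. J S)" "f = (\<Sum>a\<in>T. r a * a)"
        unfolding L_def module.span_explicit[OF module_times] by blast
      have "hcomp d (r a * a) \<in> L" if "a \<in> T" for a
      proof -
        obtain S where S: "S \<in> \<K>" "a \<in> J S" using T \<open>a \<in> T\<close> by blast
        then have "r a * a \<in> J S"
          using J(1)[OF S(1)] sub(4) unfolding homog_ideal_def is_ideal_def by blast
        then show ?thesis using J(1)[OF S(1)] supL[OF S(1)] unfolding homog_ideal_def by blast
      qed
      then show ?thesis unfolding T(3) hcomp_sum
        by (intro module.subspace_sum[OF module_times]) (use id in \<open>simp_all add: is_ideal_def\<close>)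
    qed
    then have hL: "homog_ideal L" using id unfolding homog_ideal_def by blast
    have "L \<subseteq> P \<longleftrightarrow> (\<forall>S\<in>\<K>. J S \<subseteq> P)" if "P \<in> proj_points" for P
    proof
      assume "\<forall>S\<in>\<K>. J S \<subseteq> P"
      then show "L \<subseteq> P" unfolding L_def
        by (intro module.span_minimal[OF module_times])
          (use that in \<open>auto simp: proj_points_def homog_ideal_def is_ideal_def\<close>)
    qed (use supL in blast)
    then have "proj_points - proj_vanishing L = (\<Union>S\<in>\<K>. proj_points - proj_vanishing (J S))"
      unfolding proj_vanishing_def by blast
    moreover have "(\<Union>S\<in>\<K>. proj_points - proj_vanishing (J S)) = (\<Union>S\<in>\<K>. S)"
      by (rule SUP_cong[OF refl]) (simp flip: J(2))
    ultimately have "\<Union>\<K> = proj_points - proj_vanishing L" by simp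
    with hL show ?thesis by blast
  qed
  have "istopology ?O" unfolding istopology_def
    by (intro conjI allI impI) (rule inter, assumption+, rule union, assumption)
  then show ?thesis unfolding proj_space_def by (simp add: topology_inverse')
qed

definition irreducible_closedin :: "'a topology \<Rightarrow> 'a set \<Rightarrow> bool" where
  "irreducible_closedin X Y \<longleftrightarrow>
     closedin X Y \<and> Y \<noteq> {} \<and>
     (\<forall>F G. closedin X F \<and> closedin X G \<and> Y = F \<union> G \<longrightarrow> Y = F \<or> Y = G)"

text \<open>Codimension of an irreducible closed subset, via chains of irreducible closed sets above it.\<close>

definition codim_irreducible :: "'a topology \<Rightarrow> 'a set \<Rightarrow> enat" where
  "codim_irreducible X Y =
     (SUP n\<in>{n. \<exists>C :: nat \<Rightarrow> 'a set. C 0 = Y \<and> (\<forall>i\<le>n. irreducible_closedin X (C i)) \<and>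
                  (\<forall>i<n. C i \<subset> C (Suc i))}. enat n)"

text \<open>The empty set has codimension \<open>\<infinity>\<close>.\<close>

definition codim_closed :: "'a topology \<Rightarrow> 'a set \<Rightarrow> enat" where
  "codim_closed X Z = (INF Y\<in>{Y. irreducible_closedin X Y \<and> Y \<subseteq> Z}. codim_irreducible X Y)"


section \<open>The non-Lefschetz locus of conics\<close>

text \<open>
  The generic quadratic form is \<open>C = (\<Sum>t. a\<^sub>t q\<^sub>t)\<close> where \<open>a\<^sub>t\<close> is the variable \<open>Var t\<close> of
  \<open>S = k[a\<^sub>0, \<dots>, a\<^sub>5]\<close> and \<open>q\<^sub>t = conic_monom t\<close>.
\<close>

definition conic_monom :: "6 \<Rightarrow> (3, 'k::comm_ring_1) mpoly" where
  "conic_monom t =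
     (if t = 0 then Var 0 * Var 0 else
      if t = 1 then Var 0 * Var 1 else
      if t = 2 then Var 0 * Var 2 else
      if t = 3 then Var 1 * Var 1 else
      if t = 4 then Var 1 * Var 2 else Var 2 * Var 2)"

definition graded_basis :: "('v, 'k::field) mpoly set \<Rightarrow> nat \<Rightarrow> ('v, 'k) mpoly list" where
  "graded_basis I d = (SOME bs. quot_basis (homog d) I bs)"

text \<open>
  \<open>quot_coord I bs f j\<close> is the \<open>j\<close>-th coordinate of the class of \<open>f\<close> in the basis \<open>bs\<close>; it is
  meaningful only for \<open>j < length bs\<close>.
\<close>

definition quot_coord ::
    "('v, 'k::field) mpoly set \<Rightarrow> ('v, 'k) mpoly list \<Rightarrow> ('v, 'k) mpoly \<Rightarrow> nat \<Rightarrow> 'k" where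
  "quot_coord I bs f = (SOME c. f - (\<Sum>j<length bs. Const (c j) * bs ! j) \<in> I)"

text \<open>
  Matrix over \<open>S\<close> of \<open>\<times>C : S \<otimes> [A]\<^sub>i \<rightarrow> S \<otimes> [A]\<^sub>i\<^sub>+\<^sub>2\<close>: the column of the basis element \<open>b\<close> consists of
  the coordinates of \<open>(\<Sum>t. a\<^sub>t \<otimes> q\<^sub>t b)\<close>.
\<close>

definition conic_matrix :: "(3, 'k::field) mpoly set \<Rightarrow> nat \<Rightarrow> (6, 'k) mpoly mat" where
  "conic_matrix I i =
     (let bs = graded_basis I i; cs = graded_basis I (i + 2)
      in mat (length cs) (length bs)
           (\<lambda>(j, l). \<Sum>t\<in>UNIV. Const (quot_coord I cs (conic_monom t * bs ! l) j) * Var t))"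

definition maximal_minors :: "'a::comm_ring_1 mat \<Rightarrow> 'a set" where
  "maximal_minors M =
     {det (submatrix M P Q) | P Q. P \<subseteq> {..<dim_row M} \<and> Q \<subseteq> {..<dim_col M} \<and>
        card P = min (dim_row M) (dim_col M) \<and> card Q = min (dim_row M) (dim_col M)}"

text \<open>The ideal of maximal minors does not depend on the bases chosen in \<open>graded_basis\<close>.\<close>

definition conic_ideal_at :: "(3, 'k::field) mpoly set \<Rightarrow> nat \<Rightarrow> (6, 'k) mpoly set" where
  "conic_ideal_at I i = ideal_generated (maximal_minors (conic_matrix I i))"

definition conic_ideal :: "nat \<Rightarrow> (3, 'k::field) mpoly set \<Rightarrow> (6, 'k) mpoly set" where
  "conic_ideal e I = (\<Inter>i\<in>{i. i + 2 \<le> e}. conic_ideal_at I i)"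

definition non_lefschetz_conics :: "nat \<Rightarrow> (3, 'k::field) mpoly set \<Rightarrow> (6, 'k) mpoly set set" where
  "non_lefschetz_conics e I = proj_vanishing (conic_ideal e I)"

end

theory Submission
  imports Defs "HOL-Library.Function_Algebras"
begin

text \<open>
  Write \<open>A = R/I\<close> as the inverse system of its dual generator and let \<open>x = Var 0\<close>. The required open
  set consists of the algebras on which \<open>x\<^sup>2\<close> is injective up to the middle degree; by duality \<open>x\<^sup>2\<close>
  then has maximal rank in all degrees, so that the ideal of the locus is nonzero.

  The symmetries of the Hilbert functions of \<open>A\<close> and of \<open>R/(I : x)\<close> show by induction on the socle
  degree that the g-vector of \<open>A\<close> grows as \<open>1, 2, \<dots>, s\<close> and is then nonincreasing. Hence it is the
  h-vector of the points \<open>(1 : a : b)\<close>, with \<open>(a, b)\<close> in a finite lower set of exponents, and the sum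
  of the \<open>e\<close>-th powers of the corresponding linear forms is the dual generator of an algebra in the
  open set: the relevant pairings are Gram matrices of integer matrices of full rank.

  If the g-vector is not of decreasing type, there are degrees with \<open>g\<^sub>m > g\<^sub>m\<^sub>+\<^sub>1 = g\<^sub>m\<^sub>+\<^sub>2\<close>. Maximal growth
  then yields a nonzero \<open>w \<in> [A]\<^sub>m\<close> which is a common eigenvector of the multiplications by all linear
  forms relative to \<open>x\<close>, that is, a point \<open>p\<close> such that every conic \<open>C\<close> acts on \<open>w\<close> as \<open>C(p) x\<^sup>2\<close>. So the
  hyperplane of the conics through \<open>p\<close> lies in the non-Lefschetz locus.
\<close>

section \<open>Finite-dimensional subspaces\<close>

text \<open>The conic \<open>x\<^sup>2\<close> alone is tested because one conic at which every
  degree has a nonvanishing maximal minor makes the ideal of the locus nonzero; it also gives the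
  injectivity of \<open>x\<close> that the eigenvector argument consumes. There put
  \<open>d = g\<^sub>m\<^sub>+\<^sub>1 = g\<^sub>m\<^sub>+\<^sub>2\<close>. Injectivity makes
  \<open>d\<close> the Hilbert function of \<open>A/xA\<close> in both degrees, and as
  \<open>d \<le> m\<close> this is extremal growth in two variables: the relations look like those
  of a plane curve of degree \<open>d\<close> with some points added. The curve accounts for
  \<open>\<Sum>l\<le>m. min d (l + 1)\<close> dimensions in degree \<open>m\<close>, fewer than
  \<open>h\<^sub>m\<close> because \<open>g\<^sub>m > d\<close>; the excess comes from a point. The
  obstacle is to reach it by linear algebra. After a general change of coordinates the curve is
  represented by \<open>low\<close>, the span of the monomials with small exponent in one variable.
  Modulo \<open>low\<close>, a second variable and \<open>x\<close> form a pencil on a nonzero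
  space; its eigenvalue \<open>b\<close> is one coordinate of the point. A dimension count shows
  that the second variable minus \<open>b x\<close> has a kernel in \<open>A\<close> itself, not
  only modulo \<open>low\<close>, and the remaining variable has an eigenvector in that
  kernel.\<close>

locale vspace = Vector_Spaces.vector_space scale
  for scale :: "'a::field \<Rightarrow> 'b::ab_group_add \<Rightarrow> 'b" (infixr "*s" 75)
begin

text \<open>The polynomials and functions treated below form spaces of infinite dimension, where
  \<open>dim\<close> measures nothing (an infinite basis has \<open>card\<close> 0); so finiteness
  is made a property of sets.\<close>

definition fin_dim :: "'b set \<Rightarrow> bool" where
  "fin_dim S \<longleftrightarrow> (\<exists>B. finite B \<and> S \<subseteq> span B)"

lemma fin_dim_finite: "finite S \<Longrightarrow> fin_dim S"
  unfolding fin_dim_def using span_superset by blast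

lemma fin_dim_subset: "fin_dim T \<Longrightarrow> S \<subseteq> T \<Longrightarrow> fin_dim S"
  unfolding fin_dim_def by blast

lemma fin_dim_span: "fin_dim S \<Longrightarrow> fin_dim (span S)"
  unfolding fin_dim_def by (meson span_minimal subspace_span)

lemma fin_dim_Un: "fin_dim S \<Longrightarrow> fin_dim T \<Longrightarrow> fin_dim (S \<union> T)"
proof -
  assume "fin_dim S" "fin_dim T"
  then obtain B C where "finite B" "S \<subseteq> span B" "finite C" "T \<subseteq> span C"
    unfolding fin_dim_def by blast
  moreover have "span B \<subseteq> span (B \<union> C)" "span C \<subseteq> span (B \<union> C)" by (simp_all add: span_mono)
  ultimately show ?thesis unfolding fin_dim_def by (meson Un_least finite_UnI order_trans)
qed

lemma fin_dim_basis:
  assumes "fin_dim V"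
  obtains B where "finite B" "independent B" "B \<subseteq> V" "V \<subseteq> span B" "card B = dim V"
proof -
  obtain B where B: "B \<subseteq> V" "independent B" "V \<subseteq> span B" "card B = dim V"
    using basis_exists by blast
  obtain C where "finite C" "V \<subseteq> span C" using assms unfolding fin_dim_def by blast
  then have "finite B" using independent_span_bound[of C B] B by blast
  with B that show ?thesis by blast
qed

lemma dim_mono_fin_dim:
  assumes "fin_dim W" "V \<subseteq> span W"
  shows "dim V \<le> dim W"
proof -
  obtain B where B: "finite B" "W \<subseteq> span B" "card B = dim W" using fin_dim_basis[OF assms(1)] by metis
  then have "V \<subseteq> span B" using assms(2) by (metis span_minimal subspace_span order_trans)
  then show ?thesis using dim_le_card B by metis
qed

lemma dim_insert_fin_dim:
  assumes "fin_dim S"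
  shows "dim (insert v S) = (if v \<in> span S then dim S else Suc (dim S))"
proof (cases "v \<in> span S")
  case True
  then show ?thesis using span_eq_dim[OF span_redundant[OF True]] by simp
next
  case False
  obtain B where B: "finite B" "independent B" "B \<subseteq> S" "S \<subseteq> span B" "card B = dim S"
    using fin_dim_basis[OF assms] by metis
  have sp: "span B = span S" using B by (metis span_mono span_span subset_antisym span_minimal subspace_span)
  have "independent (insert v B)" using False sp B by (simp add: independent_insertI)
  moreover have "span (insert v B) = span (insert v S)"
    using sp unfolding span_insert by simp
  moreover have "v \<notin> B" using False sp span_base by blast
  ultimately have "dim (insert v S) = Suc (card B)"
    using dim_eq_card[of "insert v B" "insert v S"] B(1) by simp
  then show ?thesis using False B by simp
qed

lemma subspace_eq_of_dim_le:
  assumes "subspace V" "V \<subseteq> W" "fin_dim W" "dim W \<le> dim V"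
  shows "W = V"
proof (rule ccontr)
  assume "W \<noteq> V"
  then obtain w where w: "w \<in> W" "w \<notin> V" using assms by blast
  have fV: "fin_dim V" using fin_dim_subset assms by blast
  have "dim (insert w V) = Suc (dim V)"
    using dim_insert_fin_dim[OF fV] w assms(1) by (metis span_eq_iff)
  moreover have "dim (insert w V) \<le> dim W"
    by (rule dim_mono_fin_dim[OF assms(3)]) (use w assms span_superset in blast)
  ultimately show False using assms(4) by linarith
qed

lemma dim_zero: "dim {0} = 0"
  by (rule dim_unique[of "{}"]) (auto simp: independent_empty)

lemma dim_eq_0_iff_fin_dim:
  assumes "fin_dim S"
  shows "dim S = 0 \<longleftrightarrow> S \<subseteq> {0}"
proof
  assume "dim S = 0"
  then show "S \<subseteq> {0}" using fin_dim_basis[OF assms] by (metis card_eq_0_iff span_empty)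
next
  assume "S \<subseteq> {0}"
  then show "dim S = 0"
    using dim_mono_fin_dim[of "{0}" S] fin_dim_finite[of "{0}"] dim_zero
    by (metis finite.emptyI finite.insertI le_zero_eq order_trans span_superset)
qed

text \<open>Adjoining the vectors one at a time raises the dimension exactly at the indices whose
  vector is new. Applied to monomials in a fixed order, this is the count of standard
  monomials.\<close>

lemma dim_Un_sequence:
  assumes "fin_dim U"
  shows "dim (U \<union> v ` {..<n}) = dim U + card {a. a < n \<and> v (a::nat) \<notin> span (U \<union> v ` {..<a})}"
proof (induction n)
  case (Suc n)
  have f: "fin_dim (U \<union> v ` {..<n})" by (intro fin_dim_Un assms fin_dim_finite) simp
  have "U \<union> v ` {..<Suc n} = insert (v n) (U \<union> v ` {..<n})" by (auto simp: lessThan_Suc)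
  moreover have "{a. a < Suc n \<and> v a \<notin> span (U \<union> v ` {..<a})} =
    (if v n \<in> span (U \<union> v ` {..<n}) then {} else {n}) \<union> {a. a < n \<and> v a \<notin> span (U \<union> v ` {..<a})}"
    by (auto simp: less_Suc_eq)
  ultimately show ?case using Suc dim_insert_fin_dim[OF f] by (simp add: card_insert_if)
qed simp

lemma sequence_in_span:
  assumes "\<And>a. d \<le> a \<Longrightarrow> a < n \<Longrightarrow> v a \<in> span (U \<union> v ` {..<a})" "a < (n::nat)"
  shows "v a \<in> span (U \<union> v ` {..<d})"
  using assms(2)
proof (induction a rule: less_induct)
  case (less a)
  show ?case
  proof (cases "a < d")
    case True
    then show ?thesis by (intro span_base) auto
  next
    case False
    have "U \<union> v ` {..<a} \<subseteq> span (U \<union> v ` {..<d})"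
      using less by (auto intro: span_base)
    then have "span (U \<union> v ` {..<a}) \<subseteq> span (U \<union> v ` {..<d})" by (simp add: span_minimal)
    then show ?thesis using assms(1)[of a] False less by auto
  qed
qed

lemma sequence_independent_mod:
  assumes U: "subspace U" and "\<And>a. a < (d::nat) \<Longrightarrow> v a \<notin> span (U \<union> v ` {..<a})"
    and "(\<Sum>a<d. c a *s v a) \<in> U"
  shows "\<forall>a<d. c a = 0"
  using assms(2,3)
proof (induction d)
  case (Suc d)
  have "c d = 0"
  proof (rule ccontr)
    assume c: "c d \<noteq> 0"
    let ?S = "span (U \<union> v ` {..<d})"
    have "(\<Sum>a<d. c a *s v a) \<in> ?S" by (intro span_sum span_scale span_base) auto
    moreover have "(\<Sum>a<d. c a *s v a) + c d *s v d \<in> ?S"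
      using Suc.prems(2) by (intro span_base) (auto simp: add.commute)
    ultimately have "c d *s v d \<in> ?S"
      by (metis add_diff_cancel_left' span_diff)
    then have "v d \<in> ?S" using c by (metis scale_scale span_scale left_inverse scale_one)
    then show False using Suc.prems(1)[of d] by blast
  qed
  moreover have "\<forall>a<d. c a = 0"
    using Suc.prems calculation by (intro Suc.IH) auto
  ultimately show ?case by (auto simp: less_Suc_eq)
qed simp

lemma span_Un_image_explicit:
  assumes "subspace U" "x \<in> span (U \<union> v ` {..<d::nat})"
  shows "\<exists>u\<in>U. \<exists>c. x = u + (\<Sum>a<d. c a *s v a)"
  using assms(2)
proof (induction d arbitrary: x)
  case 0
  then show ?case using assms(1) by (metis add.right_neutral image_empty lessThan_0 span_eq_iff sum.empty sup_bot_right)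
next
  case (Suc d)
  have "U \<union> v ` {..<Suc d} = insert (v d) (U \<union> v ` {..<d})" by (auto simp: lessThan_Suc)
  then obtain k where "x - k *s v d \<in> span (U \<union> v ` {..<d})"
    using Suc.prems by (auto simp: span_insert)
  then obtain u c where u: "u \<in> U" "x - k *s v d = u + (\<Sum>a<d. c a *s v a)" using Suc.IH by blast
  have "(\<Sum>a<d. (c(d := k)) a *s v a) = (\<Sum>a<d. c a *s v a)" by (intro sum.cong) auto
  then have "x = u + (\<Sum>a<Suc d. (c(d := k)) a *s v a)" using u(2) by (simp add: algebra_simps)
  then show ?case using u(1) by blast
qed

text \<open>The last coefficient is required to be nonzero so that the relation reads as a nonzero
  polynomial along the sequence.\<close>

lemma dependent_sequence:
  assumes "fin_dim Q" "range u \<subseteq> Q"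
  shows "\<exists>n c. c n \<noteq> 0 \<and> (\<Sum>i\<le>n. c i *s u (i::nat)) = 0"
proof (rule ccontr)
  assume neg: "\<not> ?thesis"
  have *: "u a \<notin> span ({0} \<union> u ` {..<a})" for a
  proof
    assume "u a \<in> span ({0} \<union> u ` {..<a})"
    then obtain c where "u a = (\<Sum>i<a. c i *s u i)"
      using span_Un_image_explicit[of "{0}" "u a" u a] subspace_single_0 by auto
    define d where "d i = (if i = a then - 1 else c i)" for i
    have "(\<Sum>i<a. d i *s u i) = (\<Sum>i<a. c i *s u i)" by (intro sum.cong) (auto simp: d_def)
    then have "(\<Sum>i\<le>a. d i *s u i) = 0"
      using \<open>u a = _\<close> by (simp add: d_def flip: lessThan_Suc_atMost)
    moreover have "d a \<noteq> 0" by (simp add: d_def)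
    ultimately have "d a \<noteq> 0 \<and> (\<Sum>i\<le>a. d i *s u i) = 0" by simp
    then have "\<exists>c. c a \<noteq> 0 \<and> (\<Sum>i\<le>a. c i *s u i) = 0" by (rule exI[of _ d])
    then have "\<exists>n c. c n \<noteq> 0 \<and> (\<Sum>i\<le>n. c i *s u i) = 0" by (rule exI[of _ a])
    with neg show False by (rule notE)
  qed
  have "n \<le> dim Q" for n
  proof -
    have "dim ({0} \<union> u ` {..<n}) = n" using dim_Un_sequence[of "{0}" u n] * dim_zero
      by (simp add: fin_dim_finite)
    moreover have "dim ({0} \<union> u ` {..<n}) \<le> dim Q"
      by (rule dim_mono_fin_dim[OF assms(1)]) (use assms(2) local.span_zero in \<open>auto intro: span_base\<close>)
    ultimately show ?thesis by simp
  qed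
  from this[of "Suc (dim Q)"] show False by simp
qed

lemma linear_span_subset:
  assumes "Vector_Spaces.linear scale scale f" "f ` S \<subseteq> W" "subspace W"
  shows "f ` span S \<subseteq> W"
proof -
  interpret Vector_Spaces.linear scale scale f by fact
  have "f ` span S = span (f ` S)" by (simp add: span_image)
  then show ?thesis using assms(2,3) by (simp add: span_minimal)
qed

end

locale vspace_pair = vs1: vspace s1 + vs2: vspace s2
  for s1 :: "'a::field \<Rightarrow> 'b::ab_group_add \<Rightarrow> 'b" and s2 :: "'a \<Rightarrow> 'c::ab_group_add \<Rightarrow> 'c"
begin

lemma fin_dim_image:
  assumes "Vector_Spaces.linear s1 s2 f" "vs1.fin_dim V"
  shows "vs2.fin_dim (f ` V)"
proof -
  interpret Vector_Spaces.linear s1 s2 f by fact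
  obtain B where "finite B" "V \<subseteq> vs1.span B" using assms unfolding vs1.fin_dim_def by blast
  then have "finite (f ` B)" "f ` V \<subseteq> vs2.span (f ` B)" using span_image[of B] by auto
  then show ?thesis unfolding vs2.fin_dim_def by blast
qed

lemma dim_image_le_fin_dim:
  assumes "Vector_Spaces.linear s1 s2 f" "vs1.fin_dim V"
  shows "vs2.dim (f ` V) \<le> vs1.dim V"
proof -
  interpret Vector_Spaces.linear s1 s2 f by fact
  obtain B where B: "finite B" "V \<subseteq> vs1.span B" "card B = vs1.dim V"
    using vs1.fin_dim_basis[OF assms(2)] by metis
  then have "f ` V \<subseteq> vs2.span (f ` B)" using span_image[of B] by auto
  then have "vs2.dim (f ` V) \<le> card (f ` B)" using vs2.dim_le_card B by blast
  moreover have "card (f ` B) \<le> card B" using B(1) card_image_le by blast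
  ultimately show ?thesis using B(3) by linarith
qed

lemma dim_image_eq_fin_dim:
  assumes "Vector_Spaces.linear s1 s2 f" "vs1.fin_dim V" "vs1.subspace V"
    and inj: "\<And>x. x \<in> V \<Longrightarrow> f x = 0 \<Longrightarrow> x = 0"
  shows "vs2.dim (f ` V) = vs1.dim V"
proof -
  interpret Vector_Spaces.linear s1 s2 f by fact
  obtain B where B: "finite B" "vs1.independent B" "B \<subseteq> V" "V \<subseteq> vs1.span B" "card B = vs1.dim V"
    using vs1.fin_dim_basis[OF assms(2)] by metis
  have sp: "vs1.span B = V" using B assms(3) by (simp add: vs1.span_minimal subset_antisym)
  have injV: "inj_on f V"
    using inj assms(3) by (intro inj_onI) (metis diff eq_iff_diff_eq_0 vs1.subspace_diff)
  then have "vs2.independent (f ` B)"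
    using independent_inj_on_image[of B] B sp by simp
  moreover have "vs2.span (f ` B) = f ` V" using span_image[of B] sp by simp
  moreover have "card (f ` B) = card B" using card_image inj_on_subset[OF injV B(3)] by blast
  ultimately show ?thesis using vs2.dim_eq_card[of "f ` B" "f ` V"] B(5) by (metis vs2.span_span)
qed

end

text \<open>A polynomial \<open>p\<close> of minimal degree with \<open>(\<Sum>i. p\<^sub>i u\<^sub>i) \<in> Q0\<close>, along a sequence with
  \<open>A u\<^sub>i \<equiv> B u\<^sub>i\<^sub>+\<^sub>1\<close> modulo \<open>G\<close>, has a root \<open>b\<close>, and the cofactor of that root yields the
  eigenvector.\<close>

lemma pencil_eigenvector:
  fixes scale :: "'k::alg_closed_field \<Rightarrow> 'b::ab_group_add \<Rightarrow> 'b"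
  assumes "vspace scale"
    and A: "Vector_Spaces.linear scale scale A" and B: "Vector_Spaces.linear scale scale B"
    and Q: "module.subspace scale Q" "vspace.fin_dim scale Q"
    and Q0: "module.subspace scale Q0"
    and G: "module.subspace scale G"
    and u0: "u0 \<in> Q" "u0 \<notin> Q0"
    and step: "\<And>u. u \<in> Q \<Longrightarrow> \<exists>v\<in>Q. A u - B v \<in> G"
    and BQ0: "B ` Q0 \<subseteq> G"
  shows "\<exists>b. \<exists>u\<in>Q. u \<notin> Q0 \<and> A u - scale b (B u) \<in> G"
proof -
  interpret vs: vspace scale by fact
  interpret lA: Vector_Spaces.linear scale scale A by fact
  interpret lB: Vector_Spaces.linear scale scale B by fact
  obtain nx where nx: "\<And>u. u \<in> Q \<Longrightarrow> nx u \<in> Q \<and> A u - B (nx u) \<in> G" using step by metis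
  \<comment> \<open>Iterating a choice function replaces the powers of
    \<open>B\<^sup>-\<^sup>1 A\<close>, as \<open>B\<close> need not be invertible;
    \<open>ev p\<close> below plays the part of the polynomial \<open>p\<close> in this operator,
    applied to \<open>u0\<close>.\<close>
  define u where "u i = (nx ^^ i) u0" for i
  have uQ: "u i \<in> Q" for i by (induction i) (use u0 nx in \<open>auto simp: u_def\<close>)
  have uG: "A (u i) - B (u (Suc i)) \<in> G" for i using nx[OF uQ[of i]] by (simp add: u_def)
  define ev where "ev p = (\<Sum>i\<le>degree p. scale (coeff p i) (u i))" for p
  have ev: "ev p = (\<Sum>i\<le>n. scale (coeff p i) (u i))" if "degree p \<le> n" for p n
    unfolding ev_def using that by (intro sum.mono_neutral_left) (auto simp: coeff_eq_0)
  have evQ: "ev p \<in> Q" for p unfolding ev_def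
    by (intro vs.subspace_sum vs.subspace_scale Q uQ)
  have ev_add: "ev (p + q) = ev p + ev q" for p q
  proof -
    let ?n = "max (degree p) (degree q)"
    have "degree (p + q) \<le> ?n" by (rule degree_add_le) auto
    then show ?thesis by (simp add: ev[of _ ?n] vs.scale_left_distrib sum.distrib)
  qed
  have ev_smult: "ev (smult c p) = scale c (ev p)" for c p
    using degree_smult_le[of c p] by (simp add: ev[of _ "degree p"] vs.scale_sum_right)
  have ev_shift: "A (ev p) - B (ev (pCons 0 p)) \<in> G" for p
  proof -
    have "ev (pCons 0 p) = (\<Sum>i\<le>Suc (degree p). scale (coeff (pCons 0 p) i) (u i))"
      by (rule ev) (simp add: degree_pCons_le)
    also have "\<dots> = (\<Sum>i\<le>degree p. scale (coeff p i) (u (Suc i)))"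
      by (subst sum.atMost_Suc_shift) simp
    finally have "A (ev p) - B (ev (pCons 0 p)) =
        (\<Sum>i\<le>degree p. scale (coeff p i) (A (u i) - B (u (Suc i))))"
      by (simp add: ev_def lA.sum lB.sum lA.scale lB.scale sum_subtractf vs.scale_right_diff_distrib)
    also have "\<dots> \<in> G" by (intro vs.subspace_sum vs.subspace_scale G uG)
    finally show ?thesis .
  qed
  have "\<exists>p. p \<noteq> 0 \<and> ev p \<in> Q0"
  proof -
    have "range u \<subseteq> Q" using uQ by auto
    from vs.dependent_sequence[OF Q(2) this]
    obtain n c where c: "c n \<noteq> 0" "(\<Sum>i\<le>n. scale (c i) (u i)) = 0" by (elim exE conjE)
    let ?p = "\<Sum>i\<le>n. monom (c i) i"
    have co: "coeff ?p j = (if j \<le> n then c j else 0)" for j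
      by (simp add: coeff_sum coeff_monom)
    have "coeff ?p n \<noteq> 0" using c(1) unfolding co by simp
    then have "?p \<noteq> 0" by (intro notI) simp
    moreover have "ev ?p = 0"
    proof -
      have "degree ?p \<le> n" by (intro degree_le) (simp add: co)
      then have "ev ?p = (\<Sum>i\<le>n. scale (c i) (u i))" by (simp add: ev co)
      then show ?thesis using c by simp
    qed
    ultimately show ?thesis using vs.subspace_0[OF Q0] by (intro exI[of _ ?p]) simp
  qed
  then obtain p0 where "p0 \<noteq> 0 \<and> ev p0 \<in> Q0" by auto
  from ex_has_least_nat[of "\<lambda>p. p \<noteq> 0 \<and> ev p \<in> Q0", OF this, of degree]
  obtain p where p: "p \<noteq> 0" "ev p \<in> Q0"
    and min: "\<And>q. q \<noteq> 0 \<Longrightarrow> ev q \<in> Q0 \<Longrightarrow> degree p \<le> degree q"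
    by auto
  have "degree p > 0"
  proof (rule ccontr)
    assume "\<not> degree p > 0"
    then obtain c where c: "p = [:c:]" by (metis degree_eq_zeroE neq0_conv)
    then have "scale c u0 \<in> Q0" "c \<noteq> 0" using p by (auto simp: ev_def u_def)
    then show False using u0(2) vs.subspace_scale[OF Q0, of "scale c u0" "inverse c"] by simp
  qed
  then obtain b where "poly p b = 0" using alg_closed_imp_poly_has_root by blast
  then obtain q where q: "p = [:-b, 1:] * q" by (meson dvd_def poly_eq_0_iff_dvd)
  then have q0: "q \<noteq> 0" using p(1) by auto
  then have "degree q < degree p" unfolding q by (subst degree_mult_eq) auto
  then have nq: "ev q \<notin> Q0" using min q0 by fastforce
  \<comment> \<open>With \<open>p = (X - b) q\<close>, the vector
    \<open>B (ev (X q)) - b B (ev q)\<close> is \<open>B (ev p)\<close>, which lies in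
    \<open>G\<close> because \<open>ev p \<in> Q0\<close>; modulo \<open>G\<close> the first term
    may be replaced by \<open>A (ev q)\<close>.\<close>
  have "p = pCons 0 q + smult (- b) q" unfolding q by simp
  then have "ev p = ev (pCons 0 q) - scale b (ev q)"
    by (simp only: ev_add ev_smult) simp
  then have "B (ev (pCons 0 q)) - scale b (B (ev q)) \<in> G"
    using BQ0 p(2) by (metis image_subset_iff lB.diff lB.scale)
  from vs.subspace_add[OF G ev_shift[of q] this]
  have "A (ev q) - scale b (B (ev q)) \<in> G" by simp
  then show ?thesis using nq evQ by blast
qed

section \<open>Commuting operators\<close>

context vspace begin

text \<open>For commuting operators this is the span of all their monomials of degree
  \<open>j\<close> applied to \<open>\<phi>\<close>, the degree \<open>j\<close> part of a cyclic
  graded module.\<close>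

primrec op_span :: "('b \<Rightarrow> 'b) \<Rightarrow> ('b \<Rightarrow> 'b) \<Rightarrow> ('b \<Rightarrow> 'b) \<Rightarrow> 'b \<Rightarrow> nat \<Rightarrow> 'b set" where
  "op_span P Z X \<phi> 0 = span {\<phi>}"
| "op_span P Z X \<phi> (Suc j) = span (P ` op_span P Z X \<phi> j \<union> Z ` op_span P Z X \<phi> j \<union> X ` op_span P Z X \<phi> j)"

lemma basis_extend_over:
  assumes "fin_dim W" "subspace V" "V \<subseteq> W"
  shows "\<exists>C. finite C \<and> card C = dim W - dim V \<and> C \<subseteq> W \<and> W \<subseteq> span (V \<union> C)"
proof -
  have fV: "fin_dim V" using fin_dim_subset assms by blast
  obtain B where B: "finite B" "independent B" "B \<subseteq> V" "V \<subseteq> span B" "card B = dim V"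
    using fin_dim_basis[OF fV] by metis
  have "B \<subseteq> W" using B(3) assms(3) by blast
  then obtain D where D: "B \<subseteq> D" "D \<subseteq> W" "independent D" "W \<subseteq> span D"
    using maximal_independent_subset_extend[OF _ B(2), of W] by metis
  have cD: "card D = dim W" using D dim_eq_card_independent basis_card_eq_dim by metis
  obtain E where E: "finite E" "W \<subseteq> span E" using assms(1) unfolding fin_dim_def by blast
  have fD: "finite D" using independent_span_bound[OF E(1) D(3)] D(2) E(2) by blast
  have "card (D - B) = dim W - dim V" using cD B D fD by (simp add: card_Diff_subset)
  moreover have "span D \<subseteq> span (V \<union> (D - B))" using B(3) by (intro span_mono) auto
  ultimately show ?thesis using D(2,4) fD by (intro exI[of _ "D - B"]) auto
qed

end

text \<open>\<open>D'\<close> contains the translate of \<open>D\<close> and also the minimum of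
  \<open>D\<close>, already \<open>card D + 1\<close> elements, so it contains nothing else. Hence
  every element of \<open>D\<close> other than the minimum has its predecessor in \<open>D\<close>,
  and descending from \<open>i\<close> fills the interval.\<close>

lemma shift_interval:
  fixes i :: nat
  assumes D: "D \<subseteq> {..i}" and D': "D' \<subseteq> {..Suc i}" and sub: "D \<subseteq> D'" "Suc ` D \<subseteq> D'"
    and c: "card D' = Suc (card D)" and i: "i \<in> D"
  shows "D = {Suc i - card D..i} \<and> D' = {Suc i - card D..Suc i}"
proof -
  have fD: "finite D" and fD': "finite D'" using D D' finite_subset by auto
  define m where "m = Min D"
  have m: "m \<in> D" "\<And>a. a \<in> D \<Longrightarrow> m \<le> a"
    using fD i unfolding m_def by (blast intro: Min_in, simp)
  have "m \<notin> Suc ` D" using m(2) by force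
  then have "card (insert m (Suc ` D)) = Suc (card D)"
    using fD by (simp add: card_image)
  moreover have "insert m (Suc ` D) \<subseteq> D'" using m sub by auto
  ultimately have D'_eq: "D' = insert m (Suc ` D)" using c fD' by (metis card_subset_eq)
  have down: "a \<in> D \<Longrightarrow> a \<noteq> m \<Longrightarrow> a - 1 \<in> D" for a using sub(1) D'_eq by auto
  have "i - k \<in> D" if "m + k \<le> i" for k
    using that
  proof (induction k)
    case (Suc k)
    then have "i - k \<in> D" "i - k \<noteq> m" by auto
    then show ?case using down[of "i - k"] by simp
  qed (use i in simp)
  note down2 = this
  have "a \<in> D" if "m \<le> a" "a \<le> i" for a using down2[of "i - a"] that by simp
  then have Deq: "D = {m..i}" using m D by auto
  then have "card D = Suc i - m" by simp
  moreover have "m \<le> i" using m(2)[OF i] .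
  ultimately have "m = Suc i - card D" by simp
  moreover have "D' = {m..Suc i}" unfolding D'_eq Deq using \<open>m \<le> i\<close>
    by (auto simp: image_Suc_atLeastAtMost)
  ultimately show ?thesis using Deq by simp
qed

section \<open>Leading exponents of relations modulo the image of one operator\<close>

locale comm_ops = vspace scale for scale :: "'a::field \<Rightarrow> 'b::ab_group_add \<Rightarrow> 'b" (infixr "*s" 75) +
  fixes P Z X :: "'b \<Rightarrow> 'b" and \<phi> :: 'b
  assumes linP: "Vector_Spaces.linear scale scale P"
    and linZ: "Vector_Spaces.linear scale scale Z"
    and linX: "Vector_Spaces.linear scale scale X"
    and PZ: "\<And>u. P (Z u) = Z (P u)" and PX: "\<And>u. P (X u) = X (P u)" and ZX: "\<And>u. Z (X u) = X (Z u)"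
begin

sublocale P: Vector_Spaces.linear scale scale P by (rule linP)
sublocale Z: Vector_Spaces.linear scale scale Z by (rule linZ)
sublocale X: Vector_Spaces.linear scale scale X by (rule linX)
sublocale vspace_pair scale scale by unfold_locales

abbreviation W where "W \<equiv> op_span P Z X \<phi>"

definition PW where "PW i = (case i of 0 \<Rightarrow> {0} | Suc j \<Rightarrow> P ` W j)"

definition r where "r i a = (Z ^^ (i - a)) ((X ^^ a) \<phi>)"

text \<open>\<open>\<Delta> i\<close> consists of the leading exponents of the relations among the monomials \<open>X\<^sup>a Z\<^sup>i\<^sup>-\<^sup>a \<phi>\<close>
  modulo the image of \<open>P\<close>. It is stable under multiplication by \<open>Z\<close> and \<open>X\<close>, so when it grows by a
  single element from \<open>i\<close> to \<open>i + 1\<close> it is an interval.\<close>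

definition \<Delta> where "\<Delta> i = {a. a \<le> i \<and> r i a \<in> span (PW i \<union> r i ` {..<a})}"

lemma PW_simps: "PW 0 = {0}" "PW (Suc j) = P ` W j" by (simp_all add: PW_def)

lemma subspace_W: "subspace (W j)" by (cases j) (auto simp: subspace_span)

lemma fin_dim_W: "fin_dim (W j)"
proof (induction j)
  case (Suc j)
  then show ?case unfolding op_span.simps
    by (intro fin_dim_span fin_dim_Un fin_dim_image linP linZ linX)
qed (auto intro!: fin_dim_span fin_dim_finite[of "{_}"])

lemma P_W: "u \<in> W j \<Longrightarrow> P u \<in> W (Suc j)" by (auto intro: span_base)
lemma Z_W: "u \<in> W j \<Longrightarrow> Z u \<in> W (Suc j)" by (auto intro: span_base)
lemma X_W: "u \<in> W j \<Longrightarrow> X u \<in> W (Suc j)" by (auto intro: span_base)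

lemma W_Suc_subset:
  assumes "subspace S" "P ` W j \<subseteq> S" "Z ` W j \<subseteq> S" "X ` W j \<subseteq> S"
  shows "W (Suc j) \<subseteq> S"
  using assms by (simp add: span_minimal)

lemma subspace_PW: "subspace (PW i)"
  by (cases i) (auto simp: PW_simps subspace_single_0 intro: P.subspace_image subspace_W)

lemma fin_dim_PW: "fin_dim (PW i)"
  by (cases i) (simp_all add: PW_simps fin_dim_finite fin_dim_image[OF linP fin_dim_W])

lemma PW_subset: "PW i \<subseteq> W i"
  by (cases i) (use P_W subspace_0[OF subspace_W] in \<open>auto simp: PW_simps simp del: op_span.simps\<close>)

lemma X_Zpow: "X ((Z ^^ n) u) = (Z ^^ n) (X u)"
  by (induction n) (auto simp: ZX[symmetric])

lemma r_in_W: "a \<le> i \<Longrightarrow> r i a \<in> W i"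
proof -
  have X: "(X ^^ a) \<phi> \<in> W a" for a
  proof (induction a)
    case 0
    then show ?case by (simp add: span_base)
  next
    case (Suc a)
    then show ?case using X_W by (simp del: op_span.simps)
  qed
  have "(Z ^^ n) ((X ^^ a) \<phi>) \<in> W (n + a)" for n
  proof (induction n)
    case 0
    then show ?case using X by simp
  next
    case (Suc n)
    then show ?case using Z_W by (simp del: op_span.simps)
  qed
  from this[of "i - a"] show "a \<le> i \<Longrightarrow> r i a \<in> W i" by (simp add: r_def)
qed

lemma Z_r: "a \<le> i \<Longrightarrow> Z (r i a) = r (Suc i) a"
  by (simp add: r_def Suc_diff_le)

lemma X_r: "a \<le> i \<Longrightarrow> X (r i a) = r (Suc i) (Suc a)"
  by (simp add: r_def X_Zpow)

lemma Z_PW: "Z ` PW i \<subseteq> PW (Suc i)"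
proof (cases i)
  case 0
  then show ?thesis using subspace_0[OF subspace_PW[of 1]] by (simp add: PW_simps Z.zero)
next
  case (Suc j)
  show ?thesis
  proof
    fix x assume "x \<in> Z ` PW i"
    then obtain u where "u \<in> W j" "x = Z (P u)" by (auto simp: Suc PW_simps)
    then show "x \<in> PW (Suc i)"
      unfolding PW_simps Suc using Z_W[of u j] by (intro image_eqI[of _ _ "Z u"]) (auto simp: PZ)
  qed
qed

lemma X_PW: "X ` PW i \<subseteq> PW (Suc i)"
proof (cases i)
  case 0
  then show ?thesis using subspace_0[OF subspace_PW[of 1]] by (simp add: PW_simps X.zero)
next
  case (Suc j)
  show ?thesis
  proof
    fix x assume "x \<in> X ` PW i"
    then obtain u where "u \<in> W j" "x = X (P u)" by (auto simp: Suc PW_simps)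
    then show "x \<in> PW (Suc i)"
      unfolding PW_simps Suc using X_W[of u j] by (intro image_eqI[of _ _ "X u"]) (auto simp: PX)
  qed
qed

lemma W_eq: "W i = span (PW i \<union> r i ` {..<Suc i})"
proof
  show "span (PW i \<union> r i ` {..<Suc i}) \<subseteq> W i"
    using PW_subset r_in_W by (intro span_minimal subspace_W) (auto simp: less_Suc_eq_le)
  show "W i \<subseteq> span (PW i \<union> r i ` {..<Suc i})"
  proof (induction i)
    case 0
    have "\<phi> = r 0 0" by (simp add: r_def)
    then show ?case by (simp add: PW_simps span_mono)
  next
    case (Suc i)
    let ?S = "span (PW (Suc i) \<union> r (Suc i) ` {..<Suc (Suc i)})"
    have "P ` W i \<subseteq> ?S" using PW_simps(2) span_superset by fastforce
    moreover have "Z ` W i \<subseteq> ?S"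
    proof -
      have "Z ` (PW i \<union> r i ` {..<Suc i}) \<subseteq> ?S"
        using Z_PW[of i] by (auto simp: Z_r less_Suc_eq_le intro!: span_base)
      then show ?thesis using linear_span_subset[OF linZ _ subspace_span] Suc by blast
    qed
    moreover have "X ` W i \<subseteq> ?S"
    proof -
      have "X ` (PW i \<union> r i ` {..<Suc i}) \<subseteq> ?S"
        using X_PW[of i] by (auto simp: X_r less_Suc_eq_le intro!: span_base)
      then show ?thesis using linear_span_subset[OF linX _ subspace_span] Suc by blast
    qed
    ultimately show ?case by (intro W_Suc_subset subspace_span)
  qed
qed

lemma \<Delta>_subset: "\<Delta> i \<subseteq> {..i}" by (auto simp: \<Delta>_def)

lemma finite_\<Delta>: "finite (\<Delta> i)" using \<Delta>_subset finite_subset by blast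

text \<open>The monomials \<open>r i a\<close> with \<open>a\<close> outside
  \<open>\<Delta> i\<close> form a basis of \<open>W i\<close> modulo \<open>PW i\<close>; so
  \<open>Suc i - card (\<Delta> i)\<close> is the Hilbert function of the quotient by
  \<open>P\<close>.\<close>

lemma dim_W: "dim (W i) + card (\<Delta> i) = dim (PW i) + Suc i"
proof -
  have "dim (W i) = dim (PW i) + card {a. a < Suc i \<and> r i a \<notin> span (PW i \<union> r i ` {..<a})}"
    unfolding W_eq dim_span by (rule dim_Un_sequence[OF fin_dim_PW])
  moreover have "{a. a < Suc i \<and> r i a \<notin> span (PW i \<union> r i ` {..<a})} = {..i} - \<Delta> i"
    by (auto simp: \<Delta>_def)
  moreover have "card ({..i} - \<Delta> i) = Suc i - card (\<Delta> i)"
    using \<Delta>_subset finite_\<Delta> by (simp add: card_Diff_subset)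
  moreover have "card (\<Delta> i) \<le> Suc i" using card_mono[OF _ \<Delta>_subset[of i]] by simp
  ultimately show ?thesis by simp
qed

lemma \<Delta>_step: "\<Delta> i \<subseteq> \<Delta> (Suc i)" "Suc ` \<Delta> i \<subseteq> \<Delta> (Suc i)"
proof -
  have 1: "Z x \<in> span (PW (Suc i) \<union> r (Suc i) ` {..<a})"
    if "x \<in> span (PW i \<union> r i ` {..<a})" "a \<le> i" for a x
  proof -
    have "Z ` (PW i \<union> r i ` {..<a}) \<subseteq> span (PW (Suc i) \<union> r (Suc i) ` {..<a})"
      using Z_PW[of i] that(2) by (auto simp: Z_r intro!: span_base)
    then show ?thesis using linear_span_subset[OF linZ _ subspace_span] that by blast
  qed
  have 2: "X x \<in> span (PW (Suc i) \<union> r (Suc i) ` {..<Suc a})"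
    if "x \<in> span (PW i \<union> r i ` {..<a})" "a \<le> i" for a x
  proof -
    have "X ` (PW i \<union> r i ` {..<a}) \<subseteq> span (PW (Suc i) \<union> r (Suc i) ` {..<Suc a})"
      using X_PW[of i] that(2) by (auto simp: X_r intro!: span_base)
    then show ?thesis using linear_span_subset[OF linX _ subspace_span] that by blast
  qed
  show "\<Delta> i \<subseteq> \<Delta> (Suc i)" using 1 by (force simp: \<Delta>_def Z_r)
  show "Suc ` \<Delta> i \<subseteq> \<Delta> (Suc i)" using 2 by (force simp: \<Delta>_def X_r)
qed

text \<open>Macaulay's bound in two variables: the minimum of \<open>\<Delta> i\<close> is not the
  successor of an element, so it comes in addition to the translate of
  \<open>\<Delta> i\<close>.\<close>

lemma card_\<Delta>_step: "\<Delta> i \<noteq> {} \<Longrightarrow> card (\<Delta> i) < card (\<Delta> (Suc i))"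
proof -
  assume ne: "\<Delta> i \<noteq> {}"
  let ?m = "Min (\<Delta> i)"
  have m: "?m \<in> \<Delta> i" "\<And>a. a \<in> \<Delta> i \<Longrightarrow> ?m \<le> a" using ne finite_\<Delta> by auto
  have "?m \<notin> Suc ` \<Delta> i" using m(2) by force
  then have "card (insert ?m (Suc ` \<Delta> i)) = Suc (card (\<Delta> i))"
    using finite_\<Delta> by (simp add: card_image)
  moreover have "insert ?m (Suc ` \<Delta> i) \<subseteq> \<Delta> (Suc i)" using m \<Delta>_step by blast
  ultimately show ?thesis by (metis card_mono finite_\<Delta> less_eq_Suc_le)
qed

text \<open>The same codimension \<open>d\<close> in two successive degrees means that
  \<open>\<Delta>\<close> grows by a single element, the least growth possible. The hypothesis
  \<open>i \<in> \<Delta> i\<close>, arranged by a change of coordinates, fixes the upper end of the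
  interval.\<close>

lemma \<Delta>_interval:
  assumes "dim (W i) = dim (PW i) + d" "dim (W (Suc i)) = dim (PW (Suc i)) + d" "i \<in> \<Delta> i"
  shows "\<Delta> i = {d..i}" "\<Delta> (Suc i) = {d..Suc i}"
proof -
  have c: "card (\<Delta> i) = Suc i - d" "d \<le> Suc i" "card (\<Delta> (Suc i)) = Suc (card (\<Delta> i))"
    using dim_W[of i] dim_W[of "Suc i"] assms by auto
  have "Suc i - card (\<Delta> i) = d" using c by simp
  then show "\<Delta> i = {d..i}" "\<Delta> (Suc i) = {d..Suc i}"
    using shift_interval[OF \<Delta>_subset \<Delta>_subset \<Delta>_step c(3) assms(3)] by simp_all
qed

lemma W_eq_interval:
  assumes "\<Delta> i = {d..i}" "d \<le> i"
  shows "W i = span (PW i \<union> r i ` {..<d})"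
proof
  show "span (PW i \<union> r i ` {..<d}) \<subseteq> W i"
    using PW_subset r_in_W assms(2) by (intro span_minimal subspace_W) auto
  have *: "r i a \<in> span (PW i \<union> r i ` {..<d})" if "a < Suc i" for a
  proof (rule sequence_in_span[OF _ that])
    fix a assume "d \<le> a" "a < Suc i"
    then have "a \<in> \<Delta> i" using assms(1) by simp
    then show "r i a \<in> span (PW i \<union> r i ` {..<a})" by (simp add: \<Delta>_def)
  qed
  show "W i \<subseteq> span (PW i \<union> r i ` {..<d})"
    unfolding W_eq using * by (intro span_minimal subspace_span) (auto intro: span_base)
qed

text \<open>\<open>Z\<close> is injective modulo the image of \<open>P\<close>: the basis
  \<open>r i a\<close>, \<open>a < d\<close>, of the quotient in degree \<open>i\<close> goes to the
  elements \<open>r (Suc i) a\<close>, which are still independent in the next degree because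
  \<open>\<Delta>\<close> begins at \<open>d\<close> there too.\<close>

lemma Z_reflects_PW:
  assumes "\<Delta> i = {d..i}" "\<Delta> (Suc i) = {d..Suc i}" "d \<le> i" "u \<in> W i" "Z u \<in> PW (Suc i)"
  shows "u \<in> PW i"
proof -
  have "u \<in> span (PW i \<union> r i ` {..<d})" using assms W_eq_interval by simp
  then obtain p c where p: "p \<in> PW i" "u = p + (\<Sum>a<d. c a *s r i a)"
    using span_Un_image_explicit[OF subspace_PW] by metis
  have "Z u = Z p + (\<Sum>a<d. c a *s r (Suc i) a)"
    using assms(3) by (simp add: p(2) Z.add Z.sum Z.scale Z_r)
  moreover have "Z p \<in> PW (Suc i)" using Z_PW p(1) by blast
  ultimately have "(\<Sum>a<d. c a *s r (Suc i) a) \<in> PW (Suc i)"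
    using assms(5) subspace_diff[OF subspace_PW, of "Z u" "Suc i" "Z p"] by simp
  moreover have "r (Suc i) a \<notin> span (PW (Suc i) \<union> r (Suc i) ` {..<a})" if "a < d" for a
  proof
    assume "r (Suc i) a \<in> span (PW (Suc i) \<union> r (Suc i) ` {..<a})"
    then have "a \<in> \<Delta> (Suc i)" using that assms(3) by (simp add: \<Delta>_def)
    then show False using that assms(2) by simp
  qed
  ultimately have "\<forall>a<d. c a = 0" by (intro sequence_independent_mod[OF subspace_PW])
  then show ?thesis using p by simp
qed

end

section \<open>Linear changes of coordinates\<close>

context comm_ops begin

lemma linear_shift: "Vector_Spaces.linear scale scale (\<lambda>u. Z u - s *s X u)"
  by unfold_locales
    (simp_all add: Z.add X.add Z.scale X.scale scale_right_distrib scale_right_diff_distrib scale_left_commute)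

lemma linear_shift_P: "Vector_Spaces.linear scale scale (\<lambda>u. Z u - s *s P u)"
  by unfold_locales
    (simp_all add: Z.add P.add Z.scale P.scale scale_right_distrib scale_right_diff_distrib scale_left_commute)

lemma comm_ops_shift: "comm_ops scale P (\<lambda>u. Z u - s *s X u) X"
proof (rule comm_ops.intro)
  show "comm_ops_axioms scale P (\<lambda>u. Z u - s *s X u) X"
    by (intro comm_ops_axioms.intro linear_shift linP linX)
      (simp_all add: P.diff X.diff P.scale X.scale Z.scale PZ PX ZX)
qed unfold_locales

text \<open>The roles are exchanged here: \<open>Z - s P\<close> becomes the operator whose image is
  factored out, and \<open>P\<close> takes the place of \<open>Z\<close>.\<close>

lemma comm_ops_shift_P: "comm_ops scale (\<lambda>u. Z u - s *s P u) P X"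
proof (rule comm_ops.intro)
  show "comm_ops_axioms scale (\<lambda>u. Z u - s *s P u) P X"
    by (intro comm_ops_axioms.intro linear_shift_P linP linX)
      (simp_all add: P.diff X.diff P.scale X.scale Z.scale PZ PX ZX)
qed unfold_locales

lemma op_span_shift_aux:
  assumes Q: "Q = P \<or> Q = X"
  shows "op_span P (\<lambda>u. Z u - s *s Q u) X \<phi> j = W j"
proof (induction j)
  case (Suc j)
  let ?V = "W j"
  show ?case unfolding op_span.simps Suc
  proof (intro subset_antisym span_minimal subspace_span)
    show "P ` ?V \<union> (\<lambda>u. Z u - s *s Q u) ` ?V \<union> X ` ?V \<subseteq> span (P ` ?V \<union> Z ` ?V \<union> X ` ?V)"
      using Q by (auto intro!: span_diff span_scale intro: span_base)
    let ?S = "span (P ` ?V \<union> (\<lambda>u. Z u - s *s Q u) ` ?V \<union> X ` ?V)"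
    have "Z u \<in> ?S" if "u \<in> ?V" for u
    proof -
      have "(Z u - s *s Q u) + s *s Q u \<in> ?S"
        using that Q by (intro span_add span_scale) (auto intro!: span_base)
      then show ?thesis by simp
    qed
    then show "P ` ?V \<union> Z ` ?V \<union> X ` ?V \<subseteq> ?S" by (auto intro!: span_base[of "P _"] span_base[of "X _"])
  qed
qed simp

lemma op_span_swap: "op_span P Z X \<phi> j = op_span Z P X \<phi> j"
  by (induction j) (simp_all add: Un_commute)

lemma op_span_shift: "op_span P (\<lambda>u. Z u - s *s X u) X \<phi> j = W j"
  by (rule op_span_shift_aux) simp

lemma op_span_shift_P: "op_span (\<lambda>u. Z u - s *s P u) P X \<phi> j = W j"
  using comm_ops.op_span_swap[OF comm_ops_shift_P] op_span_shift_aux[of P s j] by simp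

text \<open>After a general change of coordinates \<open>Z \<mapsto> Z - s X\<close> the leading monomial of a relation is a
  power of \<open>X\<close>.\<close>

lemma shift_top_in_\<Delta>:
  assumes "\<Delta> (Suc m) \<noteq> {}" "infinite (UNIV :: 'a set)"
  shows "\<exists>s. Suc m \<in> comm_ops.\<Delta> scale P (\<lambda>u. Z u - s *s X u) X \<phi> (Suc m)"
proof -
  let ?i = "Suc m"
  obtain a0 where a0: "a0 \<le> ?i" "r ?i a0 \<in> span (PW ?i \<union> r ?i ` {..<a0})"
    using assms(1) unfolding \<Delta>_def by auto
  obtain p0 c where p0: "p0 \<in> PW ?i" "r ?i a0 = p0 + (\<Sum>a<a0. c a *s r ?i a)"
    using span_Un_image_explicit[OF subspace_PW a0(2)] by blast
  define \<mu> where "\<mu> a = (if a = a0 then 1 else if a < a0 then - c a else 0)" for a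
  have "(\<Sum>a\<le>?i. \<mu> a *s r ?i a) = (\<Sum>a\<in>{..a0}. \<mu> a *s r ?i a)"
    using a0(1) by (intro sum.mono_neutral_right) (auto simp: \<mu>_def)
  also have "\<dots> = (\<Sum>a<a0. \<mu> a *s r ?i a) + r ?i a0"
    by (simp add: \<mu>_def flip: lessThan_Suc_atMost)
  also have "(\<Sum>a<a0. \<mu> a *s r ?i a) = (\<Sum>a<a0. - (c a *s r ?i a))"
    by (intro sum.cong) (auto simp: \<mu>_def)
  also have "\<dots> + r ?i a0 = p0" using p0(2) by (simp add: sum_negf)
  finally have rel: "(\<Sum>a\<le>?i. \<mu> a *s r ?i a) = p0" .
  \<comment> \<open>Modulo the image of \<open>Z - s X\<close>, each \<open>r ?i a\<close> becomes
    \<open>s ^ (?i - a)\<close> times the pure power of \<open>X\<close>. So the relation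
    \<open>rel\<close> turns into \<open>poly q s\<close> times that power, and any \<open>s\<close>
    off the finitely many roots of \<open>q\<close> puts the pure power among the leading
    monomials.\<close>
  define q where "q = (\<Sum>a\<le>?i. monom (\<mu> a) (?i - a))"
  have "coeff q (?i - a0) = (\<Sum>a\<le>?i. if a = a0 then \<mu> a else 0)"
    unfolding q_def coeff_sum coeff_monom using a0(1) by (intro sum.cong) auto
  also have "\<dots> = 1" using a0(1) by (simp add: \<mu>_def)
  finally have "coeff q (?i - a0) = 1" .
  then have "q \<noteq> 0" by (intro notI) simp
  then have "finite {x. poly q x = 0}" by (rule poly_roots_finite)
  then obtain s where s: "poly q s \<noteq> 0" using assms(2) by (metis (mono_tags) ex_new_if_finite mem_Collect_eq)
  have q_s: "poly q s = (\<Sum>a\<le>?i. \<mu> a * s ^ (?i - a))" by (simp add: q_def poly_sum poly_monom)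
  let ?Y = "\<lambda>u. Z u - s *s X u"
  interpret Y: comm_ops scale P ?Y X \<phi> by (rule comm_ops_shift)
  have PWeq: "Y.PW j = PW j" for j
    by (cases j) (simp_all add: Y.PW_simps PW_simps op_span_shift del: op_span.simps)
  let ?S = "span (PW ?i \<union> Y.r ?i ` {..<?i})"
  have YS: "?Y u \<in> ?S" if "u \<in> W m" for u
  proof -
    have "u \<in> span (Y.PW m \<union> Y.r m ` {..<Suc m})" using that Y.W_eq[of m] by (simp add: op_span_shift)
    moreover have "?Y ` (Y.PW m \<union> Y.r m ` {..<Suc m}) \<subseteq> ?S"
      using Y.Z_PW[of m] by (auto simp: Y.Z_r PWeq less_Suc_eq_le intro!: span_base)
    then have "?Y ` span (Y.PW m \<union> Y.r m ` {..<Suc m}) \<subseteq> ?S"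
      by (rule linear_span_subset[OF linear_shift _ subspace_span])
    ultimately show ?thesis by (simp add: image_subset_iff)
  qed
  let ?t = "(X ^^ ?i) \<phi>"
  have diff: "(Z ^^ k) ((X ^^ a) \<phi>) - s ^ k *s ?t \<in> ?S" if "k + a = ?i" for k a
    using that
  proof (induction k arbitrary: a)
    case 0
    then show ?case using span_zero by simp
  next
    case (Suc k)
    let ?v = "(Z ^^ k) ((X ^^ a) \<phi>)"
    have "?v = r m a" "a \<le> m" using Suc.prems by (auto simp: r_def)
    then have "?Y ?v \<in> ?S" using YS r_in_W by metis
    moreover have "(Z ^^ k) ((X ^^ Suc a) \<phi>) - s ^ k *s ?t \<in> ?S"
      using Suc.prems by (intro Suc.IH) simp
    then have "s *s ((Z ^^ k) ((X ^^ Suc a) \<phi>) - s ^ k *s ?t) \<in> ?S" by (rule span_scale)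
    ultimately have "?Y ?v + s *s ((Z ^^ k) ((X ^^ Suc a) \<phi>) - s ^ k *s ?t) \<in> ?S" by (rule span_add)
    then show ?case by (simp add: X_Zpow scale_right_diff_distrib)
  qed
  have "(\<Sum>a\<le>?i. \<mu> a *s (r ?i a - s ^ (?i - a) *s ?t)) \<in> ?S"
    unfolding r_def by (intro span_sum span_scale diff) simp
  moreover have "(\<Sum>a\<le>?i. \<mu> a *s (r ?i a - s ^ (?i - a) *s ?t)) = p0 - poly q s *s ?t"
    by (simp add: scale_right_diff_distrib sum_subtractf rel q_s scale_sum_left del: sum.atMost_Suc)
  moreover have "p0 \<in> ?S" using p0(1) by (intro span_base) simp
  ultimately have "p0 - (p0 - poly q s *s ?t) \<in> ?S" by (metis span_diff)
  then have "poly q s *s ?t \<in> ?S" by simp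
  from span_scale[OF this, of "inverse (poly q s)"] have "?t \<in> ?S" using s by simp
  then have "Y.r ?i ?i \<in> span (Y.PW ?i \<union> Y.r ?i ` {..<?i})" by (simp add: Y.r_def PWeq)
  then have "?i \<in> Y.\<Delta> ?i" unfolding Y.\<Delta>_def by simp
  then show ?thesis by blast
qed

end

section \<open>Monomials of a plane curve, and the common eigenvector\<close>

context comm_ops begin

text \<open>\<open>low d j\<close> is spanned by the monomials \<open>P\<^sup>k Z\<^sup>c X\<^sup>a \<phi>\<close> with \<open>k + c + a = j\<close> and \<open>a < d\<close>.\<close>

primrec low where
  "low d 0 = span (r 0 ` {..<min d 1})"
| "low d (Suc j) = span (P ` low d j \<union> r (Suc j) ` {..<min d (Suc (Suc j))})"

lemma subspace_low: "subspace (low d j)" by (cases j) (auto simp: subspace_span)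

lemma low_subset_W: "low d j \<subseteq> W j"
proof (induction j)
  case 0
  have "r 0 ` {..<min d 1} \<subseteq> W 0" using r_in_W[of _ 0] by (auto simp del: op_span.simps)
  then show ?case unfolding low.simps by (intro span_minimal subspace_W)
next
  case (Suc j)
  have "P ` low d j \<union> r (Suc j) ` {..<min d (Suc (Suc j))} \<subseteq> W (Suc j)"
    using Suc r_in_W[of _ "Suc j"] P_W[of _ j] by (auto simp del: op_span.simps low.simps)
  then show ?case unfolding low.simps by (intro span_minimal subspace_W)
qed

lemma fin_dim_low: "fin_dim (low d j)"
  using fin_dim_subset[OF fin_dim_W low_subset_W] .

lemma dim_low_Suc: "dim (low d (Suc j)) \<le> dim (low d j) + min d (Suc (Suc j))"
proof -
  have "dim (low d (Suc j)) \<le> dim (P ` low d j) + card {..<min d (Suc (Suc j))}"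
    unfolding low.simps dim_span dim_Un_sequence[OF fin_dim_image[OF linP fin_dim_low]]
    by (intro add_left_mono card_mono) auto
  then show ?thesis using dim_image_le_fin_dim[OF linP fin_dim_low[of d j]] by simp
qed

text \<open>The bound is the Hilbert function of a plane curve of degree \<open>d\<close>: if its
  equation is monic in \<open>X\<close>, the monomials with \<open>X\<close>-exponent below
  \<open>d\<close> are a basis of the coordinate ring.\<close>

lemma dim_low: "dim (low d j) \<le> (\<Sum>l\<le>j. min d (Suc l))"
proof (induction j)
  case 0
  have "dim (low d 0) \<le> card (r 0 ` {..<min d 1})" by (simp add: dim_le_card')
  also have "\<dots> \<le> min d 1" using card_image_le[of "{..<min d 1}" "r 0"] by simp
  finally show ?case by simp
next
  case (Suc j)
  then show ?case using dim_low_Suc[of d j] by simp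
qed

lemma r_in_low: "a < d \<Longrightarrow> a \<le> j \<Longrightarrow> r j a \<in> low d j"
  by (cases j) (auto intro!: span_base)

lemma P_low: "u \<in> low d j \<Longrightarrow> P u \<in> low d (Suc j)"
  by (auto intro: span_base)

lemma Z_low: "u \<in> low d j \<Longrightarrow> Z u \<in> low d (Suc j)"
proof (induction j arbitrary: u)
  case 0
  have "Z ` r 0 ` {..<min d 1} \<subseteq> low d (Suc 0)"
    by (auto simp: Z_r simp del: low.simps intro!: r_in_low)
  from linear_span_subset[OF linZ this subspace_low] show ?case
    using 0 by (simp only: low.simps(1) image_subset_iff)
next
  case (Suc j)
  have "Z ` (P ` low d j \<union> r (Suc j) ` {..<min d (Suc (Suc j))}) \<subseteq> low d (Suc (Suc j))"
  proof -
    have "Z (P u) \<in> low d (Suc (Suc j))" if "u \<in> low d j" for u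
      using P_low[OF Suc.IH[OF that]] by (simp only: PZ)
    moreover have "Z (r (Suc j) a) \<in> low d (Suc (Suc j))" if "a < d" "a < Suc (Suc j)" for a
    proof -
      have "Z (r (Suc j) a) = r (Suc (Suc j)) a" using that by (simp add: Z_r)
      then show ?thesis using that r_in_low[of a d "Suc (Suc j)"] by simp
    qed
    ultimately show ?thesis by (auto simp del: low.simps)
  qed
  from linear_span_subset[OF linZ this subspace_low] show ?case
    using Suc.prems by (simp only: low.simps(2) image_subset_iff)
qed

text \<open>The condition on the exponent of \<open>X\<close> is symmetric in \<open>P\<close> and
  \<open>Z\<close>. The vectors here are the monomials \<open>r\<close> of the system in which these
  two operators have exchanged roles.\<close>

lemma P_pow_in_low: "a < d \<Longrightarrow> a \<le> j \<Longrightarrow> (P ^^ (j - a)) ((X ^^ a) \<phi>) \<in> low d j"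
proof (induction j)
  case (Suc j)
  show ?case
  proof (cases "a = Suc j")
    case True
    then show ?thesis using r_in_low[of a d "Suc j"] Suc.prems by (simp add: r_def)
  next
    case False
    then have "(P ^^ (j - a)) ((X ^^ a) \<phi>) \<in> low d j" using Suc by simp
    from P_low[OF this] show ?thesis using False Suc.prems by (simp add: Suc_diff_le del: low.simps)
  qed
qed (use r_in_low[of 0 d 0] in \<open>simp add: r_def\<close>)

lemma subspace_kernel_on:
  assumes "Vector_Spaces.linear scale scale T" "subspace V"
  shows "subspace {v \<in> V. T v = 0}"
proof -
  interpret T: Vector_Spaces.linear scale scale T by fact
  show ?thesis using assms(2) unfolding subspace_def by (auto simp: T.zero T.add T.scale)
qed

end

text \<open>By \<open>int\<close>, \<open>Y\<close> maps \<open>W m\<close> into the image of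
  \<open>P\<close> modulo \<open>low\<close>, so \<open>Y\<close> and \<open>P\<close> form a pencil
  on \<open>W m\<close> modulo \<open>low\<close>, a nonzero space by \<open>big\<close>. For an
  eigenvalue \<open>b\<close>, the operator \<open>Y - b P\<close> sends \<open>low\<close> and one
  further vector into \<open>low\<close>. Its image therefore adds at most
  \<open>dim (W m) - dim (low d m) - 1\<close> to \<open>low d (Suc m)\<close>, which itself gains
  at most \<open>d\<close> over \<open>low d m\<close>: one dimension short of
  \<open>W (Suc m)\<close>.\<close>

lemma pencil_dimension:
  fixes scale :: "'k::{alg_closed_field, field_char_0} \<Rightarrow> 'b::ab_group_add \<Rightarrow> 'b" (infixr "*s" 75)
    and \<phi> :: 'b
  assumes "comm_ops scale P Y X"
  defines "W \<equiv> vspace.op_span scale P Y X \<phi>"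
  assumes int: "comm_ops.\<Delta> scale P Y X \<phi> (Suc m) = {d..Suc m}"
    and d: "d \<le> Suc m" "d \<le> m"
    and dim: "vector_space.dim scale (W (Suc m)) = vector_space.dim scale (W m) + d"
    and big: "vector_space.dim scale (W m) > (\<Sum>l\<le>m. min d (Suc l))"
  shows "\<exists>b. \<not> W (Suc m) \<subseteq> module.span scale ((\<lambda>u. Y u - b *s P u) ` W m \<union> comm_ops.low scale P Y X \<phi> d (Suc m))"
proof -
  interpret Y: comm_ops scale P Y X \<phi> by fact
  let ?L = "Y.low d"
  have W: "Y.W = W" by (simp add: W_def)
  have "?L m \<noteq> W m" using Y.dim_low[of d m] big unfolding W_def by auto
  then obtain u0 where u0: "u0 \<in> W m" "u0 \<notin> ?L m" using Y.low_subset_W[of d m] unfolding W by blast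
  have step: "\<exists>v\<in>W m. Y u - P v \<in> ?L (Suc m)" if "u \<in> W m" for u
  proof -
    have "Y u \<in> Y.span (Y.PW (Suc m) \<union> Y.r (Suc m) ` {..<d})"
      using Y.Z_W[of u m] Y.W_eq_interval[OF int d(1)] that unfolding W by simp
    then obtain p c where p: "p \<in> Y.PW (Suc m)" "Y u = p + (\<Sum>a<d. c a *s Y.r (Suc m) a)"
      using Y.span_Un_image_explicit[OF Y.subspace_PW] by metis
    from p(1) obtain v where v: "v \<in> W m" "p = P v" unfolding Y.PW_simps W by auto
    have "(\<Sum>a<d. c a *s Y.r (Suc m) a) \<in> ?L (Suc m)"
      using d by (intro Y.subspace_sum[OF Y.subspace_low] Y.subspace_scale[OF Y.subspace_low] Y.r_in_low) auto
    then show ?thesis using v p(2) by (intro bexI[of _ v]) auto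
  qed
  have vs: "vspace scale" by unfold_locales
  have PL: "P ` ?L m \<subseteq> ?L (Suc m)" using Y.P_low[of _ d m] by (auto simp del: Y.low.simps)
  from pencil_eigenvector[OF vs Y.linZ Y.linP Y.subspace_W[of m, unfolded W] Y.fin_dim_W[of m, unfolded W]
      Y.subspace_low Y.subspace_low u0 step PL]
  obtain b u where u: "u \<in> W m" "u \<notin> ?L m" "Y u - b *s P u \<in> ?L (Suc m)" by auto
  define T where "T = (\<lambda>u. Y u - b *s P u)"
  have linT: "Vector_Spaces.linear scale scale T" unfolding T_def by (rule Y.linear_shift_P)
  interpret T: Vector_Spaces.linear scale scale T by (rule linT)
  have TL: "T v \<in> ?L (Suc m)" if "v \<in> ?L m" for v
    unfolding T_def using that Y.subspace_low
    by (intro Y.subspace_diff Y.subspace_scale Y.Z_low Y.P_low)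
  let ?V = "Y.span (insert u (?L m))"
  have Vsub: "?V \<subseteq> W m"
    using u(1) Y.low_subset_W[of d m] by (intro Y.span_minimal Y.subspace_W[of m, unfolded W]) (auto simp: W)
  have dimV: "Y.dim ?V = Suc (Y.dim (?L m))"
    using Y.dim_insert_fin_dim[OF Y.fin_dim_low, of u d m] u(2)
    by (simp add: Y.span_eq_iff[THEN iffD2, OF Y.subspace_low])
  obtain C where C: "finite C" "card C = Y.dim (W m) - Y.dim ?V" "W m \<subseteq> Y.span (?V \<union> C)"
    using Y.basis_extend_over[OF Y.fin_dim_W[of m, unfolded W] Y.subspace_span Vsub] by blast
  let ?S = "Y.span (?L (Suc m) \<union> T ` C)"
  have "T ` insert u (?L m) \<subseteq> ?S"
  proof -
    have "T u \<in> ?L (Suc m)" using u(3) by (simp add: T_def del: Y.low.simps)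
    then show ?thesis using TL by (auto simp del: Y.low.simps intro: Y.span_base)
  qed
  then have "T ` ?V \<subseteq> ?S" by (rule Y.linear_span_subset[OF linT _ Y.subspace_span])
  then have "T ` (?V \<union> C) \<subseteq> ?S" by (auto intro: Y.span_base)
  from Y.linear_span_subset[OF linT this Y.subspace_span]
  have TW: "T ` W m \<subseteq> ?S" using C(3) by blast
  show ?thesis
  proof (intro exI notI)
    assume "W (Suc m) \<subseteq> Y.span ((\<lambda>u. Y u - b *s P u) ` W m \<union> ?L (Suc m))"
    also have "\<dots> \<subseteq> ?S"
      using TW unfolding T_def[symmetric]
      by (intro Y.span_minimal Y.subspace_span) (auto simp del: Y.low.simps intro: Y.span_base)
    finally have "Y.dim (W (Suc m)) \<le> Y.dim (?L (Suc m) \<union> T ` C)"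
      using C(1) by (intro Y.dim_mono_fin_dim Y.fin_dim_Un Y.fin_dim_low Y.fin_dim_finite) auto
    also have "\<dots> \<le> Y.dim (?L (Suc m)) + card C"
    proof -
      obtain f where f: "C = f ` {..<card C}"
        using C(1) by (metis bij_betw_imp_surj_on ex_bij_betw_nat_finite lessThan_atLeast0)
      have "T ` C = (T \<circ> f) ` {..<card C}" using f by (metis image_comp)
      then have "Y.dim (?L (Suc m) \<union> T ` C) = Y.dim (?L (Suc m)) +
          card {a. a < card C \<and> (T \<circ> f) a \<notin> Y.span (?L (Suc m) \<union> (T \<circ> f) ` {..<a})}"
        using Y.dim_Un_sequence[OF Y.fin_dim_low, of d "Suc m" "T \<circ> f" "card C"] by simp
      also have "\<dots> \<le> Y.dim (?L (Suc m)) + card {..<card C}"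
        by (intro add_left_mono card_mono) auto
      finally show ?thesis by simp
    qed
    also have "\<dots> \<le> Y.dim (?L m) + d + card C"
      using Y.dim_low_Suc[of d m] by simp
    finally have "Y.dim (W m) + d \<le> Y.dim (?L m) + d + card C" using dim by simp
    moreover have "Suc (Y.dim (?L m)) \<le> Y.dim (W m)"
      using Y.dim_mono_fin_dim[OF Y.fin_dim_W[of m, unfolded W] order_trans[OF Vsub Y.span_superset]] dimV
      by simp
    ultimately show False using C(2) dimV by linarith
  qed
qed

text \<open>The hypothesis \<open>big\<close> says that \<open>W m\<close> is too large for a plane
  curve of degree \<open>d\<close>. Let \<open>T\<close> be \<open>Y - b P\<close> for the
  eigenvalue of \<open>pencil_dimension\<close>. If \<open>T\<close> were injective on
  \<open>W m\<close>, it could replace \<open>P\<close>, and extremal growth would make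
  \<open>W (Suc m)\<close> the sum of the image of \<open>T\<close> and \<open>low\<close>, which
  was excluded. A second pencil on the kernel of \<open>T\<close> gives the joint
  eigenvector.\<close>

theorem common_eigenvector:
  fixes scale :: "'k::{alg_closed_field, field_char_0} \<Rightarrow> 'b::ab_group_add \<Rightarrow> 'b" (infixr "*s" 75)
    and \<phi> :: 'b
  assumes "comm_ops scale P Z X"
  defines "W \<equiv> vspace.op_span scale P Z X \<phi>"
  assumes inj: "\<And>j u. j \<le> Suc m \<Longrightarrow> u \<in> W j \<Longrightarrow> P u = 0 \<Longrightarrow> u = 0"
    and d: "d \<le> m"
    and dim1: "vector_space.dim scale (W (Suc m)) = vector_space.dim scale (W m) + d"
    and dim2: "vector_space.dim scale (W (Suc (Suc m))) = vector_space.dim scale (W (Suc m)) + d"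
    and big: "vector_space.dim scale (W m) > (\<Sum>l\<le>m. min d (Suc l))"
  shows "\<exists>w\<in>W m. w \<noteq> 0 \<and> (\<exists>a b. X w = a *s P w \<and> Z w = b *s P w)"
proof -
  let ?i = "Suc m"
  interpret Z: comm_ops scale P Z X \<phi> by fact
  have W: "Z.W = W" by (simp add: W_def)
  have dimP: "Z.dim (P ` W j) = Z.dim (W j)" if "j \<le> ?i" for j
    using inj[OF that] Z.subspace_W[of j] Z.fin_dim_W[of j] unfolding W
    by (intro Z.dim_image_eq_fin_dim[OF Z.linP])
  have "card (Z.\<Delta> ?i) > 0"
    using Z.dim_W[of ?i] d dimP[of m] dim1 unfolding Z.PW_simps W by simp
  then have "Z.\<Delta> ?i \<noteq> {}" by auto
  from Z.shift_top_in_\<Delta>[OF this infinite_UNIV_char_0]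
  obtain s where s: "?i \<in> comm_ops.\<Delta> scale P (\<lambda>u. Z u - s *s X u) X \<phi> ?i" by blast
  define Y where "Y = (\<lambda>u. Z u - s *s X u)"
  have cY: "comm_ops scale P Y X" unfolding Y_def by (rule Z.comm_ops_shift)
  interpret Y: comm_ops scale P Y X \<phi> by (rule cY)
  have WY: "Y.W = W" unfolding Y_def W_def by (rule ext) (rule Z.op_span_shift)
  note simpsY = Y.PW_simps[unfolded WY]
  have iY: "Y.\<Delta> ?i = {d..?i}" "Y.\<Delta> (Suc ?i) = {d..Suc ?i}"
  proof -
    have "?i \<in> Y.\<Delta> ?i" using s unfolding Y_def .
    moreover have "Z.dim (Y.W ?i) = Z.dim (Y.PW ?i) + d"
      unfolding WY simpsY using dim1 dimP[of m] by simp
    moreover have "Z.dim (Y.W (Suc ?i)) = Z.dim (Y.PW (Suc ?i)) + d"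
      unfolding WY simpsY using dim2 dimP[of ?i] by simp
    ultimately show "Y.\<Delta> ?i = {d..?i}" "Y.\<Delta> (Suc ?i) = {d..Suc ?i}"
      using Y.\<Delta>_interval by blast+
  qed
  have d': "d \<le> ?i" using d by simp
  from pencil_dimension[OF cY iY(1) d' d dim1[folded WY] big[folded WY]]
  obtain b where b: "\<not> W ?i \<subseteq> Z.span ((\<lambda>u. Y u - b *s P u) ` W m \<union> Y.low d ?i)" unfolding WY by blast
  define T where "T = (\<lambda>u. Y u - b *s P u)"
  have cT: "comm_ops scale T P X" unfolding T_def by (rule Y.comm_ops_shift_P)
  interpret T: comm_ops scale T P X \<phi> by (rule cT)
  have WT: "T.W = W" unfolding T_def WY[symmetric] by (rule ext) (rule Y.op_span_shift_P)
  note simpsT = T.PW_simps[unfolded WT]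
  \<comment> \<open>If \<open>Y u = b P u\<close>, then \<open>Y u\<close> is in the image of
    \<open>P\<close>, and so is \<open>u\<close>, since \<open>Y\<close> is injective modulo that
    image. Writing \<open>u = P v\<close>, injectivity of \<open>P\<close> carries
    \<open>T u = 0\<close> over to \<open>T v = 0\<close>.\<close>
  have T0: "\<exists>v\<in>W m. u = P v \<and> T v = 0" if u: "u \<in> W ?i" "T u = 0" for u
  proof -
    have "Y u = P (b *s u)" using u(2) by (simp add: T_def Z.P.scale)
    moreover have "b *s u \<in> W ?i" using u(1) Z.subspace_scale[OF Y.subspace_W[unfolded WY]] by blast
    ultimately have "Y u \<in> Y.PW (Suc ?i)" unfolding simpsY by blast
    then have "u \<in> Y.PW ?i" using Y.Z_reflects_PW[OF iY d'] u(1) unfolding WY by blast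
    then obtain v where v: "v \<in> W m" "u = P v" unfolding simpsY by blast
    have "P (T v) = 0" using u(2) v(2) T.PZ by simp
    moreover have "T v \<in> W ?i" using T.P_W[of v m] v(1) unfolding WT by simp
    ultimately show ?thesis using inj[of ?i] v by auto
  qed
  have "\<exists>v\<in>W m. v \<noteq> 0 \<and> T v = 0"
  proof (rule ccontr)
    assume "\<not> ?thesis"
    then have injm: "v = 0" if "v \<in> W m" "T v = 0" for v using that by blast
    have inji: "v = 0" if "v \<in> W ?i" "T v = 0" for v
    proof -
      obtain v' where "v' \<in> W m" "v = P v'" "T v' = 0" using T0[OF \<open>v \<in> W ?i\<close> \<open>T v = 0\<close>] by blast
      then show ?thesis using injm[of v'] by (simp add: Z.P.zero)
    qed
    have dimT: "Z.dim (T ` W m) = Z.dim (W m)" "Z.dim (T ` W ?i) = Z.dim (W ?i)"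
      using Z.dim_image_eq_fin_dim[OF T.linP T.fin_dim_W T.subspace_W, of m]
        Z.dim_image_eq_fin_dim[OF T.linP T.fin_dim_W T.subspace_W, of ?i] injm inji
      unfolding WT by auto
    \<comment> \<open>\<open>iY\<close> expresses the pure power of \<open>X\<close> by the image of
      \<open>P\<close> and lower monomials in \<open>Y\<close>. Replacing \<open>Y\<close> by
      \<open>T + b P\<close> and expanding the image of \<open>P\<close> turns this into a relation
      modulo the image of \<open>T\<close>, with the same leading monomial.\<close>
    have "?i \<in> T.\<Delta> ?i"
    proof -
      let ?S = "Z.span (T ` W m \<union> T.r ?i ` {..<?i})"
      have PS: "P v \<in> ?S" if "v \<in> W m" for v
      proof -
        have "P ` (T.PW m \<union> T.r m ` {..<?i}) \<subseteq> ?S"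
          using T.Z_PW[of m] by (auto simp: simpsT T.Z_r less_Suc_eq_le intro!: Z.span_base)
        from Z.linear_span_subset[OF Y.linP this Z.subspace_span] T.W_eq[of m] show ?thesis
          using that unfolding WT by (simp add: image_subset_iff)
      qed
      have "Y.r ?i ` {..<?i} \<subseteq> ?S"
      proof clarify
        fix a assume "a < ?i"
        then have a: "a \<le> m" by simp
        then have w: "Y.r m a \<in> W m" using Y.r_in_W unfolding WY by simp
        have "Y.r ?i a = T (Y.r m a) + b *s P (Y.r m a)" using a by (simp add: T_def Y.Z_r)
        also have "\<dots> \<in> ?S" using w PS by (intro Z.span_add Z.span_scale) (auto intro: Z.span_base)
        finally show "Y.r ?i a \<in> ?S" .
      qed
      moreover have "Y.PW ?i \<subseteq> ?S" using PS by (simp add: simpsY image_subset_iff)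
      ultimately have "Y.PW ?i \<union> Y.r ?i ` {..<?i} \<subseteq> ?S" by (rule Un_least[rotated])
      then have "Z.span (Y.PW ?i \<union> Y.r ?i ` {..<?i}) \<subseteq> ?S" by (intro Z.span_minimal Z.subspace_span)
      moreover have "?i \<in> Y.\<Delta> ?i" using d' iY(1) by simp
      then have "Y.r ?i ?i \<in> Z.span (Y.PW ?i \<union> Y.r ?i ` {..<?i})" by (simp add: Y.\<Delta>_def)
      ultimately have "Y.r ?i ?i \<in> ?S" by (rule subsetD)
      then show ?thesis unfolding T.\<Delta>_def simpsT by (simp add: T.r_def Y.r_def)
    qed
    then have iT: "T.\<Delta> ?i = {d..?i}"
      using T.\<Delta>_interval(1)[of ?i d] dim1 dim2 dimT unfolding WT simpsT by simp
    have "T.r ?i ` {..<d} \<subseteq> Y.low d ?i"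
      using Y.P_pow_in_low[of _ d ?i] d' by (auto simp: T.r_def simp del: Y.low.simps)
    then have "Z.span (T ` W m \<union> T.r ?i ` {..<d}) \<subseteq> Z.span (T ` W m \<union> Y.low d ?i)"
      by (intro Z.span_mono) blast
    then have "W ?i \<subseteq> Z.span (T ` W m \<union> Y.low d ?i)"
      using T.W_eq_interval[OF iT d', unfolded WT simpsT] by (simp del: Y.low.simps)
    then show False using b[folded T_def] by (rule notE[rotated])
  qed
  then obtain v0 where v0: "v0 \<in> {v \<in> W m. T v = 0}" "v0 \<notin> {0}" by blast
  have vs: "vspace scale" by unfold_locales
  have fK: "Z.fin_dim {v \<in> W m. T v = 0}"
    using Z.fin_dim_subset[OF Z.fin_dim_W[of m]] unfolding W by auto
  \<comment> \<open>\<open>X\<close> commutes with \<open>T\<close>, so \<open>X u\<close> is again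
    killed by \<open>T\<close>; by \<open>T0\<close> it is \<open>P v\<close> with \<open>v\<close>
    in the kernel.\<close>
  have step: "\<exists>v\<in>{v \<in> W m. T v = 0}. X u - P v \<in> {0}" if "u \<in> {v \<in> W m. T v = 0}" for u
  proof -
    have "X u \<in> W ?i" using that Z.X_W[of u m] unfolding W by blast
    moreover have "T (X u) = 0" using that by (simp add: T.PX Z.X.zero)
    ultimately show ?thesis using T0[of "X u"] by auto
  qed
  have P0: "P ` {0} \<subseteq> {0}" by (simp add: Z.P.zero)
  from pencil_eigenvector[OF vs Z.linX Z.linP Z.subspace_kernel_on[OF T.linP Z.subspace_W[of m, unfolded W]]
    fK Z.subspace_single_0 Z.subspace_single_0 v0 step P0]
  obtain a w where w: "w \<in> W m" "T w = 0" "w \<noteq> 0" "X w = a *s P w" by auto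
  have "Z w = (b + s * a) *s P w"
    using w(2) by (simp add: T_def Y_def w(4) Z.scale_left_distrib algebra_simps)
  then show ?thesis using w by blast
qed

section \<open>Polynomials\<close>

lemma mdeg_superset:
  assumes "finite A" "Poly_Mapping.keys m \<subseteq> A"
  shows "mdeg m = (\<Sum>v\<in>A. Poly_Mapping.lookup m v)"
  unfolding mdeg_def using assms by (intro sum.mono_neutral_left) (auto simp: in_keys_iff)

lemma mdeg_add: "mdeg (m + n) = mdeg m + mdeg n"
proof -
  let ?A = "Poly_Mapping.keys m \<union> Poly_Mapping.keys n"
  have "mdeg (m + n) = (\<Sum>v\<in>?A. Poly_Mapping.lookup (m + n) v)"
    by (rule mdeg_superset) (auto simp: Poly_Mapping.keys_add)
  then show ?thesis by (simp add: mdeg_superset[of ?A m] mdeg_superset[of ?A n] lookup_add sum.distrib)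
qed

lemma mdeg_single: "mdeg (Poly_Mapping.single v k) = k"
  by (simp add: mdeg_def)

lemma mdeg_0 [simp]: "mdeg 0 = 0"
  by (simp add: mdeg_def)

lemma mdeg_eq_0: "mdeg m = 0 \<Longrightarrow> m = 0"
  by (rule poly_mapping_eqI) (auto simp: mdeg_def in_keys_iff)

lemma finite_mdeg: "finite {m :: 'v::finite \<Rightarrow>\<^sub>0 nat. mdeg m \<le> d}"
proof -
  have "Poly_Mapping.lookup m v \<le> d" if "mdeg m \<le> d" for m :: "'v \<Rightarrow>\<^sub>0 nat" and v
  proof -
    have "Poly_Mapping.lookup m v \<le> (\<Sum>v\<in>UNIV. Poly_Mapping.lookup m v)"
      by (intro member_le_sum) auto
    then show ?thesis using that mdeg_superset[of UNIV m] by simp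
  qed
  then have "Poly_Mapping.lookup ` {m :: 'v \<Rightarrow>\<^sub>0 nat. mdeg m \<le> d} \<subseteq> UNIV \<rightarrow>\<^sub>E {..d}"
    by auto
  then have "finite (Poly_Mapping.lookup ` {m :: 'v \<Rightarrow>\<^sub>0 nat. mdeg m \<le> d})"
    by (rule finite_subset) (intro finite_PiE, auto)
  then show ?thesis by (rule finite_imageD) (auto intro: inj_onI poly_mapping_eqI)
qed

lemma mdeg_Suc_split:
  assumes "mdeg m = Suc d"
  obtains v m' where "m = Poly_Mapping.single v 1 + m'" "mdeg m' = d"
proof -
  have "m \<noteq> 0" using assms by auto
  then obtain v where v: "Poly_Mapping.lookup m v \<noteq> 0" by (metis poly_mapping_eqI lookup_zero)
  let ?m' = "m - Poly_Mapping.single v 1"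
  have m: "m = Poly_Mapping.single v 1 + ?m'"
    using v by (intro poly_mapping_eqI) (auto simp: lookup_add lookup_minus lookup_single when_def)
  then have "mdeg m = 1 + mdeg ?m'" by (metis mdeg_add mdeg_single)
  then have "mdeg ?m' = d" using assms by simp
  with m that show ?thesis by blast
qed

lemma mpoly_eq_sum: "f = (\<Sum>m\<in>Poly_Mapping.keys f. Poly_Mapping.single m (Poly_Mapping.lookup f m))"
  by (rule poly_mapping_eqI) (simp add: lookup_sum lookup_single when_def in_keys_iff)

lemma Const_mult_single: "Const c * Poly_Mapping.single m a = Poly_Mapping.single m (c * a)"
  by (simp add: Const_def mult_single)

lemma Const_add: "Const (a + b) = Const a + Const b" by (simp add: Const_def single_add)
lemma Const_mult: "Const (a * b) = Const a * Const b" by (simp add: Const_def mult_single)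
lemma Const_0 [simp]: "Const 0 = 0" by (simp add: Const_def)
lemma Const_1 [simp]: "Const 1 = 1" by (simp add: Const_def)
lemma Const_uminus: "Const (- a) = - Const a" by (simp add: Const_def single_uminus)
lemma Const_diff: "Const (a - b) = Const a - Const b" by (simp add: Const_def single_diff)
lemma Const_sum: "Const (\<Sum>x\<in>A. f x) = (\<Sum>x\<in>A. Const (f x))"
  by (induction A rule: infinite_finite_induct) (auto simp: Const_add)
lemma Var_neq_0: "Var v \<noteq> (0 :: ('v, 'k::field) mpoly)"
  unfolding Var_def by (metis lookup_single_eq lookup_zero one_neq_zero)

lemma homog_0: "0 \<in> homog d" by (simp add: homog_def)
lemma homog_add: "f \<in> homog d \<Longrightarrow> g \<in> homog d \<Longrightarrow> f + g \<in> homog d"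
  using Poly_Mapping.keys_add[of f g] by (auto simp: homog_def)
lemma homog_sum: "(\<And>x. x \<in> A \<Longrightarrow> f x \<in> homog d) \<Longrightarrow> (\<Sum>x\<in>A. f x) \<in> homog d"
  by (induction A rule: infinite_finite_induct) (auto intro: homog_add homog_0)
lemma homog_single: "mdeg m = d \<Longrightarrow> Poly_Mapping.single m c \<in> homog d"
  by (simp add: homog_def)
lemma homog_Var: "Var v \<in> homog 1"
  by (simp add: Var_def homog_single mdeg_single)
lemma homog_Const: "Const c \<in> homog 0"
  by (simp add: Const_def homog_single)
lemma homog_mult: "f \<in> homog d \<Longrightarrow> g \<in> homog d' \<Longrightarrow> f * g \<in> homog (d + d')"
  using Poly_Mapping.keys_mult[of f g] by (fastforce simp: homog_def mdeg_add)
lemma homog_scale: "f \<in> homog d \<Longrightarrow> Const c * f \<in> homog d"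
  using homog_mult[OF homog_Const] by fastforce
lemma homog_uminus: "f \<in> homog d \<Longrightarrow> - f \<in> homog d"
  by (simp add: homog_def keys_def)
lemma homog_diff: "f \<in> homog d \<Longrightarrow> g \<in> homog d \<Longrightarrow> f - g \<in> homog d"
  using homog_add[OF _ homog_uminus] by fastforce
lemma homog_prod:
  "(\<And>x. x \<in> A \<Longrightarrow> f x \<in> homog (d x)) \<Longrightarrow> (\<Prod>x\<in>A. f x) \<in> homog (\<Sum>x\<in>A. d x)"
  by (induction A rule: infinite_finite_induct) (auto intro: homog_mult homog_Const[of 1, simplified])

lemma hcomp_homog: "hcomp d f \<in> homog d"
  by (auto simp: homog_def in_keys_iff lookup_hcomp split: if_splits)

lemma hcomp_of_homog: "f \<in> homog d \<Longrightarrow> hcomp d' f = (if d' = d then f else 0)"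
  by (rule poly_mapping_eqI) (auto simp: lookup_hcomp homog_def in_keys_iff)

lemma mpoly_eq_sum_hcomp: "f = (\<Sum>d\<in>mdeg ` Poly_Mapping.keys f. hcomp d f)"
proof (rule poly_mapping_eqI)
  fix m
  have "(\<Sum>d\<in>mdeg ` Poly_Mapping.keys f. Poly_Mapping.lookup (hcomp d f) m) =
      (\<Sum>d\<in>mdeg ` Poly_Mapping.keys f. if d = mdeg m then Poly_Mapping.lookup f m else 0)"
    by (intro sum.cong) (auto simp: lookup_hcomp)
  then show "Poly_Mapping.lookup f m = Poly_Mapping.lookup (\<Sum>d\<in>mdeg ` Poly_Mapping.keys f. hcomp d f) m"
    by (auto simp: lookup_sum in_keys_iff)
qed

lemma mpoly_induct [case_names Const Var add mult]:
  assumes C: "\<And>c. Q (Const c)" and V: "\<And>v. Q (Var v)"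
    and A: "\<And>f g. Q f \<Longrightarrow> Q g \<Longrightarrow> Q (f + g)" and M: "\<And>f g. Q f \<Longrightarrow> Q g \<Longrightarrow> Q (f * g)"
  shows "Q (f :: ('v, 'k::comm_ring_1) mpoly)"
proof -
  have single: "Q (Poly_Mapping.single m c)" for m and c :: 'k
  proof (induction "mdeg m" arbitrary: m)
    case 0
    then have "m = 0" using mdeg_eq_0 by metis
    then show ?case using C[of c] by (simp add: Const_def)
  next
    case (Suc d)
    then obtain v m' where m: "m = Poly_Mapping.single v 1 + m'" "mdeg m' = d" by (metis mdeg_Suc_split)
    then have "Poly_Mapping.single m c = Var v * Poly_Mapping.single m' c" by (simp add: Var_def mult_single)
    then show ?case using M[OF V] Suc(1) m(2) by simp
  qed
  have "Q (\<Sum>m\<in>A. Poly_Mapping.single m (g m))" if "finite A" for A and g :: "_ \<Rightarrow> 'k"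
    using that
  proof (induction A rule: finite_induct)
    case empty
    then show ?case using C[of 0] by simp
  qed (simp add: A single)
  then show ?thesis by (subst mpoly_eq_sum) simp
qed

section \<open>Evaluation and substitution homomorphisms\<close>

definition mon_eval :: "('v \<Rightarrow> 'b::comm_ring_1) \<Rightarrow> ('v \<Rightarrow>\<^sub>0 nat) \<Rightarrow> 'b" where
  "mon_eval a m = (\<Prod>v\<in>Poly_Mapping.keys m. a v ^ Poly_Mapping.lookup m v)"

lemma mon_eval_superset:
  assumes "finite A" "Poly_Mapping.keys m \<subseteq> A"
  shows "mon_eval a m = (\<Prod>v\<in>A. a v ^ Poly_Mapping.lookup m v)"
  unfolding mon_eval_def using assms by (intro prod.mono_neutral_left) (auto simp: in_keys_iff)

lemma mon_eval_add: "mon_eval a (m + n) = mon_eval a m * mon_eval a n"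
proof -
  let ?A = "Poly_Mapping.keys m \<union> Poly_Mapping.keys n"
  have "mon_eval a (m + n) = (\<Prod>v\<in>?A. a v ^ Poly_Mapping.lookup (m + n) v)"
    by (rule mon_eval_superset) (auto simp: Poly_Mapping.keys_add)
  then show ?thesis
    by (simp add: mon_eval_superset[of ?A m] mon_eval_superset[of ?A n] lookup_add power_add prod.distrib)
qed

lemma mon_eval_single: "mon_eval a (Poly_Mapping.single v k) = a v ^ k"
  by (cases "k = 0") (simp_all add: mon_eval_def)

lemma mon_eval_0: "mon_eval a 0 = 1"
  by (simp add: mon_eval_def)

text \<open>One definition for two uses: evaluation at a point, and the substitution of polynomials
  for variables by which a hyperplane is shown to be a prime.\<close>

definition subst :: "('k::comm_ring_1 \<Rightarrow> 'b::comm_ring_1) \<Rightarrow> ('v \<Rightarrow> 'b) \<Rightarrow> ('v, 'k) mpoly \<Rightarrow> 'b" where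
  "subst c a p = (\<Sum>m\<in>Poly_Mapping.keys p. c (Poly_Mapping.lookup p m) * mon_eval a m)"

lemma eval_mpoly_subst: "eval_mpoly a p = subst (\<lambda>x. x) a p"
  by (simp add: eval_mpoly_def subst_def mon_eval_def)

context comm_ring_hom begin

lemma subst_superset:
  assumes "finite A" "Poly_Mapping.keys p \<subseteq> A"
  shows "subst hom a p = (\<Sum>m\<in>A. hom (Poly_Mapping.lookup p m) * mon_eval a m)"
  unfolding subst_def using assms by (intro sum.mono_neutral_left) (auto simp: in_keys_iff)

lemma subst_add: "subst hom a (p + q) = subst hom a p + subst hom a q"
proof -
  let ?A = "Poly_Mapping.keys p \<union> Poly_Mapping.keys q"
  have "subst hom a (p + q) = (\<Sum>m\<in>?A. hom (Poly_Mapping.lookup (p + q) m) * mon_eval a m)"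
    by (rule subst_superset) (auto simp: Poly_Mapping.keys_add)
  then show ?thesis
    by (simp add: subst_superset[of ?A p] subst_superset[of ?A q] lookup_add hom_add distrib_right sum.distrib)
qed

lemma subst_0: "subst hom a 0 = 0" by (simp add: subst_def)

lemma subst_sum: "subst hom a (\<Sum>x\<in>A. f x) = (\<Sum>x\<in>A. subst hom a (f x))"
  by (induction A rule: infinite_finite_induct) (auto simp: subst_0 subst_add)

lemma subst_single: "subst hom a (Poly_Mapping.single m c) = hom c * mon_eval a m"
  by (cases "c = 0") (simp_all add: subst_def)

lemma subst_Const: "subst hom a (Const c) = hom c"
  by (simp add: Const_def subst_single mon_eval_0)

lemma subst_Var: "subst hom a (Var v) = a v"
  by (simp add: Var_def subst_single mon_eval_single)

lemma subst_mult: "subst hom a (p * q) = subst hom a p * subst hom a q"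
proof -
  have "p * q = (\<Sum>m\<in>Poly_Mapping.keys p. \<Sum>n\<in>Poly_Mapping.keys q.
      Poly_Mapping.single (m + n) (Poly_Mapping.lookup p m * Poly_Mapping.lookup q n))"
    by (subst mpoly_eq_sum[of p], subst mpoly_eq_sum[of q]) (simp add: sum_product mult_single)
  then have "subst hom a (p * q) = (\<Sum>m\<in>Poly_Mapping.keys p. \<Sum>n\<in>Poly_Mapping.keys q.
      hom (Poly_Mapping.lookup p m) * mon_eval a m * (hom (Poly_Mapping.lookup q n) * mon_eval a n))"
    by (simp only: subst_sum subst_single hom_mult mon_eval_add ac_simps)
  then show ?thesis by (simp only: subst_def sum_product)
qed

lemma comm_ring_hom_subst: "comm_ring_hom (subst hom a)"
proof
  show "subst hom a 1 = 1" using subst_Const[of a 1] by simp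
qed (simp_all add: subst_add subst_mult subst_0)

end

lemma comm_ring_hom_eval: "comm_ring_hom (eval_mpoly (a :: 'v \<Rightarrow> 'b::comm_ring_1))"
proof -
  interpret comm_ring_hom "\<lambda>x::'b. x" by unfold_locales auto
  show ?thesis using comm_ring_hom_subst[of a] unfolding eval_mpoly_subst[abs_def] .
qed

lemma eval_Var: "eval_mpoly (a :: 'v \<Rightarrow> 'b::comm_ring_1) (Var v) = a v"
proof -
  interpret comm_ring_hom "\<lambda>x::'b. x" by unfold_locales auto
  show ?thesis by (simp add: eval_mpoly_subst subst_Var)
qed

lemma eval_Const: "eval_mpoly (a :: 'v \<Rightarrow> 'b::comm_ring_1) (Const c) = c"
proof -
  interpret comm_ring_hom "\<lambda>x::'b. x" by unfold_locales auto
  show ?thesis by (simp add: eval_mpoly_subst subst_Const)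
qed

lemma comm_ring_hom_Const: "comm_ring_hom (Const :: 'k::comm_ring_1 \<Rightarrow> ('v, 'k) mpoly)"
  by unfold_locales (simp_all add: Const_add Const_mult)

section \<open>Nonvanishing minors\<close>

lemma det_nonzero_imp_independent:
  fixes M :: "nat \<Rightarrow> nat \<Rightarrow> 'k::idom"
  assumes "det (mat r r (\<lambda>(a, b). M a b)) \<noteq> 0" "\<And>b. b < r \<Longrightarrow> (\<Sum>a<r. c a * M a b) = 0"
  shows "\<forall>a<r. c a = 0"
proof (rule ccontr)
  assume neg: "\<not> ?thesis"
  let ?A = "mat r r (\<lambda>(b, a). M a b)"
  let ?v = "vec r c"
  have "transpose_mat ?A = mat r r (\<lambda>(a, b). M a b)" by (intro eq_matI) auto
  then have "det ?A \<noteq> 0" using assms(1) det_transpose[of ?A r] by simp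
  moreover have "?v \<noteq> 0\<^sub>v r" using neg by (metis index_vec index_zero_vec(1))
  moreover have "?A *\<^sub>v ?v = 0\<^sub>v r"
  proof (intro eq_vecI)
    fix b assume "b < dim_vec (0\<^sub>v r :: 'k vec)"
    then have b: "b < r" by simp
    have "(?A *\<^sub>v ?v) $ b = (\<Sum>a = 0..<r. M a b * c a)" using b by (simp add: scalar_prod_def)
    also have "\<dots> = (\<Sum>a<r. c a * M a b)" by (intro sum.cong) (auto simp: mult.commute)
    finally show "(?A *\<^sub>v ?v) $ b = 0\<^sub>v r $ b" using b assms(2) by simp
  qed simp
  moreover have "?v \<in> carrier_vec r" "?A \<in> carrier_mat r r" by simp_all
  ultimately show False using det_0_iff_vec_prod_zero[of ?A r] by blast
qed

lemma independent_imp_det_nonzero: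
  fixes M :: "nat \<Rightarrow> nat \<Rightarrow> 'k::idom"
  assumes "\<And>c. (\<And>b. b < r \<Longrightarrow> (\<Sum>a<r. c a * M a b) = 0) \<Longrightarrow> \<forall>a<r. c a = 0"
  shows "det (mat r r (\<lambda>(a, b). M a b)) \<noteq> 0"
proof
  assume d0: "det (mat r r (\<lambda>(a, b). M a b)) = 0"
  let ?A = "mat r r (\<lambda>(b, a). M a b)"
  have "transpose_mat ?A = mat r r (\<lambda>(a, b). M a b)" by (intro eq_matI) auto
  then have "det ?A = 0" using d0 det_transpose[of ?A r] by simp
  then obtain v where v: "v \<in> carrier_vec r" "v \<noteq> 0\<^sub>v r" "?A *\<^sub>v v = 0\<^sub>v r"
    using det_0_iff_vec_prod_zero[of ?A r] by auto
  have "(\<Sum>a<r. v $ a * M a b) = 0" if b: "b < r" for b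
  proof -
    have "(\<Sum>a<r. v $ a * M a b) = (\<Sum>a = 0..<r. M a b * v $ a)"
      by (intro sum.cong) (auto simp: mult.commute)
    also have "\<dots> = (?A *\<^sub>v v) $ b" using b v(1) by (simp add: scalar_prod_def)
    finally show ?thesis using v(3) b by simp
  qed
  then have "\<forall>a<r. v $ a = 0" using assms[of "\<lambda>a. v $ a"] by blast
  then show False using v(1,2) by (metis carrier_vecD eq_vecI index_zero_vec)
qed

text \<open>Expanding along a last column left variable gives a linear combination of the rows whose
  coefficients are cofactors. The last cofactor is the nonzero minor already found, so by
  independence the combination is nonzero at some column.\<close>

lemma det_nonzero_selection:
  fixes F :: "nat \<Rightarrow> 'g \<Rightarrow> 'k::idom"
  assumes "\<And>c. (\<And>x. (\<Sum>a<r. c a * F a x) = 0) \<Longrightarrow> \<forall>a<r. c a = 0"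
  shows "\<exists>g. det (mat r r (\<lambda>(a, b). F a (g b))) \<noteq> 0"
  using assms
proof (induction r)
  case 0
  then show ?case by (intro exI) (simp add: det_dim_zero)
next
  case (Suc r)
  have "\<exists>g. det (mat r r (\<lambda>(a, b). F a (g b))) \<noteq> 0"
  proof (rule Suc.IH)
    fix c :: "nat \<Rightarrow> 'k" assume c: "\<And>x. (\<Sum>a<r. c a * F a x) = 0"
    have "(\<Sum>a<Suc r. (c(r := 0)) a * F a x) = 0" for x
      using c[of x] by (simp add: lessThan_Suc)
    from Suc.prems[OF this] show "\<forall>a<r. c a = 0" by (metis fun_upd_other less_SucI nat_neq_iff)
  qed
  then obtain g where g: "det (mat r r (\<lambda>(a, b). F a (g b))) \<noteq> 0" by blast
  define M where "M x = mat (Suc r) (Suc r) (\<lambda>(a, b). F a (if b = r then x else g b))" for x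
  define c where "c a = cofactor (M undefined) a r" for a
  have cof: "cofactor (M x) a r = c a" if "a < Suc r" for a x
  proof -
    have "mat_delete (M x) a r = mat_delete (M undefined) a r"
      by (intro eq_matI) (auto simp: mat_delete_def M_def)
    then show ?thesis by (simp add: c_def cofactor_def)
  qed
  have dM: "det (M x) = (\<Sum>a<Suc r. c a * F a x)" for x
  proof -
    have "det (M x) = (\<Sum>a<Suc r. M x $$ (a, r) * cofactor (M x) a r)"
      by (rule laplace_expansion_column) (auto simp: M_def)
    also have "\<dots> = (\<Sum>a<Suc r. c a * F a x)"
    proof (intro sum.cong refl)
      fix a assume "a \<in> {..<Suc r}"
      then have "M x $$ (a, r) = F a x" "cofactor (M x) a r = c a" using cof by (auto simp: M_def)
      then show "M x $$ (a, r) * cofactor (M x) a r = c a * F a x" by (simp add: mult.commute)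
    qed
    finally show ?thesis .
  qed
  have "mat_delete (M undefined) r r = mat r r (\<lambda>(a, b). F a (g b))"
    by (intro eq_matI) (auto simp: mat_delete_def M_def)
  then have "c r \<noteq> 0" using g by (simp add: c_def cofactor_def)
  then obtain x where "det (M x) \<noteq> 0" using Suc.prems[of c] unfolding dM by blast
  moreover have "M x = mat (Suc r) (Suc r) (\<lambda>(a, b). F a ((g(r := x)) b))"
    unfolding M_def by (intro eq_matI) auto
  ultimately have "det (mat (Suc r) (Suc r) (\<lambda>(a, b). F a ((g(r := x)) b))) \<noteq> 0" by simp
  then show ?case by (rule exI[of _ "g(r := x)"])
qed

context vspace begin

text \<open>Independence of the family and not of its image: a repeated vector counts as dependent,
  as for the lists in \<open>quot_basis\<close>.\<close>

definition indep_seq :: "nat \<Rightarrow> (nat \<Rightarrow> 'b) \<Rightarrow> bool" where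
  "indep_seq r v \<longleftrightarrow> (\<forall>c. (\<Sum>a<r. c a *s v a) = 0 \<longrightarrow> (\<forall>a<r. c a = 0))"

lemma indep_seq_le_dim:
  assumes "indep_seq r v" "\<And>a. a < r \<Longrightarrow> v a \<in> V" "fin_dim V"
  shows "r \<le> dim V"
proof -
  have *: "v a \<notin> span ({0} \<union> v ` {..<a})" if "a < r" for a
  proof
    assume "v a \<in> span ({0} \<union> v ` {..<a})"
    then obtain c where c: "v a = (\<Sum>i<a. c i *s v i)"
      using span_Un_image_explicit[OF subspace_single_0, of "v a" v a] by auto
    define d where "d i = (if i = a then - 1 else if i < a then c i else 0)" for i
    have "(\<Sum>i<r. d i *s v i) = (\<Sum>i\<le>a. d i *s v i)"
      using that by (intro sum.mono_neutral_right) (auto simp: d_def)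
    also have "\<dots> = (\<Sum>i<a. d i *s v i) + d a *s v a" by (simp flip: lessThan_Suc_atMost)
    also have "(\<Sum>i<a. d i *s v i) = (\<Sum>i<a. c i *s v i)" by (intro sum.cong) (auto simp: d_def)
    finally have "(\<Sum>i<r. d i *s v i) = 0" using c by (simp add: d_def)
    then have "d a = 0" using assms(1) that unfolding indep_seq_def by blast
    then show False by (simp add: d_def)
  qed
  have "{a. a < r \<and> v a \<notin> span ({0} \<union> v ` {..<a})} = {..<r}" using * by auto
  then have "dim ({0} \<union> v ` {..<r}) = r"
    using dim_Un_sequence[of "{0}" v r] dim_zero fin_dim_finite[of "{0}"] by simp
  moreover have "dim ({0} \<union> v ` {..<r}) \<le> dim V"
    using assms(2) local.span_zero by (intro dim_mono_fin_dim[OF assms(3)]) (auto intro: span_base)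
  ultimately show ?thesis by simp
qed

lemma indep_seq_basis:
  assumes "fin_dim (v ` A)"
  shows "\<exists>m. (\<forall>a<dim (v ` A). m a \<in> A) \<and> indep_seq (dim (v ` A)) (\<lambda>a. v (m a)) \<and>
    v ` A \<subseteq> span ((\<lambda>a. v (m a)) ` {..<dim (v ` A)})"
proof -
  obtain B where B: "finite B" "independent B" "B \<subseteq> v ` A" "v ` A \<subseteq> span B" "card B = dim (v ` A)"
    using fin_dim_basis[OF assms] by blast
  obtain f where f: "bij_betw f {..<dim (v ` A)} B"
    using B(1,5) by (metis ex_bij_betw_nat_finite lessThan_atLeast0)
  have "\<forall>a\<in>{..<dim (v ` A)}. \<exists>i\<in>A. v i = f a" using f B(3) unfolding bij_betw_def by fastforce
  then obtain m where m: "\<And>a. a < dim (v ` A) \<Longrightarrow> m a \<in> A \<and> v (m a) = f a" by (metis lessThan_iff)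
  have "indep_seq (dim (v ` A)) (\<lambda>a. v (m a))"
    unfolding indep_seq_def
  proof (intro allI impI)
    fix c a assume c: "(\<Sum>a<dim (v ` A). c a *s v (m a)) = 0" and a: "a < dim (v ` A)"
    let ?g = "the_inv_into {..<dim (v ` A)} f"
    have inj: "inj_on f {..<dim (v ` A)}" using f bij_betw_imp_inj_on by blast
    have "(\<Sum>b\<in>B. c (?g b) *s b) = (\<Sum>a<dim (v ` A). c (?g (f a)) *s f a)"
      using sum.reindex_bij_betw[OF f, of "\<lambda>b. c (?g b) *s b"] by simp
    also have "\<dots> = (\<Sum>a<dim (v ` A). c a *s v (m a))"
      using m by (intro sum.cong) (auto simp: the_inv_into_f_f[OF inj])
    finally have "(\<Sum>b\<in>B. c (?g b) *s b) = 0" using c by simp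
    then have "c (?g (f a)) = 0"
      using independentD[OF B(2) B(1) subset_refl, of "\<lambda>b. c (?g b)"] f a by (auto simp: bij_betw_def)
    then show "c a = 0" using a by (simp add: the_inv_into_f_f[OF inj])
  qed
  moreover have "(\<lambda>a. v (m a)) ` {..<dim (v ` A)} = B"
    using f m unfolding bij_betw_def by auto
  ultimately show ?thesis using m B(4) by (intro exI[of _ m]) auto
qed

end

section \<open>Contraction and inverse systems\<close>

definition fscale :: "'k::field \<Rightarrow> ('a \<Rightarrow> 'k) \<Rightarrow> 'a \<Rightarrow> 'k" where
  "fscale c \<psi> = (\<lambda>n. c * \<psi> n)"

definition mscale :: "'k::field \<Rightarrow> ('v, 'k) mpoly \<Rightarrow> ('v, 'k) mpoly" where
  "mscale c f = Const c * f"

interpretation fs: vspace fscale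
  by unfold_locales (auto simp: fscale_def fun_eq_iff algebra_simps)

interpretation ms: vspace mscale
  by unfold_locales (auto simp: mscale_def algebra_simps Const_add Const_mult)

interpretation ms_fs: vspace_pair mscale fscale ..

interpretation ms_ms: vspace_pair mscale mscale ..

interpretation fs_fs: vspace_pair fscale fscale ..

lemma fun_sum_apply: "(\<Sum>x\<in>A. F x) n = (\<Sum>x\<in>A. F x n)"
  by (induction A rule: infinite_finite_induct) auto

definition mon_shift :: "('v \<Rightarrow>\<^sub>0 nat) \<Rightarrow> (('v \<Rightarrow>\<^sub>0 nat) \<Rightarrow> 'k) \<Rightarrow> ('v \<Rightarrow>\<^sub>0 nat) \<Rightarrow> 'k" where
  "mon_shift m \<psi> = (\<lambda>n. \<psi> (m + n))"

definition contract :: "'v \<Rightarrow> (('v \<Rightarrow>\<^sub>0 nat) \<Rightarrow> 'k) \<Rightarrow> ('v \<Rightarrow>\<^sub>0 nat) \<Rightarrow> 'k" where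
  "contract v = mon_shift (Poly_Mapping.single v 1)"

text \<open>Contraction: with \<open>\<psi>\<close> read as a linear functional on \<open>R\<close>,
  the value of \<open>act f \<psi>\<close> at a monomial is that of \<open>\<psi>\<close> at
  \<open>f\<close> times the monomial. In contrast to differentiation no factorials occur.\<close>

definition act :: "('v, 'k::field) mpoly \<Rightarrow> (('v \<Rightarrow>\<^sub>0 nat) \<Rightarrow> 'k) \<Rightarrow> ('v \<Rightarrow>\<^sub>0 nat) \<Rightarrow> 'k" where
  "act f \<psi> = (\<Sum>m\<in>Poly_Mapping.keys f. fscale (Poly_Mapping.lookup f m) (mon_shift m \<psi>))"

lemma act_apply: "act f \<psi> n = (\<Sum>m\<in>Poly_Mapping.keys f. Poly_Mapping.lookup f m * \<psi> (m + n))"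
  by (simp add: act_def fun_sum_apply fscale_def mon_shift_def)

lemma act_superset:
  assumes "finite A" "Poly_Mapping.keys f \<subseteq> A"
  shows "act f \<psi> = (\<Sum>m\<in>A. fscale (Poly_Mapping.lookup f m) (mon_shift m \<psi>))"
  unfolding act_def using assms
  by (intro sum.mono_neutral_left) (auto simp: in_keys_iff fscale_def fun_eq_iff)

lemma act_add: "act (f + g) \<psi> = act f \<psi> + act g \<psi>"
proof -
  let ?A = "Poly_Mapping.keys f \<union> Poly_Mapping.keys g"
  have "act (f + g) \<psi> = (\<Sum>m\<in>?A. fscale (Poly_Mapping.lookup (f + g) m) (mon_shift m \<psi>))"
    by (rule act_superset) (auto simp: Poly_Mapping.keys_add)
  then show ?thesis
    by (simp add: act_superset[of ?A f] act_superset[of ?A g] lookup_add fs.scale_left_distrib sum.distrib)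
qed

lemma act_0: "act 0 \<psi> = 0" by (simp add: act_def)

lemma act_sum: "act (\<Sum>x\<in>A. f x) \<psi> = (\<Sum>x\<in>A. act (f x) \<psi>)"
  by (induction A rule: infinite_finite_induct) (auto simp: act_0 act_add)

lemma act_single: "act (Poly_Mapping.single m c) \<psi> = fscale c (mon_shift m \<psi>)"
  by (cases "c = 0") (simp_all add: act_def fscale_def fun_eq_iff)

lemma act_Var: "act (Var v) \<psi> = contract v \<psi>"
  by (simp add: Var_def act_single fscale_def contract_def)

lemma linear_act_right: "Vector_Spaces.linear fscale fscale (act f)"
  by unfold_locales
    (auto simp: act_apply fun_eq_iff fscale_def algebra_simps sum.distrib sum_distrib_left)

lemma mon_shift_shift: "mon_shift m (mon_shift n \<psi>) = mon_shift (m + n) \<psi>"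
  by (simp add: mon_shift_def fun_eq_iff ac_simps)

lemma linear_mon_shift: "Vector_Spaces.linear fscale fscale (mon_shift m)"
  by unfold_locales (auto simp: mon_shift_def fscale_def fun_eq_iff)

lemma act_mult: "act (f * g) \<psi> = act f (act g \<psi>)"
proof -
  have "f * g = (\<Sum>m\<in>Poly_Mapping.keys f. \<Sum>n\<in>Poly_Mapping.keys g.
      Poly_Mapping.single (m + n) (Poly_Mapping.lookup f m * Poly_Mapping.lookup g n))"
    by (subst mpoly_eq_sum[of f], subst mpoly_eq_sum[of g]) (simp add: sum_product mult_single)
  then have "act (f * g) \<psi> = (\<Sum>m\<in>Poly_Mapping.keys f. \<Sum>n\<in>Poly_Mapping.keys g.
      fscale (Poly_Mapping.lookup f m * Poly_Mapping.lookup g n) (mon_shift (m + n) \<psi>))"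
    by (simp only: act_sum act_single)
  also have "\<dots> = act f (act g \<psi>)"
    by (simp add: fun_eq_iff fun_sum_apply act_apply fscale_def mon_shift_def sum_distrib_left ac_simps)
  finally show ?thesis .
qed

lemma act_Const: "act (Const c) \<psi> = fscale c \<psi>"
  by (simp add: Const_def act_single mon_shift_def)

lemma linear_act: "Vector_Spaces.linear mscale fscale (\<lambda>f. act f \<psi>)"
  by unfold_locales (auto simp: act_add mscale_def act_mult act_Const)

lemma act_diff: "act (f - g) \<psi> = act f \<psi> - act g \<psi>"
proof -
  interpret Vector_Spaces.linear mscale fscale "\<lambda>f. act f \<psi>" by (rule linear_act)
  show ?thesis by (rule diff)
qed

lemma contract_act: "contract v (act f \<psi>) = act (Var v * f) \<psi>"
  by (simp add: act_mult act_Var)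

lemma act_mon_shift: "act f (mon_shift m \<psi>) = mon_shift m (act f \<psi>)"
  by (simp add: act_apply mon_shift_def fun_eq_iff ac_simps)

lemma subspace_homog: "ms.subspace (homog d)"
  by (auto simp: ms.subspace_def mscale_def homog_0 homog_add homog_scale)

lemma homog_eq_span: "(homog d :: ('v, 'k::field) mpoly set) = ms.span ((\<lambda>m. Poly_Mapping.single m 1) ` {m. mdeg m = d})"
proof -
  let ?G = "(\<lambda>m. Poly_Mapping.single m (1::'k)) ` {m :: 'v \<Rightarrow>\<^sub>0 nat. mdeg m = d}"
  have "f \<in> ms.span ?G" if "f \<in> homog d" for f
  proof -
    from that have "\<forall>m\<in>Poly_Mapping.keys f. mdeg m = d" by (simp add: homog_def)
    then have "(\<Sum>m\<in>Poly_Mapping.keys f. mscale (Poly_Mapping.lookup f m) (Poly_Mapping.single m 1)) \<in> ms.span ?G"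
      by (intro ms.span_sum ms.span_scale ms.span_base) auto
    moreover have "(\<Sum>m\<in>Poly_Mapping.keys f. mscale (Poly_Mapping.lookup f m) (Poly_Mapping.single m 1)) = f"
      using mpoly_eq_sum[of f] by (simp add: mscale_def Const_mult_single)
    ultimately show ?thesis by simp
  qed
  moreover have "ms.span ?G \<subseteq> homog d"
    by (intro ms.span_minimal subspace_homog) (auto intro: homog_single)
  ultimately show ?thesis by auto
qed

lemma fin_dim_homog: "ms.fin_dim (homog d :: ('v::finite, 'k::field) mpoly set)"
  unfolding homog_eq_span
  by (intro ms.fin_dim_span ms.fin_dim_finite finite_imageI)
    (rule finite_subset[OF _ finite_mdeg[of d]], auto)

text \<open>For an ideal \<open>I\<close> with dual generator \<open>\<psi>\<close>, contraction \<open>f \<mapsto> act f \<psi>\<close> identifies \<open>[R/I]\<^sub>j\<close> with the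
  subspace \<open>inv_sys \<psi> j\<close>, and multiplication by a variable with \<open>contract\<close>.\<close>

definition inv_sys :: "(('v \<Rightarrow>\<^sub>0 nat) \<Rightarrow> 'k::field) \<Rightarrow> nat \<Rightarrow> (('v \<Rightarrow>\<^sub>0 nat) \<Rightarrow> 'k) set" where
  "inv_sys \<psi> j = (\<lambda>f. act f \<psi>) ` homog j"

lemma inv_sys_eq_span: "inv_sys \<psi> j = fs.span ((\<lambda>m. mon_shift m \<psi>) ` {m. mdeg m = j})"
proof -
  interpret Vector_Spaces.linear mscale fscale "\<lambda>f. act f \<psi>" by (rule linear_act)
  show ?thesis unfolding inv_sys_def homog_eq_span span_image[symmetric]
    by (simp add: image_image act_single fscale_def)
qed

lemma subspace_inv_sys: "fs.subspace (inv_sys \<psi> j)"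
  unfolding inv_sys_eq_span by (rule fs.subspace_span)

lemma fin_dim_inv_sys: "fs.fin_dim (inv_sys (\<psi> :: ('v::finite \<Rightarrow>\<^sub>0 nat) \<Rightarrow> 'k::field) j)"
  unfolding inv_sys_def by (rule ms_fs.fin_dim_image[OF linear_act fin_dim_homog])

lemma inv_sys_mon_shift: "inv_sys (mon_shift m \<psi>) j = mon_shift m ` inv_sys \<psi> j"
  by (simp add: inv_sys_def image_image act_mon_shift)

lemma mon_shift_inv_sys: "\<theta> \<in> inv_sys \<psi> j \<Longrightarrow> mon_shift m \<theta> \<in> inv_sys \<psi> (mdeg m + j)"
proof -
  assume "\<theta> \<in> inv_sys \<psi> j"
  then obtain f where f: "f \<in> homog j" "\<theta> = act f \<psi>" by (auto simp: inv_sys_def)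
  have "mon_shift m \<theta> = act (Poly_Mapping.single m 1 * f) \<psi>"
    by (simp add: f(2) act_mult act_single fscale_def)
  moreover have "Poly_Mapping.single m 1 * f \<in> homog (mdeg m + j)"
    using f(1) by (intro homog_mult homog_single) auto
  ultimately show ?thesis by (auto simp: inv_sys_def)
qed

lemma cases_3: "v = 0 \<or> v = 1 \<or> v = (2::3)"
proof -
  have "card {0, 1, 2::3} = card (UNIV :: 3 set)" by simp
  then have "{0, 1, 2::3} = UNIV" by (intro card_subset_eq) auto
  then show ?thesis by blast
qed

interpretation co: comm_ops fscale "contract (0::3)" "contract 2" "contract 1" \<phi> for \<phi>
  by unfold_locales (auto simp: contract_def mon_shift_def fscale_def fun_eq_iff ac_simps)

lemma inv_sys_eq_op_span: "fs.op_span (contract 0) (contract 2) (contract (1::3)) \<phi> j = inv_sys \<phi> j"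
proof (induction j)
  case 0
  have "{m. mdeg m = 0} = {0 :: 3 \<Rightarrow>\<^sub>0 nat}" using mdeg_eq_0 by auto
  then show ?case by (simp add: inv_sys_eq_span mon_shift_def)
next
  case (Suc j)
  show ?case unfolding fs.op_span.simps Suc
  proof (rule subset_antisym)
    show "fs.span (contract 0 ` inv_sys \<phi> j \<union> contract 2 ` inv_sys \<phi> j \<union> contract 1 ` inv_sys \<phi> j)
      \<subseteq> inv_sys \<phi> (Suc j)"
    proof (intro fs.span_minimal subspace_inv_sys)
      have "contract v ` inv_sys \<phi> j \<subseteq> inv_sys \<phi> (Suc j)" for v
        using mon_shift_inv_sys[of _ \<phi> j "Poly_Mapping.single v 1"] by (auto simp: mdeg_single contract_def)
      then show "contract 0 ` inv_sys \<phi> j \<union> contract 2 ` inv_sys \<phi> j \<union> contract 1 ` inv_sys \<phi> j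
        \<subseteq> inv_sys \<phi> (Suc j)" by (intro Un_least)
    qed
    let ?S = "fs.span (contract 0 ` inv_sys \<phi> j \<union> contract 2 ` inv_sys \<phi> j \<union> contract 1 ` inv_sys \<phi> j)"
    have "mon_shift m \<phi> \<in> ?S" if "mdeg m = Suc j" for m
    proof -
      obtain v m' where m: "m = Poly_Mapping.single v 1 + m'" "mdeg m' = j"
        using mdeg_Suc_split \<open>mdeg m = Suc j\<close> by metis
      have "mon_shift m' \<phi> \<in> inv_sys \<phi> j" unfolding inv_sys_eq_span using m by (intro fs.span_base) auto
      moreover have "mon_shift m \<phi> = contract v (mon_shift m' \<phi>)" by (simp add: m mon_shift_shift contract_def)
      ultimately show ?thesis using cases_3[of v] by (intro fs.span_base) auto
    qed
    then show "inv_sys \<phi> (Suc j) \<subseteq> ?S"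
      unfolding inv_sys_eq_span[of \<phi> "Suc j"] by (intro fs.span_minimal fs.subspace_span) auto
  qed
qed

section \<open>Hilbert functions from catalecticant minors\<close>

definition supported :: "nat \<Rightarrow> (('v \<Rightarrow>\<^sub>0 nat) \<Rightarrow> 'k::zero) \<Rightarrow> bool" where
  "supported e \<psi> \<longleftrightarrow> (\<forall>m. mdeg m \<noteq> e \<longrightarrow> \<psi> m = 0)"

lemma supported_mon_shift: "supported (mdeg m + e) \<psi> \<Longrightarrow> supported e (mon_shift m \<psi>)"
  by (auto simp: supported_def mon_shift_def mdeg_add)

lemma supported_contract: "supported (Suc e) \<psi> \<Longrightarrow> supported e (contract v \<psi>)"
  unfolding contract_def by (intro supported_mon_shift) (simp add: mdeg_single)

lemma inv_sys_contract: "inv_sys (contract v \<psi>) j = contract v ` inv_sys \<psi> j"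
  unfolding contract_def by (rule inv_sys_mon_shift)

lemma inv_sys_above:
  assumes "supported e \<psi>" "e < j"
  shows "inv_sys \<psi> j = {0}"
proof -
  have "mon_shift m \<psi> = 0" if "mdeg m = j" for m
    using assms that by (auto simp: mon_shift_def supported_def mdeg_add fun_eq_iff)
  then have "(\<lambda>m. mon_shift m \<psi>) ` {m. mdeg m = j} \<subseteq> {0}" by auto
  then have "inv_sys \<psi> j \<subseteq> {0}" unfolding inv_sys_eq_span by (metis fs.span_minimal fs.subspace_single_0)
  then show ?thesis using fs.subspace_0[OF subspace_inv_sys[of \<psi> j]] by auto
qed

abbreviation hd_fun :: "(('v \<Rightarrow>\<^sub>0 nat) \<Rightarrow> 'k::field) \<Rightarrow> nat \<Rightarrow> nat" where
  "hd_fun \<psi> j \<equiv> fs.dim (inv_sys \<psi> j)"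

text \<open>The matrices are minors of catalecticants of \<open>\<psi>\<close>. This form serves
  twice: transposition yields the symmetry of the Hilbert function, and the minors, being
  polynomials in the coordinates of \<open>\<psi>\<close>, yield Zariski openness.\<close>

lemma le_hd_fun_iff_minor:
  fixes \<psi> :: "('v::finite \<Rightarrow>\<^sub>0 nat) \<Rightarrow> 'k::field"
  shows "r \<le> hd_fun \<psi> j \<longleftrightarrow>
    (\<exists>m n. (\<forall>a<r. mdeg (m a) = j) \<and> det (mat r r (\<lambda>(a, b). \<psi> (m a + n b))) \<noteq> 0)"
proof
  assume r: "r \<le> hd_fun \<psi> j"
  let ?A = "{m. mdeg m = j}"
  let ?R = "fs.dim ((\<lambda>m. mon_shift m \<psi>) ` ?A)"
  have R: "?R = hd_fun \<psi> j" by (simp add: inv_sys_eq_span)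
  have "fs.fin_dim ((\<lambda>m. mon_shift m \<psi>) ` ?A)"
    using fs.fin_dim_subset[OF fin_dim_inv_sys[of \<psi> j]] fs.span_superset unfolding inv_sys_eq_span by blast
  from fs.indep_seq_basis[OF this] obtain m
    where m: "\<forall>a<?R. m a \<in> ?A" and ind: "fs.indep_seq ?R (\<lambda>a. mon_shift (m a) \<psi>)"
    by (elim exE conjE)
  have "\<exists>n. det (mat r r (\<lambda>(a, b). mon_shift (m a) \<psi> (n b))) \<noteq> 0"
  proof (rule det_nonzero_selection)
    fix c assume c: "\<And>x. (\<Sum>a<r. c a * mon_shift (m a) \<psi> x) = 0"
    define c' where "c' a = (if a < r then c a else 0)" for a
    have "(\<Sum>a<?R. c' a * mon_shift (m a) \<psi> x) = (\<Sum>a<r. c' a * mon_shift (m a) \<psi> x)" for x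
      using r unfolding R by (intro sum.mono_neutral_right) (auto simp: c'_def)
    moreover have "(\<Sum>a<r. c' a * mon_shift (m a) \<psi> x) = 0" for x
      using c[of x] by (simp add: c'_def)
    ultimately have "(\<Sum>a<?R. fscale (c' a) (mon_shift (m a) \<psi>)) = 0"
      by (simp add: fun_eq_iff fun_sum_apply fscale_def)
    then have "\<forall>a<?R. c' a = 0" using ind unfolding fs.indep_seq_def by simp
    then show "\<forall>a<r. c a = 0" using r R by (metis c'_def order_less_le_trans)
  qed
  then obtain n where "det (mat r r (\<lambda>(a, b). mon_shift (m a) \<psi> (n b))) \<noteq> 0" by (elim exE)
  then have "det (mat r r (\<lambda>(a, b). \<psi> (m a + n b))) \<noteq> 0" unfolding mon_shift_def .
  moreover have "\<forall>a<r. mdeg (m a) = j" using m r R by simp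
  ultimately show "\<exists>m n. (\<forall>a<r. mdeg (m a) = j) \<and> det (mat r r (\<lambda>(a, b). \<psi> (m a + n b))) \<noteq> 0"
    by (intro exI conjI)
next
  assume "\<exists>m n. (\<forall>a<r. mdeg (m a) = j) \<and> det (mat r r (\<lambda>(a, b). \<psi> (m a + n b))) \<noteq> 0"
  then obtain m n where m: "\<forall>a<r. mdeg (m a) = j" and d: "det (mat r r (\<lambda>(a, b). \<psi> (m a + n b))) \<noteq> 0"
    by (elim exE conjE)
  have "fs.indep_seq r (\<lambda>a. mon_shift (m a) \<psi>)"
    unfolding fs.indep_seq_def
  proof (intro allI impI)
    fix c a assume c: "(\<Sum>a<r. fscale (c a) (mon_shift (m a) \<psi>)) = 0" and a: "a < r"
    have "(\<Sum>a<r. c a * \<psi> (m a + n b)) = 0" for b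
      using fun_cong[OF c, of "n b"] by (simp add: fun_sum_apply fscale_def mon_shift_def)
    from det_nonzero_imp_independent[OF d, of c, OF this] show "c a = 0" using a by simp
  qed
  then show "r \<le> hd_fun \<psi> j"
  proof (rule fs.indep_seq_le_dim[OF _ _ fin_dim_inv_sys])
    fix a assume "a < r"
    then show "mon_shift (m a) \<psi> \<in> inv_sys \<psi> j"
      unfolding inv_sys_eq_span using m by (intro fs.span_base) auto
  qed
qed

text \<open>In a nonzero minor with rows of degree \<open>j\<close>, every column has degree
  \<open>e - j\<close>, since a column of another degree vanishes. So its transpose is a minor for
  degree \<open>e - j\<close>.\<close>

lemma hd_fun_le_symmetric:
  fixes \<psi> :: "('v::finite \<Rightarrow>\<^sub>0 nat) \<Rightarrow> 'k::field"
  assumes "supported e \<psi>" "j \<le> e"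
  shows "hd_fun \<psi> j \<le> hd_fun \<psi> (e - j)"
proof -
  let ?r = "hd_fun \<psi> j"
  have "\<exists>m n. (\<forall>a<?r. mdeg (m a) = j) \<and> det (mat ?r ?r (\<lambda>(a, b). \<psi> (m a + n b))) \<noteq> 0"
    using le_hd_fun_iff_minor[of ?r \<psi> j] by simp
  then obtain m n where m: "\<forall>a<?r. mdeg (m a) = j"
    and n: "det (mat ?r ?r (\<lambda>(a, b). \<psi> (m a + n b))) \<noteq> 0" by (elim exE conjE)
  have "transpose_mat (mat ?r ?r (\<lambda>(a, b). \<psi> (m a + n b))) = mat ?r ?r (\<lambda>(b, a). \<psi> (n b + m a))"
    by (intro eq_matI) (auto simp: add.commute)
  then have n': "det (mat ?r ?r (\<lambda>(b, a). \<psi> (n b + m a))) \<noteq> 0"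
    using n det_transpose[of "mat ?r ?r (\<lambda>(a, b). \<psi> (m a + n b))" ?r] by simp
  have deg: "mdeg (n b) = e - j" if b: "b < ?r" for b
  proof (rule ccontr)
    assume "mdeg (n b) \<noteq> e - j"
    then have z: "\<psi> (n b + m a) = 0" if "a < ?r" for a
      using assms m that by (auto simp: supported_def mdeg_add)
    have "(\<Sum>b'<?r. (if b' = b then 1 else 0) * \<psi> (n b' + m a)) = 0" if "a < ?r" for a
      using z[OF that] by (intro sum.neutral) auto
    from det_nonzero_imp_independent[OF n', of "\<lambda>b'. if b' = b then 1 else 0", OF this]
    show False using b by (auto dest: spec[of _ b])
  qed
  show ?thesis unfolding le_hd_fun_iff_minor using deg n' by (intro exI[of _ n] exI[of _ m] conjI) auto
qed

lemma hd_fun_symmetric: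
  fixes \<psi> :: "('v::finite \<Rightarrow>\<^sub>0 nat) \<Rightarrow> 'k::field"
  assumes "supported e \<psi>" "j \<le> e"
  shows "hd_fun \<psi> (e - j) = hd_fun \<psi> j"
  using hd_fun_le_symmetric[OF assms] hd_fun_le_symmetric[OF assms(1), of "e - j"] assms(2) by simp

section \<open>The g-vector of a Gorenstein algebra\<close>

text \<open>Hilbert function of the quotient by the linear form \<open>Var 0\<close>.\<close>

definition hyp_fun :: "((3 \<Rightarrow>\<^sub>0 nat) \<Rightarrow> 'k::field) \<Rightarrow> nat \<Rightarrow> nat" where
  "hyp_fun \<phi> i = Suc i - card (co.\<Delta> TYPE('k) \<phi> i)"

lemma hyp_fun_0: "hd_fun (\<phi> :: (3 \<Rightarrow>\<^sub>0 nat) \<Rightarrow> 'k::field) 0 = hyp_fun \<phi> 0"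
  using co.dim_W[of \<phi> 0]
  by (simp add: fs.dim_zero hyp_fun_def co.PW_simps inv_sys_eq_op_span del: fs.op_span.simps)

text \<open>Multiplication by \<open>Var 0\<close> has as image in degree \<open>i + 1\<close> the
  degree \<open>i\<close> part of the quotient by \<open>I : Var 0\<close>, whose dual generator is
  \<open>contract 0 \<phi>\<close>; \<open>hyp_fun\<close> measures the cokernel.\<close>

lemma hyp_fun_Suc: "hd_fun (\<phi> :: (3 \<Rightarrow>\<^sub>0 nat) \<Rightarrow> 'k::field) (Suc i) = hd_fun (contract 0 \<phi>) i + hyp_fun \<phi> (Suc i)"
proof -
  have "card (co.\<Delta> TYPE('k) \<phi> (Suc i)) \<le> Suc (Suc i)"
    using card_mono[OF _ co.\<Delta>_subset[of \<phi> "Suc i"]] by simp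
  then show ?thesis
    using co.dim_W[of \<phi> "Suc i"]
    by (simp add: hyp_fun_def co.PW_simps inv_sys_eq_op_span inv_sys_contract del: fs.op_span.simps)
qed

lemma hyp_fun_le: "hyp_fun (\<phi> :: (3 \<Rightarrow>\<^sub>0 nat) \<Rightarrow> 'k::field) i \<le> Suc i"
  by (simp add: hyp_fun_def)

lemma hyp_fun_decreasing: "hyp_fun (\<phi> :: (3 \<Rightarrow>\<^sub>0 nat) \<Rightarrow> 'k::field) i \<le> i \<Longrightarrow> hyp_fun \<phi> (Suc i) \<le> hyp_fun \<phi> i"
  using co.card_\<Delta>_step[of \<phi> i] by (cases "co.\<Delta> TYPE('k) \<phi> i = {}") (auto simp: hyp_fun_def)

text \<open>\<open>s\<close> is the first degree with a relation modulo \<open>Var 0\<close>.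
  Monotonicity already starts at \<open>s - 1\<close>, where the value is \<open>s\<close>; hence
  the bound \<open>s \<le> Suc i\<close>.\<close>

lemma hyp_fun_shape:
  fixes \<phi> :: "(3 \<Rightarrow>\<^sub>0 nat) \<Rightarrow> 'k::field"
  assumes "supported e \<phi>"
  shows "\<exists>s. (\<forall>i<s. hyp_fun \<phi> i = Suc i) \<and>
    (\<forall>i j. s \<le> Suc i \<longrightarrow> i \<le> j \<longrightarrow> hyp_fun \<phi> j \<le> hyp_fun \<phi> i) \<and> (s = 0 \<longrightarrow> hyp_fun \<phi> 0 = 0)"
proof -
  have "hd_fun \<phi> (Suc e) = 0" using inv_sys_above[OF assms, of "Suc e"] by (simp add: fs.dim_zero)
  then have "hyp_fun \<phi> (Suc e) \<le> Suc e" using hyp_fun_Suc[of \<phi> e] by simp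
  then have ex: "\<exists>i. hyp_fun \<phi> i \<le> i" by (rule exI)
  define s where "s = (LEAST i. hyp_fun \<phi> i \<le> i)"
  have s: "hyp_fun \<phi> s \<le> s" unfolding s_def using LeastI_ex[OF ex] .
  have lt: "hyp_fun \<phi> i = Suc i" if "i < s" for i
    using not_less_Least[of i "\<lambda>i. hyp_fun \<phi> i \<le> i"] that hyp_fun_le[of \<phi> i] unfolding s_def by simp
  have ge: "hyp_fun \<phi> (s + k) \<le> s" for k
  proof (induction k)
    case (Suc k)
    then have "hyp_fun \<phi> (s + k) \<le> s + k" by simp
    from hyp_fun_decreasing[OF this] Suc show ?case by simp
  qed (use s in simp)
  have step: "hyp_fun \<phi> (Suc i) \<le> hyp_fun \<phi> i" if "s \<le> Suc i" for i
  proof (cases "s \<le> i")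
    case True
    then show ?thesis using ge[of "i - s"] hyp_fun_decreasing[of \<phi> i] by simp
  next
    case False
    then have "s = Suc i" using that by simp
    then show ?thesis using s lt[of i] by simp
  qed
  have mono: "hyp_fun \<phi> j \<le> hyp_fun \<phi> i" if "s \<le> Suc i" "i \<le> j" for i j
    using that(2)
  proof (induction rule: dec_induct)
    case (step n)
    then show ?case using \<open>\<And>i. s \<le> Suc i \<Longrightarrow> hyp_fun \<phi> (Suc i) \<le> hyp_fun \<phi> i\<close>[of n] that(1) by simp
  qed simp
  show ?thesis by (rule exI[of _ s]) (use lt mono s in auto)
qed

text \<open>Writing \<open>b\<close> for the Hilbert function modulo \<open>Var 0\<close> and \<open>h'\<close> for that of the contraction of
  \<open>\<phi>\<close> by \<open>Var 0\<close>, the symmetries of \<open>h\<close> and \<open>h'\<close> give \<open>g\<^sub>i = b\<^sub>i - b\<^sub>e\<^sub>+\<^sub>1\<^sub>-\<^sub>i\<close> as well as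
  \<open>g\<^sub>i = g'\<^sub>i\<^sub>-\<^sub>1 + b\<^sub>i - b\<^sub>i\<^sub>-\<^sub>1\<close>: the first controls the range where \<open>b\<close> is nonincreasing and the second,
  by induction, the range where \<open>b\<^sub>i = i + 1\<close>.\<close>

theorem g_vector_shape:
  fixes \<phi> :: "(3 \<Rightarrow>\<^sub>0 nat) \<Rightarrow> 'k::field"
  assumes "supported e \<phi>"
  shows "\<exists>s. (\<forall>i<s. i \<le> e div 2 \<longrightarrow> g_vector (hd_fun \<phi>) i = int i + 1) \<and>
    (\<forall>i. s \<le> Suc i \<and> Suc i \<le> e div 2 \<longrightarrow> g_vector (hd_fun \<phi>) (Suc i) \<le> g_vector (hd_fun \<phi>) i) \<and>
    (\<forall>i\<le>e div 2. 0 \<le> g_vector (hd_fun \<phi>) i) \<and> (s = 0 \<longrightarrow> g_vector (hd_fun \<phi>) 0 = 0)"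
  using assms
proof (induction e arbitrary: \<phi>)
  case 0
  have "hd_fun \<phi> 0 \<le> 1" using hyp_fun_0[of \<phi>] hyp_fun_le[of \<phi> 0] by simp
  then show ?case
    by (intro exI[of _ "hd_fun \<phi> 0"]) (auto simp: g_vector_def)
next
  case (Suc e)
  let ?E = "Suc e"
  let ?\<phi>' = "contract 0 \<phi>"
  define b where "b i = int (hyp_fun \<phi> i)" for i
  define g where "g = g_vector (hd_fun \<phi>)"
  define g' where "g' = g_vector (hd_fun ?\<phi>')"
  have sup': "supported e ?\<phi>'" using supported_contract[OF Suc.prems] .
  obtain s where "(\<forall>i<s. hyp_fun \<phi> i = Suc i) \<and>
    (\<forall>i j. s \<le> Suc i \<longrightarrow> i \<le> j \<longrightarrow> hyp_fun \<phi> j \<le> hyp_fun \<phi> i) \<and> (s = 0 \<longrightarrow> hyp_fun \<phi> 0 = 0)"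
    using hyp_fun_shape[OF Suc.prems] by (elim exE)
  then have s: "\<And>i. i < s \<Longrightarrow> b i = int i + 1" "\<And>i j. s \<le> Suc i \<Longrightarrow> i \<le> j \<Longrightarrow> b j \<le> b i"
    "s = 0 \<Longrightarrow> b 0 = 0"
    unfolding b_def by auto
  obtain s' where s': "\<And>i. i < s' \<Longrightarrow> i \<le> e div 2 \<Longrightarrow> g' i = int i + 1"
    "\<And>i. s' \<le> Suc i \<Longrightarrow> Suc i \<le> e div 2 \<Longrightarrow> g' (Suc i) \<le> g' i"
    "\<And>i. i \<le> e div 2 \<Longrightarrow> 0 \<le> g' i" "s' = 0 \<Longrightarrow> g' 0 = 0"
    using Suc.IH[OF sup'] unfolding g'_def by auto
  have b0: "0 \<le> b i" for i by (simp add: b_def)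
  have g0: "g 0 = b 0" by (simp add: g_def g_vector_def b_def hyp_fun_0)
  have g1: "g (Suc i) = g' i + b (Suc i) - b i" for i
  proof (cases i)
    case 0
    then show ?thesis by (simp add: g_def g'_def g_vector_def b_def hyp_fun_Suc hyp_fun_0)
  next
    case (Suc n)
    then show ?thesis by (simp add: g_def g'_def g_vector_def b_def hyp_fun_Suc)
  qed
  \<comment> \<open>For \<open>i = n + 1\<close>, symmetry moves \<open>h n\<close> to degree
    \<open>?E - n\<close>, where it splits by \<open>hyp_fun_Suc\<close>; the symmetry of
    \<open>h'\<close>, one degree lower, brings the first summand back to degree \<open>n\<close>,
    where it cancels.\<close>
  have g2: "g i = b i - b (Suc ?E - i)" if "i \<le> ?E" for i
  proof (cases i)
    case 0
    have "hd_fun \<phi> (Suc ?E) = 0" using inv_sys_above[OF Suc.prems, of "Suc ?E"] by (simp add: fs.dim_zero)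
    then have "b (Suc ?E) = 0" using hyp_fun_Suc[of \<phi> ?E] by (simp add: b_def)
    then show ?thesis using g0 0 by simp
  next
    case (Suc n)
    have "hd_fun \<phi> n = hd_fun \<phi> (?E - n)" using hd_fun_symmetric[OF Suc.prems, of n] that Suc by simp
    also have "?E - n = Suc (e - n)" using that Suc by simp
    finally have 1: "hd_fun \<phi> n = hd_fun ?\<phi>' (e - n) + hyp_fun \<phi> (Suc (e - n))" by (simp only: hyp_fun_Suc)
    have "hd_fun ?\<phi>' (e - n) = hd_fun ?\<phi>' n" using hd_fun_symmetric[OF sup', of n] that Suc by simp
    moreover have "Suc ?E - i = Suc (e - n)" using that Suc by simp
    ultimately show ?thesis using 1 hyp_fun_Suc[of \<phi> n] by (simp add: g_def g_vector_def b_def Suc)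
  qed
  \<comment> \<open>While \<open>b i = i + 1\<close>, the recursion \<open>g1\<close> says that
    \<open>g\<close> at \<open>i\<close> is \<open>g'\<close> at \<open>i - 1\<close> plus one. So
    \<open>g\<close> follows \<open>i + 1\<close> as long as \<open>b\<close> does and
    \<open>g'\<close> did one degree earlier.\<close>
  define \<sigma> where "\<sigma> = min (Suc s') s"
  have A: "g i = int i + 1" if "i < \<sigma>" "i \<le> ?E div 2" for i
  proof (cases i)
    case 0
    then show ?thesis using g0 s(1)[of 0] that by (simp add: \<sigma>_def)
  next
    case (Suc n)
    then show ?thesis using g1[of n] s(1)[of i] s(1)[of n] s'(1)[of n] that by (simp add: \<sigma>_def)
  qed
  have B: "0 \<le> g i" if i: "i \<le> ?E div 2" for i
  proof (cases "i < s")
    case True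
    show ?thesis
    proof (cases i)
      case 0
      then show ?thesis using g0 b0 by simp
    next
      case (Suc n)
      then show ?thesis using g1[of n] s(1)[of i] s(1)[of n] s'(3)[of n] i True by simp
    qed
  next
    case False
    moreover have "i \<le> Suc ?E - i" "i \<le> ?E" using i by auto
    ultimately show ?thesis using g2[of i] s(2)[of i "Suc ?E - i"] by simp
  qed
  \<comment> \<open>From \<open>s\<close> on, both terms of \<open>g2\<close> move in the right
    direction because \<open>b\<close> does not increase; below \<open>s\<close> the difference of
    \<open>g\<close> is a difference of \<open>g'\<close> one degree lower.\<close>
  have C: "g (Suc i) \<le> g i" if i: "\<sigma> \<le> Suc i" "Suc i \<le> ?E div 2" for i
  proof (cases "s \<le> Suc i")
    case True
    have "i \<le> ?E - i" "i \<le> ?E" "Suc i \<le> ?E" "Suc ?E - i = Suc (?E - i)" using i(2) by auto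
    then show ?thesis
      using g2[of i] g2[of "Suc i"] s(2)[of i "Suc i"] s(2)[of "?E - i" "Suc (?E - i)"] True by simp
  next
    case False
    then have s'i: "s' \<le> i" using i(1) by (auto simp: \<sigma>_def)
    show ?thesis
    proof (cases i)
      case 0
      then show ?thesis using g1[of 0] g0 s(1)[of 0] s(1)[of 1] False s'(4) s'i by simp
    next
      case (Suc n)
      then show ?thesis
        using g1[of i] g1[of n] s(1)[of n] s(1)[of i] s(1)[of "Suc i"] False s'(2)[of n] s'i i(2) by simp
    qed
  qed
  have D: "g 0 = 0" if "\<sigma> = 0" using that s(3) g0 by (simp add: \<sigma>_def)
  show ?case unfolding g_def[symmetric] using A B C D by (intro exI[of _ \<sigma>]) auto
qed

section \<open>Sets of points with prescribed g-vector\<close>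

text \<open>The functional dual to the sum of the \<open>e\<close>-th powers of the linear forms of the points
  \<open>(1 : a : b)\<close>, \<open>(a, b) \<in> \<Gamma>\<close>.\<close>

definition pt :: "nat \<times> nat \<Rightarrow> 3 \<Rightarrow> 'k::field" where
  "pt q v = (if v = 0 then 1 else if v = 1 then of_nat (fst q) else of_nat (snd q))"

definition points_fun :: "(nat \<times> nat) set \<Rightarrow> nat \<Rightarrow> (3 \<Rightarrow>\<^sub>0 nat) \<Rightarrow> 'k::field" where
  "points_fun \<Gamma> e m = (if mdeg m = e then \<Sum>q\<in>\<Gamma>. mon_eval (pt q) m else 0)"

lemma supported_points_fun: "supported e (points_fun \<Gamma> e)"
  by (simp add: supported_def points_fun_def)

lemma contract_points_fun: "contract 0 (points_fun \<Gamma> (Suc e)) = points_fun \<Gamma> e"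
  by (auto simp: contract_def mon_shift_def points_fun_def mdeg_add mdeg_single mon_eval_add
      mon_eval_single pt_def fun_eq_iff)

lemma act_points_fun:
  assumes "f \<in> homog j"
  shows "act f (points_fun \<Gamma> e) n =
    (if mdeg n + j = e then \<Sum>q\<in>\<Gamma>. eval_mpoly (pt q) f * mon_eval (pt q) n else 0)"
proof -
  have deg: "mdeg m = j" if "m \<in> Poly_Mapping.keys f" for m using assms that by (simp add: homog_def)
  show ?thesis
  proof (cases "mdeg n + j = e")
    case True
    have "act f (points_fun \<Gamma> e) n =
        (\<Sum>m\<in>Poly_Mapping.keys f. Poly_Mapping.lookup f m * (\<Sum>q\<in>\<Gamma>. mon_eval (pt q) m * mon_eval (pt q) n))"
      unfolding act_apply points_fun_def using True
      by (intro sum.cong refl) (simp add: deg mdeg_add mon_eval_add add.commute)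
    also have "\<dots> = (\<Sum>q\<in>\<Gamma>. (\<Sum>m\<in>Poly_Mapping.keys f. Poly_Mapping.lookup f m * mon_eval (pt q) m) * mon_eval (pt q) n)"
      by (simp only: sum_distrib_left sum_distrib_right mult.assoc) (rule sum.swap)
    finally show ?thesis using True by (simp add: eval_mpoly_def mon_eval_def)
  next
    case False
    then show ?thesis by (simp add: act_apply points_fun_def mdeg_add deg add.commute)
  qed
qed

text \<open>Homogenised falling factorials in the two affine coordinates. At a point
  \<open>(1 : a : b)\<close> with natural coordinates they vanish unless the index is below
  \<open>(a, b)\<close> in both components; this triangularity is what monomials lack.\<close>

definition falling :: "nat \<times> nat \<Rightarrow> (3, 'k::field) mpoly" where
  "falling p = (\<Prod>s<fst p. Var 1 - Const (of_nat s) * Var 0) * (\<Prod>t<snd p. Var 2 - Const (of_nat t) * Var 0)"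

definition falling_hom :: "nat \<Rightarrow> nat \<times> nat \<Rightarrow> (3, 'k::field) mpoly" where
  "falling_hom j p = Var 0 ^ (j - (fst p + snd p)) * falling p"

definition falling_val :: "nat \<times> nat \<Rightarrow> nat \<times> nat \<Rightarrow> int" where
  "falling_val p q = (\<Prod>s<fst p. int (fst q) - int s) * (\<Prod>t<snd p. int (snd q) - int t)"

lemma homog_Var_power: "Var v ^ n \<in> homog n"
proof (induction n)
  case 0
  then show ?case using homog_Const[of 1] by simp
next
  case (Suc n)
  then show ?case using homog_mult[OF homog_Var Suc, of v] by simp
qed

lemma homog_falling: "(falling p :: (3, 'k::field) mpoly) \<in> homog (fst p + snd p)"
proof -
  have lin: "Var v - Const c * Var 0 \<in> (homog 1 :: (3, 'k) mpoly set)" for v c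
    by (intro homog_diff homog_Var homog_scale)
  have "(\<Prod>s<a. Var v - Const (of_nat s) * Var 0) \<in> (homog a :: (3, 'k) mpoly set)" for v a
  proof (induction a)
    case 0
    then show ?case using homog_Const[of 1] by simp
  next
    case (Suc a)
    then show ?case using homog_mult[OF Suc lin[of v "of_nat a"]] by (simp add: mult.commute)
  qed
  then show ?thesis unfolding falling_def by (intro homog_mult)
qed

lemma homog_falling_hom: "fst p + snd p \<le> j \<Longrightarrow> falling_hom j p \<in> homog j"
  using homog_mult[OF homog_Var_power homog_falling, of 0 "j - (fst p + snd p)" p]
  by (simp add: falling_hom_def)

lemma eval_falling_hom: "eval_mpoly (pt q) (falling_hom j p) = of_int (falling_val p q)"
proof -
  interpret comm_ring_hom "eval_mpoly (pt q) :: (3, 'a) mpoly \<Rightarrow> 'a" by (rule comm_ring_hom_eval)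
  show ?thesis
    by (simp add: falling_hom_def falling_def falling_val_def hom_distribs eval_Var eval_Const pt_def)
qed

lemma falling_val_zero:
  assumes "\<not> (fst p \<le> fst q \<and> snd p \<le> snd q)"
  shows "falling_val p q = 0"
proof -
  have "(\<Prod>s<a. int b - int s) = 0" if "b < a" for a b :: nat
    using that by (intro prod_zero) auto
  then show ?thesis using assms by (auto simp: falling_val_def not_le)
qed

lemma falling_val_self: "falling_val p p \<noteq> 0"
  by (auto simp: falling_val_def)

lemma Var0_falling_hom: "fst p + snd p \<le> j \<Longrightarrow> Var 0 * falling_hom j p = falling_hom (Suc j) p"
  by (simp add: falling_hom_def Suc_diff_le)

lemma Var1_falling_hom:
  assumes "a + b \<le> j"
  shows "Var 1 * falling_hom j (a, b) = falling_hom (Suc j) (Suc a, b) + Const (of_nat a) * falling_hom (Suc j) (a, b)"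
  using assms by (simp add: falling_hom_def falling_def Suc_diff_le algebra_simps)

lemma Var2_falling_hom:
  assumes "a + b \<le> j"
  shows "Var 2 * falling_hom j (a, b) = falling_hom (Suc j) (a, Suc b) + Const (of_nat b) * falling_hom (Suc j) (a, b)"
  using assms by (simp add: falling_hom_def falling_def Suc_diff_le algebra_simps)

text \<open>A variable times a form of the family is the next form plus a multiple of a form of the
  same degree in the family, so the span absorbs all monomials by induction on the degree.\<close>

lemma homog_span_falling:
  "(homog j :: (3, 'k::field) mpoly set) = ms.span (falling_hom j ` {p. fst p + snd p \<le> j})"
proof (rule subset_antisym)
  show "ms.span (falling_hom j ` {p. fst p + snd p \<le> j}) \<subseteq> (homog j :: (3, 'k) mpoly set)"
    by (intro ms.span_minimal subspace_homog) (auto intro: homog_falling_hom)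
  have "Poly_Mapping.single m 1 \<in> ms.span (falling_hom j ` {p. fst p + snd p \<le> j} :: (3, 'k) mpoly set)"
    if "mdeg m = j" for m
    using that
  proof (induction j arbitrary: m)
    case 0
    then have "m = 0" by (rule mdeg_eq_0)
    then have "Poly_Mapping.single m 1 = (falling_hom 0 (0, 0) :: (3, 'k) mpoly)"
      by (simp add: falling_hom_def falling_def)
    then show ?case by (auto intro: ms.span_base)
  next
    case (Suc j)
    let ?S = "ms.span (falling_hom (Suc j) ` {p. fst p + snd p \<le> Suc j} :: (3, 'k) mpoly set)"
    have mem: "falling_hom (Suc j) (a, b) \<in> ?S" if "a + b \<le> Suc j" for a b
      using that by (intro ms.span_base) auto
    have memc: "Const c * falling_hom (Suc j) (a, b) \<in> ?S" if "a + b \<le> Suc j" for a b c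
      using ms.span_scale[OF mem[OF that], of c] by (simp add: mscale_def)
    have lin: "Vector_Spaces.linear mscale mscale (\<lambda>f :: (3, 'k) mpoly. Var v * f)" for v
      by unfold_locales (auto simp: mscale_def algebra_simps)
    have "(\<lambda>f. Var v * f) ` (falling_hom j ` {p. fst p + snd p \<le> j}) \<subseteq> ?S" for v
      using cases_3[of v] mem memc
      by (auto simp: Var0_falling_hom Var1_falling_hom Var2_falling_hom intro!: ms.span_add)
    then have V: "(\<lambda>f. Var v * f) ` ms.span (falling_hom j ` {p. fst p + snd p \<le> j}) \<subseteq> ?S" for v
      by (rule ms.linear_span_subset[OF lin _ ms.subspace_span])
    obtain v m' where m: "m = Poly_Mapping.single v 1 + m'" "mdeg m' = j"
      using mdeg_Suc_split Suc.prems by metis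
    have "Poly_Mapping.single m 1 = Var v * (Poly_Mapping.single m' 1 :: (3, 'k) mpoly)"
      by (simp add: m Var_def mult_single)
    then show ?case using V[of v] Suc.IH[OF m(2)] by auto
  qed
  then show "(homog j :: (3, 'k) mpoly set) \<subseteq> ms.span (falling_hom j ` {p. fst p + snd p \<le> j})"
    unfolding homog_eq_span[of j] by (intro ms.span_minimal ms.subspace_span) auto
qed

locale lower_set =
  fixes \<Gamma> :: "(nat \<times> nat) set"
  assumes fin: "finite \<Gamma>"
    and lower: "\<And>a b a' b'. (a, b) \<in> \<Gamma> \<Longrightarrow> a' \<le> a \<Longrightarrow> b' \<le> b \<Longrightarrow> (a', b') \<in> \<Gamma>"
begin

definition upto where "upto j = {p \<in> \<Gamma>. fst p + snd p \<le> j}"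

lemma finite_upto: "finite (upto j)" using fin by (simp add: upto_def)

text \<open>The Gram matrix is an integer matrix which is positive definite, as evaluating the falling
  factorials indexed by \<open>\<Gamma>\<close> on the points of \<open>\<Gamma>\<close> gives a triangular matrix.\<close>

lemma gram_det_nonzero:
  assumes p: "inj_on p {..<r}" "p ` {..<r} \<subseteq> \<Gamma>"
  shows "det (mat r r (\<lambda>(a, b). \<Sum>q\<in>\<Gamma>. falling_val (p a) q * falling_val (p b) q)) \<noteq> 0"
proof (rule independent_imp_det_nonzero)
  fix c :: "nat \<Rightarrow> int"
  assume c: "\<And>b. b < r \<Longrightarrow> (\<Sum>a<r. c a * (\<Sum>q\<in>\<Gamma>. falling_val (p a) q * falling_val (p b) q)) = 0"
  have "(\<Sum>q\<in>\<Gamma>. (\<Sum>a<r. c a * falling_val (p a) q)\<^sup>2) =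
      (\<Sum>q\<in>\<Gamma>. \<Sum>b<r. \<Sum>a<r. c b * (c a * (falling_val (p a) q * falling_val (p b) q)))"
    by (simp add: power2_eq_square sum_product ac_simps)
  also have "\<dots> = (\<Sum>b<r. \<Sum>q\<in>\<Gamma>. \<Sum>a<r. c b * (c a * (falling_val (p a) q * falling_val (p b) q)))"
    by (rule sum.swap)
  also have "\<dots> = (\<Sum>b<r. \<Sum>a<r. \<Sum>q\<in>\<Gamma>. c b * (c a * (falling_val (p a) q * falling_val (p b) q)))"
    by (intro sum.cong refl) (rule sum.swap)
  also have "\<dots> = (\<Sum>b<r. c b * (\<Sum>a<r. c a * (\<Sum>q\<in>\<Gamma>. falling_val (p a) q * falling_val (p b) q)))"
    by (simp add: sum_distrib_left)
  also have "\<dots> = 0" using c by (intro sum.neutral) auto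
  finally have "(\<Sum>q\<in>\<Gamma>. (\<Sum>a<r. c a * falling_val (p a) q)\<^sup>2) = 0" .
  then have z: "(\<Sum>a<r. c a * falling_val (p a) q) = 0" if "q \<in> \<Gamma>" for q
    using that fin by (simp add: sum_nonneg_eq_0_iff)
  show "\<forall>a<r. c a = 0"
  proof (rule ccontr)
    assume "\<not> (\<forall>a<r. c a = 0)"
    then obtain a0 where a0: "a0 < r \<and> c a0 \<noteq> 0" by auto
    \<comment> \<open>Among the indices with nonzero coefficient take one of least degree and
      evaluate at the point \<open>p a\<close>: any other such index has at least the same degree
      and differs from it, so it is not below \<open>p a\<close> and its value there is
      zero.\<close>
    obtain a where "(a < r \<and> c a \<noteq> 0) \<and>
        (\<forall>a'. a' < r \<and> c a' \<noteq> 0 \<longrightarrow> fst (p a) + snd (p a) \<le> fst (p a') + snd (p a'))"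
      using ex_has_least_nat[of "\<lambda>a. a < r \<and> c a \<noteq> 0", OF a0, of "\<lambda>a. fst (p a) + snd (p a)"]
      by (elim exE)
    then have a: "a < r" "c a \<noteq> 0"
      and min: "\<And>a'. a' < r \<Longrightarrow> c a' \<noteq> 0 \<Longrightarrow> fst (p a) + snd (p a) \<le> fst (p a') + snd (p a')"
      by auto
    have "c a' * falling_val (p a') (p a) = 0" if "a' < r" "a' \<noteq> a" for a'
    proof (cases "c a' = 0")
      case False
      have "p a' \<noteq> p a" using p(1) a(1) that by (auto dest: inj_onD)
      then have "\<not> (fst (p a') \<le> fst (p a) \<and> snd (p a') \<le> snd (p a))"
        using min[OF that(1) False] by (auto simp: prod_eq_iff)
      then show ?thesis using falling_val_zero by simp
    qed simp
    then have "(\<Sum>a'<r. c a' * falling_val (p a') (p a)) = (\<Sum>a'\<in>{a}. c a' * falling_val (p a') (p a))"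
      using a(1) by (intro sum.mono_neutral_right) auto
    moreover have "p a \<in> \<Gamma>" using p(2) a(1) by auto
    ultimately show False using z[of "p a"] a(2) falling_val_self[of "p a"] by simp
  qed
qed

text \<open>A falling form indexed by \<open>p\<close> outside \<open>\<Gamma>\<close> vanishes on
  all of \<open>\<Gamma>\<close>, since a point above \<open>p\<close> would force \<open>p\<close>
  into the lower set. Hence it annihilates the functional and may be dropped.\<close>

lemma inv_sys_points_fun:
  "inv_sys (points_fun \<Gamma> e :: _ \<Rightarrow> 'k::field) j = fs.span ((\<lambda>p. act (falling_hom j p) (points_fun \<Gamma> e)) ` upto j)"
proof -
  let ?\<phi> = "points_fun \<Gamma> e :: _ \<Rightarrow> 'k"
  interpret Vector_Spaces.linear mscale fscale "\<lambda>f. act f ?\<phi>" by (rule linear_act)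
  let ?A = "{p. fst p + snd p \<le> j}"
  have "inv_sys ?\<phi> j = fs.span ((\<lambda>p. act (falling_hom j p) ?\<phi>) ` ?A)"
    unfolding inv_sys_def homog_span_falling span_image[symmetric] by (simp add: image_image)
  moreover have "act (falling_hom j p) ?\<phi> = 0" if p: "p \<in> ?A" "p \<notin> \<Gamma>" for p
  proof -
    have fv: "falling_val p q = 0" if "q \<in> \<Gamma>" for q
      using lower[of "fst q" "snd q" "fst p" "snd p"] p(2) that by (intro falling_val_zero) auto
    have le: "fst p + snd p \<le> j" using p(1) by simp
    show ?thesis
    proof (rule ext)
      fix n
      show "act (falling_hom j p) ?\<phi> n = 0 n"
        unfolding act_points_fun[OF homog_falling_hom[OF le]] by (simp add: eval_falling_hom fv)
    qed
  qed
  then have "(\<lambda>p. act (falling_hom j p) ?\<phi>) ` ?A \<subseteq> fs.span ((\<lambda>p. act (falling_hom j p) ?\<phi>) ` upto j)"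
  proof (intro image_subsetI)
    fix p assume p: "p \<in> ?A"
    show "act (falling_hom j p) ?\<phi> \<in> fs.span ((\<lambda>p. act (falling_hom j p) ?\<phi>) ` upto j)"
    proof (cases "p \<in> \<Gamma>")
      case True
      then show ?thesis using p by (intro fs.span_base) (auto simp: upto_def)
    next
      case False
      then show ?thesis
        using \<open>\<And>p. p \<in> ?A \<Longrightarrow> p \<notin> \<Gamma> \<Longrightarrow> act (falling_hom j p) ?\<phi> = 0\<close>[OF p]
          fs.subspace_0[OF fs.subspace_span] by simp
    qed
  qed
  then have "fs.span ((\<lambda>p. act (falling_hom j p) ?\<phi>) ` ?A) \<subseteq> fs.span ((\<lambda>p. act (falling_hom j p) ?\<phi>) ` upto j)"
    by (intro fs.span_minimal fs.subspace_span)
  moreover have "fs.span ((\<lambda>p. act (falling_hom j p) ?\<phi>) ` upto j) \<subseteq> fs.span ((\<lambda>p. act (falling_hom j p) ?\<phi>) ` ?A)"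
    by (intro fs.span_mono) (auto simp: upto_def)
  ultimately show ?thesis by simp
qed

text \<open>By \<open>2 * j \<le> e\<close>, each index used in degree \<open>j\<close> also gives a
  form of degree \<open>e - j\<close>. Pairing the two families yields the integer Gram matrix,
  which does not depend on \<open>e\<close> and stays invertible in characteristic 0.\<close>

lemma hd_fun_points_fun:
  assumes "2 * j \<le> e"
  shows "hd_fun (points_fun \<Gamma> e :: _ \<Rightarrow> 'k::field_char_0) j = card (upto j)"
proof (rule antisym)
  let ?\<phi> = "points_fun \<Gamma> e :: _ \<Rightarrow> 'k"
  let ?w = "\<lambda>p. act (falling_hom j p) ?\<phi>"
  have "hd_fun ?\<phi> j \<le> card (?w ` upto j)"
    unfolding inv_sys_points_fun by (rule fs.dim_le_card[OF subset_refl]) (simp add: finite_upto)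
  also have "\<dots> \<le> card (upto j)" by (rule card_image_le[OF finite_upto])
  finally show "hd_fun ?\<phi> j \<le> card (upto j)" .
  let ?r = "card (upto j)"
  obtain p where "bij_betw p {0..<?r} (upto j)" using ex_bij_betw_nat_finite[OF finite_upto] by blast
  then have p: "inj_on p {..<?r}" "p ` {..<?r} = upto j" by (auto simp: bij_betw_def lessThan_atLeast0)
  have pj: "fst (p a) + snd (p a) \<le> j" "p a \<in> \<Gamma>" if "a < ?r" for a
    using p(2) that by (auto simp: upto_def)
  define M where "M a b = (\<Sum>q\<in>\<Gamma>. falling_val (p a) q * falling_val (p b) q)" for a b
  have "det (mat ?r ?r (\<lambda>(a, b). M a b)) \<noteq> 0"
    unfolding M_def by (rule gram_det_nonzero[OF p(1)]) (use p(2) in \<open>auto simp: upto_def\<close>)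
  moreover have "det (mat ?r ?r (\<lambda>(a, b). of_int (M a b) :: 'k)) = of_int (det (mat ?r ?r (\<lambda>(a, b). M a b)))"
  proof -
    have "map_mat of_int (mat ?r ?r (\<lambda>(a, b). M a b)) = mat ?r ?r (\<lambda>(a, b). of_int (M a b) :: 'k)"
      by (intro eq_matI) auto
    moreover have "det (map_mat (of_int :: int \<Rightarrow> 'k) (mat ?r ?r (\<lambda>(a, b). M a b))) =
        of_int (det (mat ?r ?r (\<lambda>(a, b). M a b)))"
      by (rule of_int_hom.hom_det)
    ultimately show ?thesis by (simp only:)
  qed
  ultimately have dk: "det (mat ?r ?r (\<lambda>(a, b). of_int (M a b) :: 'k)) \<noteq> 0" by simp
  have "fs.indep_seq ?r (\<lambda>a. ?w (p a))"
    unfolding fs.indep_seq_def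
  proof (intro allI impI)
    fix c a assume c: "(\<Sum>a<?r. fscale (c a) (?w (p a))) = 0" and a: "a < ?r"
    have "(\<Sum>a<?r. c a * of_int (M a b)) = 0" if b: "b < ?r" for b
    proof -
      let ?f = "falling_hom (e - j) (p b) :: (3, 'k) mpoly"
      interpret L: Vector_Spaces.linear fscale fscale "act ?f" by (rule linear_act_right)
      have jj: "j \<le> e - j" using assms by simp
      have fh: "?f * falling_hom j (p a) \<in> homog e" if "a < ?r" for a
        using homog_mult[OF homog_falling_hom homog_falling_hom, of "p b" "e - j" "p a" j]
          pj[OF b] pj[OF that] assms jj by simp
      have "act ?f (\<Sum>a<?r. fscale (c a) (?w (p a))) 0 = (\<Sum>a<?r. c a * act (?f * falling_hom j (p a)) ?\<phi> 0)"
        by (simp add: L.sum L.scale fun_sum_apply act_mult) (simp add: fscale_def)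
      also have "\<dots> = (\<Sum>a<?r. c a * of_int (M a b))"
      proof (intro sum.cong refl)
        fix a assume "a \<in> {..<?r}"
        then have a: "a < ?r" by simp
        have ev: "eval_mpoly (pt q) (?f * falling_hom j (p a)) = of_int (falling_val (p a) q * falling_val (p b) q :: int)"
          for q :: "nat \<times> nat"
        proof -
          interpret E: comm_ring_hom "eval_mpoly (pt q) :: (3, 'k) mpoly \<Rightarrow> 'k" by (rule comm_ring_hom_eval)
          show ?thesis by (simp add: E.hom_mult eval_falling_hom)
        qed
        show "c a * act (?f * falling_hom j (p a)) ?\<phi> 0 = c a * of_int (M a b)"
          by (simp add: act_points_fun[OF fh[OF a]] ev mon_eval_0 M_def del: of_int_mult)
      qed
      finally have "act ?f (\<Sum>a<?r. fscale (c a) (?w (p a))) 0 = (\<Sum>a<?r. c a * of_int (M a b))" .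
      then show ?thesis unfolding c by (simp add: L.zero)
    qed
    then have "\<forall>a<?r. c a = 0" by (rule det_nonzero_imp_independent[OF dk])
    then show "c a = 0" using a by blast
  qed
  then show "?r \<le> hd_fun ?\<phi> j"
  proof (rule fs.indep_seq_le_dim[OF _ _ fin_dim_inv_sys])
    fix a assume "a < ?r"
    then show "?w (p a) \<in> inv_sys ?\<phi> j" unfolding inv_sys_def
      by (intro imageI homog_falling_hom pj(1))
  qed
qed

end

section \<open>Gorenstein ideals and dual generators\<close>

context vspace begin

lemma in_span_image_lessThan:
  "x \<in> span (w ` {..<n::nat}) \<longleftrightarrow> (\<exists>c. x = (\<Sum>j<n. c j *s w j))"
proof
  assume "x \<in> span (w ` {..<n})"
  then have "x \<in> span ({0} \<union> w ` {..<n})" using span_mono[of "w ` {..<n}" "{0} \<union> w ` {..<n}"] by auto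
  then show "\<exists>c. x = (\<Sum>j<n. c j *s w j)"
    using span_Un_image_explicit[OF subspace_single_0] by auto
next
  assume "\<exists>c. x = (\<Sum>j<n. c j *s w j)"
  then show "x \<in> span (w ` {..<n})"
    by (elim exE, simp only:, intro span_sum span_scale span_base) auto
qed

text \<open>Realises a quotient space as the image of a linear map, so that dimensions of quotients
  become dimensions of subspaces.\<close>

lemma exists_linear_kernel:
  assumes "subspace I"
  shows "\<exists>L. Vector_Spaces.linear scale scale L \<and> (\<forall>x. L x = 0 \<longleftrightarrow> x \<in> I)"
proof -
  interpret vp: vector_space_pair scale scale ..
  obtain B where B: "B \<subseteq> I" "independent B" "I \<subseteq> span B"
    using maximal_independent_subset[of I] by metis
  obtain B' where B': "B \<subseteq> B'" "independent B'" "UNIV \<subseteq> span B'"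
    using maximal_independent_subset_extend[OF subset_UNIV B(2)] by metis
  obtain L where L: "Vector_Spaces.linear scale scale L" "\<forall>x\<in>B'. L x = (if x \<in> B then 0 else x)"
    using vp.linear_independent_extend[OF B'(2), of "\<lambda>x. if x \<in> B then 0 else x"] by blast
  interpret L: Vector_Spaces.linear scale scale L by (rule L(1))
  have spB: "span B = I" using B assms by (simp add: span_minimal subset_antisym)
  have "L ` B \<subseteq> {0}" using L(2) B'(1) by auto
  from linear_span_subset[OF L(1) this subspace_single_0] have z: "L x = 0" if "x \<in> I" for x
    using that spB by auto
  have id: "L x = x" if "x \<in> span (B' - B)" for x
    using that
  proof (induction rule: span_induct_alt)
    case base
    show ?case by (simp add: L.zero)
  next
    case (step c x y)
    then show ?case using L(2) by (simp add: L.add L.scale)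
  qed
  have "x \<in> I" if "L x = 0" for x
  proof -
    have "B \<union> (B' - B) = B'" using B'(1) by blast
    then have "x \<in> span (B \<union> (B' - B))" using B'(3) by auto
    then obtain y z where yz: "y \<in> span B" "z \<in> span (B' - B)" "x = y + z"
      unfolding span_Un by auto
    have "L x = z" using yz z[of y] id[of z] spB by (simp add: L.add)
    then show ?thesis using that yz spB by simp
  qed
  then show ?thesis using L(1) z by blast
qed

lemma dim_image_eq_imp_inj:
  assumes "Vector_Spaces.linear scale scale f" "fin_dim V" "subspace V"
    "dim (f ` V) = dim V" "x \<in> V" "f x = 0"
  shows "x = 0"
proof (rule ccontr)
  assume "x \<noteq> 0"
  interpret f: Vector_Spaces.linear scale scale f by fact
  have xV: "span {x} \<subseteq> V" using assms(3,5) by (intro span_minimal) auto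
  have "dim (span {x}) = 1" using \<open>x \<noteq> 0\<close> dim_span_eq_card_independent[of "{x}"] by simp
  moreover obtain C where C: "finite C" "card C = dim V - dim (span {x})" "V \<subseteq> span (span {x} \<union> C)"
    using basis_extend_over[OF assms(2) subspace_span xV] by blast
  moreover have "1 \<le> dim V"
    using dim_mono_fin_dim[OF assms(2) order_trans[OF xV span_superset]] calculation(1) by simp
  moreover have "f ` {x} \<subseteq> span (f ` C)" using assms(6) local.span_zero by simp
  then have "f ` span {x} \<subseteq> span (f ` C)" by (rule linear_span_subset[OF assms(1) _ subspace_span])
  then have "f ` (span {x} \<union> C) \<subseteq> span (f ` C)" by (auto intro: span_base)
  then have "f ` span (span {x} \<union> C) \<subseteq> span (f ` C)" by (rule linear_span_subset[OF assms(1) _ subspace_span])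
  then have "f ` V \<subseteq> span (f ` C)" using C(3) by blast
  then have "dim (f ` V) \<le> card (f ` C)" using C(1) by (intro dim_le_card) auto
  moreover have "card (f ` C) \<le> card C" using C(1) by (rule card_image_le)
  ultimately show False using assms(4) by simp
qed

end

lemma is_idealD:
  assumes "is_ideal I"
  shows "0 \<in> I" "\<And>x y. x \<in> I \<Longrightarrow> y \<in> I \<Longrightarrow> x + y \<in> I" "\<And>r x. x \<in> I \<Longrightarrow> r * x \<in> I"
  using assms unfolding is_ideal_def
  by (auto intro: module.subspace_0[OF module_times] module.subspace_add[OF module_times]
      module.subspace_scale[OF module_times])

lemma is_idealI:
  assumes "0 \<in> I" "\<And>x y. x \<in> I \<Longrightarrow> y \<in> I \<Longrightarrow> x + y \<in> I" "\<And>r x. x \<in> I \<Longrightarrow> r * x \<in> I"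
  shows "is_ideal I"
  unfolding is_ideal_def by (rule module.subspaceI[OF module_times]) (use assms in auto)

lemma is_ideal_sum: "is_ideal I \<Longrightarrow> (\<And>x. x \<in> A \<Longrightarrow> f x \<in> I) \<Longrightarrow> (\<Sum>x\<in>A. f x) \<in> I"
  by (induction A rule: infinite_finite_induct) (auto intro: is_idealD)

lemma is_ideal_diff: "is_ideal I \<Longrightarrow> x \<in> I \<Longrightarrow> y \<in> I \<Longrightarrow> x - y \<in> I"
  using is_idealD(2)[of I x "- y"] is_idealD(3)[of I y "- 1"] by simp

lemma is_ideal_subspace: "is_ideal I \<Longrightarrow> ms.subspace I"
  unfolding ms.subspace_def mscale_def by (auto intro: is_idealD)

text \<open>\<open>L\<close> identifies \<open>V\<close> modulo \<open>I\<close> with its image. It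
  will be a map with kernel \<open>I\<close> as long as no dual generator is available, and
  contraction of the dual generator afterwards.\<close>

lemma quot_basis_linear:
  fixes V I :: "('v, 'k::field) mpoly set"
  assumes s2: "vspace s2" and L: "Vector_Spaces.linear mscale s2 L"
    and V: "ms.subspace V" and I: "\<And>f. f \<in> V \<Longrightarrow> f \<in> I \<longleftrightarrow> L f = 0"
  shows "quot_basis V I bs \<longleftrightarrow> set bs \<subseteq> V \<and> vspace.indep_seq s2 (length bs) (\<lambda>j. L (bs ! j)) \<and>
    L ` V \<subseteq> module.span s2 ((\<lambda>j. L (bs ! j)) ` {..<length bs})"
proof (cases "set bs \<subseteq> V")
  case True
  interpret s2: vspace s2 by fact
  interpret L: Vector_Spaces.linear mscale s2 L by fact
  have in_V: "(\<Sum>j<length bs. Const (c j) * bs ! j) \<in> V" for c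
  proof (intro ms.subspace_sum[OF V])
    fix j assume "j \<in> {..<length bs}"
    then have "bs ! j \<in> V" using True nth_mem by auto
    then show "Const (c j) * bs ! j \<in> V" using ms.subspace_scale[OF V, of "bs ! j" "c j"] by (simp add: mscale_def)
  qed
  have L_sum: "L (\<Sum>j<length bs. Const (c j) * bs ! j) = (\<Sum>j<length bs. s2 (c j) (L (bs ! j)))" for c
    unfolding L.sum mscale_def[symmetric] L.scale ..
  have 1: "(\<Sum>j<length bs. Const (c j) * bs ! j) \<in> I \<longleftrightarrow> (\<Sum>j<length bs. s2 (c j) (L (bs ! j))) = 0" for c
    using I[OF in_V] L_sum by simp
  have 2: "f - (\<Sum>j<length bs. Const (c j) * bs ! j) \<in> I \<longleftrightarrow> L f = (\<Sum>j<length bs. s2 (c j) (L (bs ! j)))"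
    if "f \<in> V" for f c
    using I[OF ms.subspace_diff[OF V that in_V]] L_sum by (simp add: L.diff)
  have "(\<forall>f\<in>V. \<exists>c. f - (\<Sum>j<length bs. Const (c j) * bs ! j) \<in> I) \<longleftrightarrow>
      L ` V \<subseteq> s2.span ((\<lambda>j. L (bs ! j)) ` {..<length bs})"
    using 2 by (simp add: s2.in_span_image_lessThan image_subset_iff)
  then show ?thesis using True unfolding quot_basis_def s2.indep_seq_def 1 by simp
qed (simp add: quot_basis_def)

lemma quot_dim_linear:
  fixes V I :: "('v, 'k::field) mpoly set"
  assumes s2: "vspace s2" and L: "Vector_Spaces.linear mscale s2 L"
    and V: "ms.subspace V" and I: "\<And>f. f \<in> V \<Longrightarrow> f \<in> I \<longleftrightarrow> L f = 0"
    and fin: "vspace.fin_dim s2 (L ` V)"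
  shows "\<exists>bs. quot_basis V I bs" "quot_basis V I bs \<Longrightarrow> length bs = vector_space.dim s2 (L ` V)"
    "quot_dim V I = vector_space.dim s2 (L ` V)"
proof -
  interpret s2: vspace s2 by fact
  have qb: "quot_basis V I bs \<longleftrightarrow> set bs \<subseteq> V \<and> s2.indep_seq (length bs) (\<lambda>j. L (bs ! j)) \<and>
      L ` V \<subseteq> s2.span ((\<lambda>j. L (bs ! j)) ` {..<length bs})" for bs
    by (rule quot_basis_linear[OF s2 L V I])
  let ?r = "s2.dim (L ` V)"
  obtain m where m: "\<forall>a<?r. m a \<in> V" and m2: "s2.indep_seq ?r (\<lambda>a. L (m a))"
    and m3: "L ` V \<subseteq> s2.span ((\<lambda>a. L (m a)) ` {..<?r})"
    using s2.indep_seq_basis[OF fin] by (elim exE conjE)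
  have "set (map m [0..<?r]) \<subseteq> V" using m by auto
  moreover have "s2.indep_seq (length (map m [0..<?r])) (\<lambda>j. L (map m [0..<?r] ! j))"
    using m2 by (simp add: s2.indep_seq_def)
  moreover have "(\<lambda>j. L (map m [0..<?r] ! j)) ` {..<?r} = (\<lambda>a. L (m a)) ` {..<?r}"
    by (intro image_cong) auto
  ultimately have ex: "quot_basis V I (map m [0..<?r])"
    using m3 unfolding qb by (simp only: length_map length_upt minus_nat.diff_0 conj_absorb simp_thms)
  then show "\<exists>bs. quot_basis V I bs" by blast
  have len: "length bs = ?r" if "quot_basis V I bs" for bs
  proof -
    from that have bs: "set bs \<subseteq> V" "s2.indep_seq (length bs) (\<lambda>j. L (bs ! j))"
      "L ` V \<subseteq> s2.span ((\<lambda>j. L (bs ! j)) ` {..<length bs})" unfolding qb by simp_all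
    have "length bs \<le> ?r" 
    proof (rule s2.indep_seq_le_dim[OF bs(2) _ fin])
      fix a assume "a < length bs"
      then have "bs ! a \<in> V" using bs(1) by (auto dest: nth_mem)
      then show "L (bs ! a) \<in> L ` V" by (rule imageI)
    qed
    moreover have "?r \<le> card ((\<lambda>j. L (bs ! j)) ` {..<length bs})" by (rule s2.dim_le_card[OF bs(3)]) simp
    moreover have "card ((\<lambda>j. L (bs ! j)) ` {..<length bs}) \<le> length bs"
      using card_image_le[of "{..<length bs}" "\<lambda>j. L (bs ! j)"] by simp
    ultimately show ?thesis by simp
  qed
  then show "quot_basis V I bs \<Longrightarrow> length bs = ?r" .
  show "quot_dim V I = ?r" unfolding quot_dim_def
  proof (rule the_equality)
    show "\<exists>bs. quot_basis V I bs \<and> length bs = ?r" using ex len by blast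
  qed (use len in blast)
qed

lemma vspace_fscale: "vspace fscale" by unfold_locales
lemma vspace_mscale: "vspace mscale" by unfold_locales

lemma homog_ideal_idealD: "homog_ideal I \<Longrightarrow> is_ideal I"
  by (simp add: homog_ideal_def)

lemma act_at_0: "act g \<phi> 0 = (\<Sum>m\<in>Poly_Mapping.keys g. Poly_Mapping.lookup g m * \<phi> m)"
  by (simp add: act_apply)

locale gorenstein_ideal =
  fixes I :: "('v::finite, 'k::field) mpoly set" and e :: nat
  assumes gor: "artinian_gorenstein I"
    and top: "quot_dim (homog e) I > 0"
    and above: "\<And>d. d > e \<Longrightarrow> quot_dim (homog d) I = 0"
begin

lemma homog_ideal: "homog_ideal I" using gor by (simp add: artinian_gorenstein_def)
lemma is_ideal: "is_ideal I" using homog_ideal by (rule homog_ideal_idealD)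

lemma quot_map:
  "\<exists>L :: ('v, 'k) mpoly \<Rightarrow> ('v, 'k) mpoly. Vector_Spaces.linear mscale mscale L \<and> (\<forall>f. L f = 0 \<longleftrightarrow> f \<in> I)"
  by (rule ms.exists_linear_kernel[OF is_ideal_subspace[OF is_ideal]])

lemma quot_dim_homog:
  fixes L :: "('v, 'k) mpoly \<Rightarrow> ('v, 'k) mpoly"
  assumes L: "Vector_Spaces.linear mscale mscale L" "\<And>f. L f = 0 \<longleftrightarrow> f \<in> I"
  shows "quot_dim (homog d) I = ms.dim (L ` homog d)"
  by (rule quot_dim_linear(3)[OF vspace_mscale L(1) subspace_homog])
    (simp_all add: L(2) ms_ms.fin_dim_image[OF L(1) fin_dim_homog])

lemma homog_above: "d > e \<Longrightarrow> homog d \<subseteq> I"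
proof -
  assume d: "d > e"
  obtain L :: "('v, 'k) mpoly \<Rightarrow> ('v, 'k) mpoly" where
    L0: "Vector_Spaces.linear mscale mscale L \<and> (\<forall>f. L f = 0 \<longleftrightarrow> f \<in> I)"
    using quot_map by (elim exE)
  note L = L0[THEN conjunct1] L0[THEN conjunct2, rule_format]
  have "ms.dim (L ` homog d) = 0" using quot_dim_homog[OF L, of d] above[OF d] by simp
  then have "L ` homog d \<subseteq> {0}"
    using ms.dim_eq_0_iff_fin_dim[OF ms_ms.fin_dim_image[OF L(1) fin_dim_homog]] by blast
  then show ?thesis using L(2) by auto
qed

lemma exists_top: "\<exists>u\<in>homog e. u \<notin> I"
proof (rule ccontr)
  assume "\<not> ?thesis"
  then have sub: "homog e \<subseteq> I" by blast
  obtain L :: "('v, 'k) mpoly \<Rightarrow> ('v, 'k) mpoly" where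
    L0: "Vector_Spaces.linear mscale mscale L \<and> (\<forall>f. L f = 0 \<longleftrightarrow> f \<in> I)"
    using quot_map by (elim exE)
  note L = L0[THEN conjunct1] L0[THEN conjunct2, rule_format]
  have "L ` homog e \<subseteq> {0}" using L(2) sub by auto
  then have "ms.dim (L ` homog e) = 0"
    using ms.dim_eq_0_iff_fin_dim[OF ms_ms.fin_dim_image[OF L(1) fin_dim_homog]] by blast
  then show False using quot_dim_homog[OF L, of e] top by simp
qed

lemma homog_top_socle: "f \<in> homog e \<Longrightarrow> f \<in> socle I"
proof -
  assume f: "f \<in> homog e"
  have "Var v * f \<in> homog (Suc e)" for v using homog_mult[OF homog_Var f] by simp
  moreover have "homog (Suc e) \<subseteq> I" by (rule homog_above) simp
  ultimately show ?thesis by (auto simp: socle_def)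
qed

lemma subspace_socle: "ms.subspace (socle I)"
  unfolding ms.subspace_def socle_def mscale_def
  by (auto simp: distrib_left mult.left_commute[of "Var _"] intro: is_idealD[OF is_ideal])

text \<open>The quotient is finite-dimensional because all monomials above degree \<open>e\<close>
  lie in \<open>I\<close>. In it the socle is a line, and the class of \<open>u\<close> is a nonzero
  element of that line.\<close>

lemma socle_multiple:
  assumes u: "u \<in> homog e" "u \<notin> I" and f: "f \<in> socle I"
  shows "\<exists>c. f - Const c * u \<in> I"
proof -
  obtain L :: "('v, 'k) mpoly \<Rightarrow> ('v, 'k) mpoly" where
    L0: "Vector_Spaces.linear mscale mscale L \<and> (\<forall>f. L f = 0 \<longleftrightarrow> f \<in> I)"
    using quot_map by (elim exE)
  note L = L0[THEN conjunct1] L0[THEN conjunct2, rule_format]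
  interpret L: Vector_Spaces.linear mscale mscale L by (rule L(1))
  let ?M = "(\<lambda>m. Poly_Mapping.single m (1::'k)) ` {m :: 'v \<Rightarrow>\<^sub>0 nat. mdeg m \<le> e}"
  have "L g \<in> ms.span (L ` ?M)" for g
  proof -
    have "(\<Sum>m\<in>Poly_Mapping.keys g. mscale (Poly_Mapping.lookup g m) (Poly_Mapping.single m 1)) = g"
      using mpoly_eq_sum[of g] by (simp add: mscale_def Const_mult_single)
    from arg_cong[OF this, of L]
    have "L g = (\<Sum>m\<in>Poly_Mapping.keys g. mscale (Poly_Mapping.lookup g m) (L (Poly_Mapping.single m 1)))"
      unfolding L.sum L.scale by (rule sym)
    also have "\<dots> \<in> ms.span (L ` ?M)"
    proof (intro ms.span_sum ms.span_scale)
      fix m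
      show "L (Poly_Mapping.single m 1) \<in> ms.span (L ` ?M)"
      proof (cases "mdeg m \<le> e")
        case True
        then show ?thesis by (intro ms.span_base) auto
      next
        case False
        then have "Poly_Mapping.single m (1::'k) \<in> I" using homog_above[of "mdeg m"] homog_single[of m "mdeg m"] by auto
        then have "L (Poly_Mapping.single m 1) = 0" using L(2) by blast
        then show ?thesis using ms.subspace_0[OF ms.subspace_span] by simp
      qed
    qed
    finally show ?thesis .
  qed
  then have "L ` socle I \<subseteq> ms.span (L ` ?M)" by blast
  then have fin: "ms.fin_dim (L ` socle I)"
    unfolding ms.fin_dim_def using finite_mdeg[of e] by (intro exI[of _ "L ` ?M"]) auto
  have "ms.dim (L ` socle I) = quot_dim (socle I) I"
    by (rule quot_dim_linear(3)[OF vspace_mscale L(1) subspace_socle _ fin, symmetric]) (simp add: L(2))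
  then have d1: "ms.dim (L ` socle I) = 1" using gor by (simp add: artinian_gorenstein_def)
  have Lu: "L u \<noteq> 0" "L u \<in> L ` socle I" using u L(2) homog_top_socle by auto
  have sub: "ms.span {L u} \<subseteq> L ` socle I"
    using Lu(2) by (intro ms.span_minimal L.subspace_image subspace_socle) auto
  have "ms.dim (ms.span {L u}) = 1" using Lu(1) ms.dim_span_eq_card_independent[of "{L u}"] by simp
  then have "L ` socle I = ms.span {L u}"
    using ms.subspace_eq_of_dim_le[OF ms.subspace_span sub fin] d1 by simp
  then have "L f \<in> ms.span {L u}" using f by blast
  then obtain c where "L f = mscale c (L u)" unfolding ms.span_singleton by (elim rangeE)
  moreover have "L (Const c * u) = mscale c (L u)" using L.scale[of c u] by (simp add: mscale_def)
  ultimately have "L (f - Const c * u) = 0" by (simp add: L.diff)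
  then show ?thesis unfolding L(2) by (rule exI)
qed

text \<open>A form outside \<open>I\<close> of degree below \<open>e\<close> is not in the socle: it
  would be a multiple of an element of degree \<open>e\<close>, whose component in the lower degree
  is zero. So some variable keeps it outside \<open>I\<close>, and the degree can be raised up to
  \<open>e\<close>.\<close>

lemma nondegenerate:
  assumes "f \<in> homog j" "f \<notin> I"
  shows "\<exists>n. mdeg n = e - j \<and> Poly_Mapping.single n 1 * f \<notin> I"
  using assms
proof (induction "e - j" arbitrary: j f)
  case 0
  then have "mdeg (0 :: 'v \<Rightarrow>\<^sub>0 nat) = e - j" by simp
  moreover have "Poly_Mapping.single 0 1 * f \<notin> I" using 0 by simp
  ultimately show ?case by (intro exI[of _ 0] conjI)
next
  case (Suc d)
  have "f \<notin> socle I"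
  proof
    assume f: "f \<in> socle I"
    obtain u where u: "u \<in> homog e" "u \<notin> I" using exists_top by blast
    obtain c where "f - Const c * u \<in> I" using socle_multiple[OF u f] by blast
    then have "hcomp j (f - Const c * u) \<in> I" using homog_ideal by (simp add: homog_ideal_def)
    moreover have "hcomp j (f - Const c * u) = hcomp j f - hcomp j (Const c * u)"
      by (rule poly_mapping_eqI) (simp add: lookup_hcomp lookup_minus)
    moreover have "hcomp j (Const c * u) = 0"
      using hcomp_of_homog[OF homog_scale[OF u(1)], of j c] Suc(2) by simp
    ultimately show False using hcomp_of_homog[OF Suc(3), of j] Suc(4) by simp
  qed
  then obtain v where v: "Var v * f \<notin> I" by (auto simp: socle_def)
  have vf: "Var v * f \<in> homog (Suc j)" using homog_mult[OF homog_Var Suc(3)] by simp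
  have d: "d = e - Suc j" using Suc(2) by simp
  obtain n where "mdeg n = e - Suc j \<and> Poly_Mapping.single n 1 * (Var v * f) \<notin> I"
    using Suc(1)[OF d vf v] by (elim exE)
  then have n: "mdeg n = e - Suc j" "Poly_Mapping.single n 1 * (Var v * f) \<notin> I" by simp_all
  have "Poly_Mapping.single (n + Poly_Mapping.single v 1) 1 * f = Poly_Mapping.single n 1 * (Var v * f)"
    by (simp add: Var_def mult_single flip: mult.assoc)
  then have "Poly_Mapping.single (n + Poly_Mapping.single v 1) 1 * f \<notin> I" using n(2) by simp
  moreover have "mdeg (n + Poly_Mapping.single v 1) = e - j" using n(1) Suc(2) by (simp add: mdeg_add mdeg_single)
  ultimately show ?case by (intro exI[of _ "n + Poly_Mapping.single v 1"] conjI)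
qed

lemma dual_supported: "dual_coords e I \<phi> \<Longrightarrow> supported e \<phi>"
  by (simp add: dual_coords_def supported_def)

text \<open>Macaulay duality. \<open>dual_coords\<close> speaks of degree \<open>e\<close> only; a
  form of lower degree lies in \<open>I\<close> as soon as all its multiples by monomials in degree
  \<open>e\<close> do, by \<open>nondegenerate\<close>. Above degree \<open>e\<close> both sides
  hold.\<close>

lemma dual_annihilator:
  assumes \<phi>: "dual_coords e I \<phi>" and f: "f \<in> homog j"
  shows "f \<in> I \<longleftrightarrow> act f \<phi> = 0"
proof -
  have top: "g \<in> I \<longleftrightarrow> act g \<phi> 0 = 0" if "g \<in> homog e" for g
    using \<phi> that unfolding dual_coords_def act_at_0 by blast
  have sh: "act (Poly_Mapping.single n 1 * f) \<phi> 0 = act f \<phi> n" for n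
    by (simp add: act_mult act_single fscale_def mon_shift_def)
  show ?thesis
  proof (cases "j \<le> e")
    case False
    then have "f \<in> I" using homog_above[of j] f by auto
    moreover have "act f \<phi> = 0"
      using inv_sys_above[OF dual_supported[OF \<phi>], of j] False f by (auto simp: inv_sys_def)
    ultimately show ?thesis by simp
  next
    case True
    have he: "Poly_Mapping.single n 1 * f \<in> homog e" if "mdeg n = e - j" for n
      using homog_mult[OF homog_single[OF that, of 1] f] True by simp
    show ?thesis
    proof
      assume fI: "f \<in> I"
      show "act f \<phi> = 0"
      proof (rule ext)
        fix n
        show "act f \<phi> n = 0 n"
        proof (cases "mdeg n = e - j")
          case n: True
          have "Poly_Mapping.single n 1 * f \<in> I" using fI is_idealD(3)[OF is_ideal] by blast
          then show ?thesis using top[OF he[OF n]] sh by simp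
        next
          case False
          have "\<phi> (m + n) = 0" if "m \<in> Poly_Mapping.keys f" for m
            using f that False True dual_supported[OF \<phi>] by (auto simp: homog_def supported_def mdeg_add)
          then show ?thesis by (simp add: act_apply)
        qed
      qed
    next
      assume 0: "act f \<phi> = 0"
      show "f \<in> I"
      proof (rule ccontr)
        assume "f \<notin> I"
        obtain n where "mdeg n = e - j \<and> Poly_Mapping.single n 1 * f \<notin> I"
          using nondegenerate[OF f \<open>f \<notin> I\<close>] by (elim exE)
        then have n: "mdeg n = e - j" "Poly_Mapping.single n 1 * f \<notin> I" by simp_all
        then show False using top[OF he[OF n(1)]] sh[of n] 0 by simp
      qed
    qed
  qed
qed

text \<open>Modulo \<open>I\<close> every monomial of degree \<open>e\<close> is a multiple of one
  fixed socle generator; the multipliers are the coordinates.\<close>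

lemma exists_dual: "\<exists>\<phi>. dual_coords e I \<phi>"
proof -
  obtain u where u: "u \<in> homog e" "u \<notin> I" using exists_top by blast
  have "\<forall>m. mdeg m = e \<longrightarrow> (\<exists>c. Poly_Mapping.single m 1 - Const c * u \<in> I)"
    using socle_multiple[OF u homog_top_socle[OF homog_single]] by blast
  then obtain c where c: "\<And>m. mdeg m = e \<Longrightarrow> Poly_Mapping.single m 1 - Const (c m) * u \<in> I" by metis
  define \<phi> where "\<phi> m = (if mdeg m = e then c m else 0)" for m
  have "f \<in> I \<longleftrightarrow> (\<Sum>m\<in>Poly_Mapping.keys f. Poly_Mapping.lookup f m * \<phi> m) = 0" if f: "f \<in> homog e" for f
  proof -
    let ?s = "\<Sum>m\<in>Poly_Mapping.keys f. Poly_Mapping.lookup f m * \<phi> m"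
    have "(\<Sum>m\<in>Poly_Mapping.keys f. Const (Poly_Mapping.lookup f m) * (Poly_Mapping.single m 1 - Const (\<phi> m) * u)) \<in> I"
      using f c by (intro is_ideal_sum[OF is_ideal] is_idealD(3)[OF is_ideal]) (auto simp: homog_def \<phi>_def)
    also have "(\<Sum>m\<in>Poly_Mapping.keys f. Const (Poly_Mapping.lookup f m) * (Poly_Mapping.single m 1 - Const (\<phi> m) * u)) =
        (\<Sum>m\<in>Poly_Mapping.keys f. Poly_Mapping.single m (Poly_Mapping.lookup f m)) - Const ?s * u"
      by (simp add: right_diff_distrib sum_subtractf Const_mult_single Const_sum Const_mult sum_distrib_right mult.assoc)
    finally have 1: "f - Const ?s * u \<in> I" using mpoly_eq_sum[of f] by simp
    show ?thesis
    proof
      assume "f \<in> I"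
      then have "f - (f - Const ?s * u) \<in> I" using 1 is_ideal_diff[OF is_ideal] by blast
      then have "Const (inverse ?s) * (Const ?s * u) \<in> I" using is_idealD(3)[OF is_ideal] by simp
      then have "Const (inverse ?s * ?s) * u \<in> I" by (simp add: Const_mult mult.assoc)
      then show "?s = 0" using u(2) by (cases "?s = 0") auto
    next
      assume "?s = 0"
      then show "f \<in> I" using 1 by simp
    qed
  qed
  then have "dual_coords e I \<phi>" unfolding dual_coords_def \<phi>_def by auto
  then show ?thesis by blast
qed

lemma quot_basis_homog:
  assumes \<phi>: "dual_coords e I \<phi>"
  shows "\<exists>bs. quot_basis (homog d) I bs" "quot_basis (homog d) I bs \<Longrightarrow> length bs = hd_fun \<phi> d"
    "hilbert_fun I d = hd_fun \<phi> d"
proof -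
  have I: "f \<in> I \<longleftrightarrow> act f \<phi> = 0" if "f \<in> homog d" for f by (rule dual_annihilator[OF \<phi> that])
  note fin = fin_dim_inv_sys[of \<phi> d, unfolded inv_sys_def]
  note q = quot_dim_linear[OF vspace_fscale linear_act subspace_homog I fin]
  show "\<exists>bs. quot_basis (homog d) I bs" by (rule q(1))
  show "quot_basis (homog d) I bs \<Longrightarrow> length bs = hd_fun \<phi> d" unfolding inv_sys_def by (rule q(2))
  show "hilbert_fun I d = hd_fun \<phi> d" unfolding inv_sys_def hilbert_fun_def by (rule q(3))
qed

end

section \<open>From a functional to its Gorenstein ideal\<close>

definition ann :: "(('v \<Rightarrow>\<^sub>0 nat) \<Rightarrow> 'k::field) \<Rightarrow> ('v, 'k) mpoly set" where
  "ann \<phi> = {f. act f \<phi> = 0}"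

lemma act_zero_right: "act f 0 = 0"
proof -
  interpret Vector_Spaces.linear fscale fscale "act f" by (rule linear_act_right)
  show ?thesis by (rule zero)
qed

lemma is_ideal_ann: "is_ideal (ann \<phi>)"
  by (rule is_idealI) (simp_all add: ann_def act_0 act_add act_mult act_zero_right)

lemma act_hcomp:
  assumes "supported e \<phi>"
  shows "act (hcomp d f) \<phi> n = (if mdeg n + d = e then act f \<phi> n else 0)"
proof -
  have keys: "Poly_Mapping.keys (hcomp d f) \<subseteq> Poly_Mapping.keys f"
    by (auto simp: in_keys_iff lookup_hcomp split: if_splits)
  have "act (hcomp d f) \<phi> n = (\<Sum>m\<in>Poly_Mapping.keys f. Poly_Mapping.lookup (hcomp d f) m * \<phi> (m + n))"
    by (simp add: act_superset[OF finite_keys keys] fun_sum_apply fscale_def mon_shift_def)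
  also have "\<dots> = (\<Sum>m\<in>Poly_Mapping.keys f. if mdeg n + d = e then Poly_Mapping.lookup f m * \<phi> (m + n) else 0)"
    using assms by (intro sum.cong refl) (auto simp: lookup_hcomp supported_def mdeg_add)
  finally show ?thesis by (simp add: act_apply)
qed

lemma homog_ideal_ann: "supported e \<phi> \<Longrightarrow> homog_ideal (ann \<phi>)"
  unfolding homog_ideal_def using is_ideal_ann act_hcomp[of e \<phi>]
  by (auto simp: ann_def fun_eq_iff)

lemma act_in_span:
  assumes "supported e \<phi>"
  shows "act f \<phi> \<in> fs.span ((\<lambda>m. mon_shift m \<phi>) ` {m. mdeg m \<le> e})"
  unfolding act_def
proof (intro fs.span_sum fs.span_scale)
  fix m
  show "mon_shift m \<phi> \<in> fs.span ((\<lambda>m. mon_shift m \<phi>) ` {m. mdeg m \<le> e})"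
  proof (cases "mdeg m \<le> e")
    case True
    then show ?thesis by (intro fs.span_base) auto
  next
    case False
    then have "mon_shift m \<phi> = 0" using assms by (auto simp: mon_shift_def supported_def mdeg_add fun_eq_iff)
    then show ?thesis using fs.subspace_0[OF fs.subspace_span] by simp
  qed
qed

lemma fin_dim_act_image:
  fixes \<phi> :: "('v::finite \<Rightarrow>\<^sub>0 nat) \<Rightarrow> 'k::field"
  assumes "supported e \<phi>"
  shows "fs.fin_dim ((\<lambda>f. act f \<phi>) ` V)"
  unfolding fs.fin_dim_def using act_in_span[OF assms] finite_mdeg[of e]
  by (intro exI[of _ "(\<lambda>m. mon_shift m \<phi>) ` {m. mdeg m \<le> e}"]) auto

text \<open>Contraction maps the ideals above \<open>ann \<phi>\<close> injectively to subspaces of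
  a finite-dimensional space, so along a strictly descending chain the dimension would drop
  forever.\<close>

lemma artinian_ann:
  fixes \<phi> :: "('v::finite \<Rightarrow>\<^sub>0 nat) \<Rightarrow> 'k::field"
  assumes "supported e \<phi>"
  shows "artinian_quotient (ann \<phi>)"
  unfolding artinian_quotient_def
proof
  assume "\<exists>J :: nat \<Rightarrow> ('v, 'k) mpoly set. \<forall>n. is_ideal (J n) \<and> ann \<phi> \<subseteq> J n \<and> J (Suc n) \<subset> J n"
  then obtain J :: "nat \<Rightarrow> ('v, 'k) mpoly set"
    where J0: "\<forall>n. is_ideal (J n) \<and> ann \<phi> \<subseteq> J n \<and> J (Suc n) \<subset> J n" by (elim exE)
  then have J: "is_ideal (J n)" "ann \<phi> \<subseteq> J n" "J (Suc n) \<subset> J n" for n by simp_all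
  interpret L: Vector_Spaces.linear mscale fscale "\<lambda>f. act f \<phi>" by (rule linear_act)
  define A where "A n = (\<lambda>f. act f \<phi>) ` J n" for n
  have sub: "fs.subspace (A n)" for n
    unfolding A_def by (intro L.subspace_image is_ideal_subspace J)
  have lt: "fs.dim (A (Suc n)) < fs.dim (A n)" for n
  proof (rule ccontr)
    assume "\<not> ?thesis"
    moreover have AA: "A (Suc n) \<subseteq> A n" using J(3)[of n] by (auto simp: A_def)
    moreover have "fs.fin_dim (A n)" unfolding A_def by (rule fin_dim_act_image[OF assms])
    ultimately have eq: "A n = A (Suc n)" by (intro fs.subspace_eq_of_dim_le[OF sub]) auto
    obtain f where f: "f \<in> J n" "f \<notin> J (Suc n)" using J(3)[of n] by blast
    then have "act f \<phi> \<in> A (Suc n)" using eq by (auto simp: A_def)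
    then obtain g where g: "g \<in> J (Suc n)" "act f \<phi> = act g \<phi>" by (auto simp: A_def)
    then have "f - g \<in> ann \<phi>" by (simp add: ann_def act_diff)
    then have "(f - g) + g \<in> J (Suc n)" using J(2)[of "Suc n"] g(1) is_idealD(2)[OF J(1)] by blast
    then show False using f(2) by simp
  qed
  have "fs.dim (A n) + n \<le> fs.dim (A 0)" for n
  proof (induction n)
    case (Suc n)
    then show ?case using lt[of n] by simp
  qed simp
  from this[of "Suc (fs.dim (A 0))"] show False by simp
qed

lemma act_nonzero_top:
  assumes "supported e \<phi>" "\<phi> m \<noteq> 0"
  shows "act (Poly_Mapping.single m (inverse (\<phi> m))) \<phi> = (\<lambda>n. if n = 0 then 1 else 0)"
proof -
  have "mdeg m = e" using assms by (auto simp: supported_def)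
  then have "\<phi> (m + n) = 0" if "n \<noteq> 0" for n
  proof -
    have "mdeg n \<noteq> 0" using mdeg_eq_0 that by auto
    then have "mdeg (m + n) \<noteq> e" using \<open>mdeg m = e\<close> by (simp add: mdeg_add)
    then show ?thesis using assms(1) by (simp add: supported_def)
  qed
  then show ?thesis using assms(2) by (simp add: act_single fscale_def mon_shift_def fun_eq_iff)
qed

text \<open>A class is in the socle when all variables contract its image to zero, that is, when the
  image is concentrated at exponent 0. This is a line, and it is reached by a monomial at which
  \<open>\<phi>\<close> is nonzero.\<close>

lemma quot_dim_socle_ann:
  fixes \<phi> :: "('v::finite \<Rightarrow>\<^sub>0 nat) \<Rightarrow> 'k::field"
  assumes \<phi>: "supported e \<phi>" "\<phi> \<noteq> 0"
  shows "quot_dim (socle (ann \<phi>)) (ann \<phi>) = 1"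
proof -
  let ?\<delta> = "(\<lambda>n. if n = 0 then 1 else 0) :: ('v \<Rightarrow>\<^sub>0 nat) \<Rightarrow> 'k"
  have sub: "ms.subspace (socle (ann \<phi>))"
    unfolding ms.subspace_def socle_def mscale_def
    by (auto simp: distrib_left mult.left_commute[of "Var _"] intro: is_idealD[OF is_ideal_ann])
  have soc: "f \<in> socle (ann \<phi>) \<longleftrightarrow> (\<forall>n. n \<noteq> 0 \<longrightarrow> act f \<phi> n = 0)" for f
  proof -
    have "f \<in> socle (ann \<phi>) \<longleftrightarrow> (\<forall>v n. act f \<phi> (Poly_Mapping.single v 1 + n) = 0)"
      by (simp add: socle_def ann_def contract_act[symmetric] contract_def mon_shift_def fun_eq_iff)
    also have "\<dots> \<longleftrightarrow> (\<forall>n. n \<noteq> 0 \<longrightarrow> act f \<phi> n = 0)"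
    proof (intro iffI allI impI)
      fix n :: "'v \<Rightarrow>\<^sub>0 nat"
      assume *: "\<forall>v n. act f \<phi> (Poly_Mapping.single v 1 + n) = 0" and "n \<noteq> 0"
      then have "mdeg n \<noteq> 0" using mdeg_eq_0 by auto
      then obtain d where "mdeg n = Suc d" using not0_implies_Suc by auto
      then obtain v n' where "n = Poly_Mapping.single v 1 + n'" by (rule mdeg_Suc_split)
      then show "act f \<phi> n = 0" using * by simp
    next
      fix v :: 'v and n :: "'v \<Rightarrow>\<^sub>0 nat"
      assume *: "\<forall>n. n \<noteq> 0 \<longrightarrow> act f \<phi> n = 0"
      have "mdeg (Poly_Mapping.single v 1 + n) \<noteq> 0" by (simp add: mdeg_add mdeg_single)
      then have "Poly_Mapping.single v 1 + n \<noteq> 0" by auto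
      then show "act f \<phi> (Poly_Mapping.single v 1 + n) = 0" using * by simp
    qed
    finally show ?thesis .
  qed
  obtain m where m: "\<phi> m \<noteq> 0" using \<phi>(2) by (auto simp: fun_eq_iff)
  have "(\<lambda>f. act f \<phi>) ` socle (ann \<phi>) = fs.span {?\<delta>}"
  proof (intro subset_antisym subsetI)
    fix \<theta> assume "\<theta> \<in> (\<lambda>f. act f \<phi>) ` socle (ann \<phi>)"
    then have "\<forall>n. n \<noteq> 0 \<longrightarrow> \<theta> n = 0" using soc by auto
    then have "\<theta> = fscale (\<theta> 0) ?\<delta>" by (auto simp: fscale_def fun_eq_iff)
    then show "\<theta> \<in> fs.span {?\<delta>}" by (metis fs.span_base fs.span_scale singletonI)
  next
    fix \<theta> assume "\<theta> \<in> fs.span {?\<delta>}"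
    then obtain c where "\<theta> = fscale c ?\<delta>" unfolding fs.span_singleton by (elim rangeE)
    then have t: "\<theta> = act (mscale c (Poly_Mapping.single m (inverse (\<phi> m)))) \<phi>"
      by (simp add: mscale_def act_mult act_Const act_nonzero_top[OF \<phi>(1) m])
    moreover have "mscale c (Poly_Mapping.single m (inverse (\<phi> m))) \<in> socle (ann \<phi>)"
    proof -
      have "act (mscale c (Poly_Mapping.single m (inverse (\<phi> m)))) \<phi> = fscale c ?\<delta>"
        using t \<open>\<theta> = fscale c ?\<delta>\<close> by (simp only:)
      then show ?thesis unfolding soc by (simp add: fscale_def)
    qed
    ultimately show "\<theta> \<in> (\<lambda>f. act f \<phi>) ` socle (ann \<phi>)" by blast
  qed
  moreover have "?\<delta> \<noteq> 0" by (auto simp: fun_eq_iff)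
  then have "fs.dim (fs.span {?\<delta>}) = 1" using fs.dim_span_eq_card_independent[of "{?\<delta>}"] by simp
  moreover have "quot_dim (socle (ann \<phi>)) (ann \<phi>) = fs.dim ((\<lambda>f. act f \<phi>) ` socle (ann \<phi>))"
    by (rule quot_dim_linear(3)[OF vspace_fscale linear_act sub _ fin_dim_act_image[OF \<phi>(1)]]) (simp add: ann_def)
  ultimately show ?thesis by simp
qed

lemma artinian_gorenstein_ann:
  fixes \<phi> :: "('v::finite \<Rightarrow>\<^sub>0 nat) \<Rightarrow> 'k::field"
  assumes "supported e \<phi>" "\<phi> \<noteq> 0"
  shows "artinian_gorenstein (ann \<phi>)"
  unfolding artinian_gorenstein_def
  using homog_ideal_ann artinian_ann quot_dim_socle_ann assms by blast

lemma hilbert_fun_ann: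
  fixes \<phi> :: "('v::finite \<Rightarrow>\<^sub>0 nat) \<Rightarrow> 'k::field"
  shows "hilbert_fun (ann \<phi>) d = hd_fun \<phi> d"
  unfolding hilbert_fun_def inv_sys_def
  by (rule quot_dim_linear(3)[OF vspace_fscale linear_act subspace_homog _ fin_dim_inv_sys[unfolded inv_sys_def]])
    (simp add: ann_def)

section \<open>Multiplication by conics\<close>

text \<open>\<open>submatrix\<close> lists indices increasingly by \<open>pick\<close>, while the
  selection lemma yields an unordered choice. The chosen indices are distinct and below
  \<open>N\<close>, as otherwise the determinant vanishes, and reordering them does not affect the
  independence of the rows.\<close>

lemma minor_exists:
  fixes F :: "nat \<Rightarrow> nat \<Rightarrow> 'k::idom"
  assumes ind: "\<And>c. (\<And>s. s < N \<Longrightarrow> (\<Sum>a<r. c a * F a s) = 0) \<Longrightarrow> \<forall>a<r. c a = 0"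
  shows "\<exists>P\<subseteq>{..<N}. card P = r \<and> det (mat r r (\<lambda>(a, i). F a (pick P i))) \<noteq> 0"
proof -
  define G where "G a s = (if s < N then F a s else 0)" for a s
  have "\<exists>g. det (mat r r (\<lambda>(a, b). G a (g b))) \<noteq> 0"
  proof (rule det_nonzero_selection)
    fix c assume c: "\<And>x. (\<Sum>a<r. c a * G a x) = 0"
    have "(\<Sum>a<r. c a * F a s) = 0" if "s < N" for s using c[of s] that by (simp add: G_def)
    then show "\<forall>a<r. c a = 0" by (rule ind)
  qed
  then obtain g where g: "det (mat r r (\<lambda>(a, b). G a (g b))) \<noteq> 0" by (elim exE)
  have "transpose_mat (mat r r (\<lambda>(a, b). G a (g b))) = mat r r (\<lambda>(b, a). G a (g b))"
    by (intro eq_matI) auto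
  then have g': "det (mat r r (\<lambda>(b, a). G a (g b))) \<noteq> 0"
    using g det_transpose[of "mat r r (\<lambda>(a, b). G a (g b))" r] by simp
  note indT = det_nonzero_imp_independent[OF g']
  have gN: "g b < N" if b: "b < r" for b
  proof (rule ccontr)
    assume "\<not> g b < N"
    then have "(\<Sum>b'<r. (if b' = b then 1 else 0) * G a (g b')) = 0" for a
      by (intro sum.neutral) (auto simp: G_def)
    from indT[of "\<lambda>b'. if b' = b then 1 else 0", OF this] show False using b by (auto dest: spec[of _ b])
  qed
  have inj: "inj_on g {..<r}"
  proof (rule inj_onI, rule ccontr)
    fix b b' assume bb: "b \<in> {..<r}" "b' \<in> {..<r}" "g b = g b'" "b \<noteq> b'"
    define c where "c x = (if x = b then 1 else 0) - (if x = b' then 1 else (0::'k))" for x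
    have "(\<Sum>x<r. c x * G a (g x)) = 0" for a
    proof -
      have "(\<Sum>x<r. c x * G a (g x)) =
          (\<Sum>x<r. if x = b then G a (g x) else 0) - (\<Sum>x<r. if x = b' then G a (g x) else 0)"
        unfolding sum_subtractf[symmetric] by (intro sum.cong refl) (auto simp: c_def)
      also have "\<dots> = G a (g b) - G a (g b')" using bb(1,2) by simp
      finally show ?thesis using bb(3) by simp
    qed
    from indT[of c, OF this] have "c b = 0" using bb(1) by auto
    then show False using bb(4) by (simp add: c_def)
  qed
  define P where "P = g ` {..<r}"
  have PN: "P \<subseteq> {..<N}" using gN by (auto simp: P_def)
  have cP: "card P = r" using inj by (simp add: P_def card_image)
  have fP: "finite P" by (simp add: P_def)
  have "det (mat r r (\<lambda>(a, i). F a (pick P i))) \<noteq> 0"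
  proof (rule independent_imp_det_nonzero)
    fix c assume c: "\<And>i. i < r \<Longrightarrow> (\<Sum>a<r. c a * F a (pick P i)) = 0"
    have "(\<Sum>a<r. c a * G a (g b)) = 0" if b: "b < r" for b
    proof -
      let ?i = "card {x \<in> P. x < g b}"
      have gP: "g b \<in> P" using b by (auto simp: P_def)
      have "{x \<in> P. x < g b} \<subset> P" using gP by auto
      then have "?i < r" using psubset_card_mono[OF fP] cP by simp
      moreover have "pick P ?i = g b" by (rule pick_card_in_set[OF gP])
      ultimately show ?thesis using c[of ?i] gN[OF b] by (simp add: G_def)
    qed
    then show "\<forall>a<r. c a = 0" by (rule det_nonzero_imp_independent[OF g])
  qed
  then show ?thesis using PN cP by blast
qed

lemma pick_lessThan: "i < r \<Longrightarrow> pick {..<r} i = i"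
proof -
  assume i: "i < r"
  have "{a \<in> {..<r}. a < i} = {..<i}" using i by auto
  then show ?thesis using pick_card_in_set[of i "{..<r}"] i by simp
qed

lemma quot_coord_spec:
  assumes "quot_basis V I cs" "f \<in> V"
  shows "f - (\<Sum>s<length cs. Const (quot_coord I cs f s) * cs ! s) \<in> I"
proof -
  have "\<exists>c. f - (\<Sum>s<length cs. Const (c s) * cs ! s) \<in> I" using assms unfolding quot_basis_def by blast
  then show ?thesis unfolding quot_coord_def by (rule someI_ex)
qed

lemma quot_basis_unique:
  assumes "quot_basis V I cs" "is_ideal I"
    and "f - (\<Sum>s<length cs. Const (c s) * cs ! s) \<in> I" "f - (\<Sum>s<length cs. Const (d s) * cs ! s) \<in> I"
    and "s < length cs"
  shows "c s = d s"
proof -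
  have "(f - (\<Sum>s<length cs. Const (d s) * cs ! s)) - (f - (\<Sum>s<length cs. Const (c s) * cs ! s)) \<in> I"
    by (rule is_ideal_diff[OF assms(2,4,3)])
  then have "(\<Sum>s<length cs. Const (c s - d s) * cs ! s) \<in> I"
    by (simp add: Const_diff left_diff_distrib sum_subtractf)
  moreover have "\<forall>c. (\<Sum>s<length cs. Const (c s) * cs ! s) \<in> I \<longrightarrow> (\<forall>s<length cs. c s = 0)"
    using assms(1) unfolding quot_basis_def by blast
  ultimately have "\<forall>s<length cs. c s - d s = 0" by (elim allE[of _ "\<lambda>s. c s - d s"]) simp
  then show ?thesis using assms(5) by simp
qed

lemma quot_coord_eqI:
  assumes "quot_basis V I cs" "is_ideal I" "f \<in> V"
    and "f - (\<Sum>s<length cs. Const (c s) * cs ! s) \<in> I" "s < length cs"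
  shows "quot_coord I cs f s = c s"
  by (rule quot_basis_unique[OF assms(1,2) quot_coord_spec[OF assms(1,3)] assms(4,5)])

lemma quot_coord_sum:
  assumes cs: "quot_basis V I cs" and I: "is_ideal I" and f: "f \<in> V"
    and F: "\<And>l. l < n \<Longrightarrow> F l \<in> V" "f - (\<Sum>l<n. Const (d l) * F l) \<in> I" and s: "s < length cs"
  shows "quot_coord I cs f s = (\<Sum>l<n. d l * quot_coord I cs (F l) s)"
proof (rule quot_coord_eqI[OF cs I f _ s])
  have "(\<Sum>l<n. Const (d l) * (F l - (\<Sum>s<length cs. Const (quot_coord I cs (F l) s) * cs ! s))) \<in> I"
    by (intro is_ideal_sum[OF I] is_idealD(3)[OF I] quot_coord_spec[OF cs] F(1)) simp
  from is_idealD(2)[OF I F(2) this]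
  have "f - (\<Sum>l<n. \<Sum>s<length cs. Const (d l) * (Const (quot_coord I cs (F l) s) * cs ! s)) \<in> I"
    by (simp add: right_diff_distrib sum_subtractf sum_distrib_left)
  also have "(\<Sum>l<n. \<Sum>s<length cs. Const (d l) * (Const (quot_coord I cs (F l) s) * cs ! s)) =
      (\<Sum>s<length cs. Const (\<Sum>l<n. d l * quot_coord I cs (F l) s) * cs ! s)"
    by (subst sum.swap) (simp add: Const_sum Const_mult sum_distrib_right mult.assoc)
  finally show "f - (\<Sum>s<length cs. Const (\<Sum>l<n. d l * quot_coord I cs (F l) s) * cs ! s) \<in> I" .
qed

lemma homog_conic_monom: "conic_monom t \<in> homog 2"
  using homog_mult[OF homog_Var homog_Var] by (auto simp: conic_monom_def numeral_2_eq_2)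

context gorenstein_ideal begin

lemma graded_basis: "quot_basis (homog d) I (graded_basis I d)"
proof -
  obtain \<phi> where "dual_coords e I \<phi>" using exists_dual by (elim exE)
  from quot_basis_homog(1)[OF this] show ?thesis unfolding graded_basis_def by (rule someI_ex)
qed

lemma length_graded_basis: "length (graded_basis I d) = hilbert_fun I d"
proof -
  obtain \<phi> where \<phi>: "dual_coords e I \<phi>" using exists_dual by (elim exE)
  show ?thesis using quot_basis_homog(2)[OF \<phi> graded_basis] quot_basis_homog(3)[OF \<phi>] by simp
qed

lemma graded_basis_homog: "l < length (graded_basis I d) \<Longrightarrow> graded_basis I d ! l \<in> homog d"
  using graded_basis unfolding quot_basis_def by (meson nth_mem subsetD)

end

section \<open>Minors of the conic matrix\<close>

text \<open>The coordinates of the conic \<open>Var 0 * Var 0\<close>, at which the minors are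
  evaluated.\<close>

definition base_conic :: "6 \<Rightarrow> 'k::field" where
  "base_conic t = (if t = 0 then 1 else 0)"

lemma eval_conic_entry:
  "eval_mpoly base_conic (\<Sum>t\<in>UNIV. Const (c t) * Var t) = (c 0 :: 'k::field)"
proof -
  interpret E: comm_ring_hom "eval_mpoly base_conic :: (6, 'k) mpoly \<Rightarrow> 'k" by (rule comm_ring_hom_eval)
  have "eval_mpoly base_conic (\<Sum>t\<in>UNIV. Const (c t) * Var t) = (\<Sum>t\<in>UNIV. c t * base_conic t)"
    by (simp add: E.hom_sum E.hom_mult eval_Const eval_Var)
  also have "\<dots> = (\<Sum>t\<in>UNIV. if t = 0 then c t else 0)" by (intro sum.cong) (auto simp: base_conic_def)
  finally show ?thesis by simp
qed

lemma submatrix_subset: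
  assumes "P \<subseteq> {..<dim_row M}" "Q \<subseteq> {..<dim_col M}"
  shows "submatrix M P Q = mat (card P) (card Q) (\<lambda>(i, j). M $$ (pick P i, pick Q j))"
proof -
  have "{i. i < dim_row M \<and> i \<in> P} = P" "{j. j < dim_col M \<and> j \<in> Q} = Q" using assms by auto
  then show ?thesis by (simp add: submatrix_def)
qed

lemma pick_subset_less:
  assumes "P \<subseteq> {..<N}" "i < card P"
  shows "pick P i < N"
  using pick_in_set[of i P] assms by auto

text \<open>The linear form whose zeros are the coefficient vectors of the conics through
  \<open>p\<close>.\<close>

definition conic_at :: "(3 \<Rightarrow> 'k::field) \<Rightarrow> (6, 'k) mpoly" where
  "conic_at p = (\<Sum>t\<in>UNIV. Const (eval_mpoly p (conic_monom t)) * Var t)"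

context gorenstein_ideal begin

lemma shifted_product:
  assumes w: "\<And>v. Var v * w - Const (p v) * (Var u * w) \<in> I"
  shows "Var a * Var b * w - Const (p a * p b) * (Var u * Var u * w) \<in> I"
proof -
  have "Var a * (Var b * w - Const (p b) * (Var u * w)) + Const (p b) * Var u * (Var a * w - Const (p a) * (Var u * w)) \<in> I"
    by (intro is_idealD(2)[OF is_ideal] is_idealD(3)[OF is_ideal] w)
  then show ?thesis by (simp add: Const_mult algebra_simps)
qed

end

locale gorenstein_ideal3 = gorenstein_ideal I e for I :: "(3, 'k::field) mpoly set" and e
begin

lemma conic_matrix_dims:
  "dim_row (conic_matrix I j) = hilbert_fun I (j + 2)" "dim_col (conic_matrix I j) = hilbert_fun I j"
  by (simp_all add: conic_matrix_def Let_def length_graded_basis)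

definition entry where
  "entry j t s l = quot_coord I (graded_basis I (j + 2)) (conic_monom t * graded_basis I j ! l) s"

lemma conic_matrix_entry:
  assumes "s < hilbert_fun I (j + 2)" "l < hilbert_fun I j"
  shows "conic_matrix I j $$ (s, l) = (\<Sum>t\<in>UNIV. Const (entry j t s l) * Var t)"
  using assms by (simp add: conic_matrix_def Let_def length_graded_basis entry_def)

lemma eval_minor:
  assumes "P \<subseteq> {..<hilbert_fun I (j + 2)}" "Q \<subseteq> {..<hilbert_fun I j}" "card P = r" "card Q = r"
  shows "eval_mpoly base_conic (det (submatrix (conic_matrix I j) P Q)) =
    det (mat r r (\<lambda>(i, k). entry j 0 (pick P i) (pick Q k)))"
proof -
  interpret E: comm_ring_hom "eval_mpoly base_conic :: (6, 'k) mpoly \<Rightarrow> 'k" by (rule comm_ring_hom_eval)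
  have "map_mat (eval_mpoly base_conic) (submatrix (conic_matrix I j) P Q) =
      mat r r (\<lambda>(i, k). entry j 0 (pick P i) (pick Q k))"
    using assms pick_subset_less[OF assms(1)] pick_subset_less[OF assms(2)]
    by (intro eq_matI) (simp_all add: submatrix_subset conic_matrix_dims conic_matrix_entry eval_conic_entry)
  then show ?thesis using E.hom_det[of "submatrix (conic_matrix I j) P Q"] by simp
qed

lemma quot_coord_conic:
  assumes "f \<in> homog j" "f - (\<Sum>l<hilbert_fun I j. Const (d l) * graded_basis I j ! l) \<in> I" "s < hilbert_fun I (j + 2)"
  shows "quot_coord I (graded_basis I (j + 2)) (conic_monom t * f) s = (\<Sum>l<hilbert_fun I j. d l * entry j t s l)"
  unfolding entry_def
proof (rule quot_coord_sum[OF graded_basis is_ideal])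
  show "conic_monom t * f \<in> homog (j + 2)" using homog_mult[OF homog_conic_monom assms(1), of t] by (simp add: add.commute)
  show "conic_monom t * graded_basis I j ! l \<in> homog (j + 2)" if "l < hilbert_fun I j" for l
    using homog_mult[OF homog_conic_monom graded_basis_homog, of l j t] that
    by (simp add: length_graded_basis add.commute)
  have "conic_monom t * (f - (\<Sum>l<hilbert_fun I j. Const (d l) * graded_basis I j ! l)) \<in> I"
    by (rule is_idealD(3)[OF is_ideal assms(2)])
  then show "conic_monom t * f - (\<Sum>l<hilbert_fun I j. Const (d l) * (conic_monom t * graded_basis I j ! l)) \<in> I"
    by (simp add: right_diff_distrib sum_distrib_left mult.left_commute)
qed (use assms(3) in \<open>simp add: length_graded_basis\<close>)

lemma minor_nonzero_of_inj:
  assumes inj: "\<And>f. f \<in> homog j \<Longrightarrow> conic_monom 0 * f \<in> I \<Longrightarrow> f \<in> I"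
  shows "\<exists>\<mu>\<in>maximal_minors (conic_matrix I j). eval_mpoly base_conic \<mu> \<noteq> 0"
proof -
  let ?N = "hilbert_fun I (j + 2)" and ?r = "hilbert_fun I j"
  have "\<exists>P\<subseteq>{..<?N}. card P = ?r \<and> det (mat ?r ?r (\<lambda>(l, i). entry j 0 (pick P i) l)) \<noteq> 0"
  proof (rule minor_exists)
    fix c assume c: "\<And>s. s < ?N \<Longrightarrow> (\<Sum>l<?r. c l * entry j 0 s l) = 0"
    let ?f = "\<Sum>l<?r. Const (c l) * graded_basis I j ! l"
    have f: "?f \<in> homog j"
      by (intro homog_sum homog_scale graded_basis_homog) (simp add: length_graded_basis)
    have "?f - ?f \<in> I" using is_idealD(1)[OF is_ideal] by simp
    from quot_coord_conic[OF f this] c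
    have z: "quot_coord I (graded_basis I (j + 2)) (conic_monom 0 * ?f) s = 0" if "s < ?N" for s using that by simp
    have "conic_monom 0 * ?f \<in> homog (j + 2)" using homog_mult[OF homog_conic_monom f, of 0] by (simp add: add.commute)
    note spec = quot_coord_spec[OF graded_basis this]
    have "(\<Sum>s<length (graded_basis I (j + 2)). Const (quot_coord I (graded_basis I (j + 2)) (conic_monom 0 * ?f) s)
        * graded_basis I (j + 2) ! s) = 0"
      by (intro sum.neutral ballI) (simp only: lessThan_iff length_graded_basis z Const_0 mult_zero_left)
    with spec have "conic_monom 0 * ?f \<in> I" by (simp only: diff_zero)
    then have "?f \<in> I" using inj[OF f] by simp
    moreover have "\<forall>c. (\<Sum>l<?r. Const (c l) * graded_basis I j ! l) \<in> I \<longrightarrow> (\<forall>l<?r. c l = 0)"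
      using graded_basis[of j] unfolding quot_basis_def length_graded_basis by blast
    ultimately show "\<forall>l<?r. c l = 0" by (elim allE[of _ c]) simp
  qed
  then obtain P where P: "P \<subseteq> {..<?N}" "card P = ?r"
    and d: "det (mat ?r ?r (\<lambda>(l, i). entry j 0 (pick P i) l)) \<noteq> 0" by (elim exE conjE)
  have "transpose_mat (mat ?r ?r (\<lambda>(l, i). entry j 0 (pick P i) l)) =
      mat ?r ?r (\<lambda>(i, k). entry j 0 (pick P i) (pick {..<?r} k))"
    by (intro eq_matI) (auto simp: pick_lessThan)
  then have "det (mat ?r ?r (\<lambda>(i, k). entry j 0 (pick P i) (pick {..<?r} k))) \<noteq> 0"
    using d det_transpose[of "mat ?r ?r (\<lambda>(l, i). entry j 0 (pick P i) l)" ?r] by simp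
  then have "eval_mpoly base_conic (det (submatrix (conic_matrix I j) P {..<?r})) \<noteq> 0"
    using eval_minor[OF P(1) subset_refl P(2)] by simp
  moreover have "?r \<le> ?N" using card_mono[OF _ P(1)] P(2) by simp
  then have "det (submatrix (conic_matrix I j) P {..<?r}) \<in> maximal_minors (conic_matrix I j)"
    unfolding maximal_minors_def conic_matrix_dims
    using P by (intro CollectI exI[of _ P] exI[of _ "{..<?r}"]) (simp add: min_def)
  ultimately show ?thesis by blast
qed

text \<open>The rows are independent: writing the basis element \<open>s0\<close> as
  \<open>conic_monom 0 * g\<close> produces a combination of the columns equal to a unit vector, on
  which a relation \<open>c\<close> between the rows takes the value \<open>c s0\<close>.\<close>

lemma minor_nonzero_of_surj:
  assumes surj: "\<And>f. f \<in> homog (j + 2) \<Longrightarrow> \<exists>g\<in>homog j. f - conic_monom 0 * g \<in> I"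
  shows "\<exists>\<mu>\<in>maximal_minors (conic_matrix I j). eval_mpoly base_conic \<mu> \<noteq> 0"
proof -
  let ?r = "hilbert_fun I (j + 2)" and ?N = "hilbert_fun I j"
  let ?cs = "graded_basis I (j + 2)"
  have "\<exists>P\<subseteq>{..<?N}. card P = ?r \<and> det (mat ?r ?r (\<lambda>(s, i). entry j 0 s (pick P i))) \<noteq> 0"
  proof (rule minor_exists)
    fix c assume c: "\<And>l. l < ?N \<Longrightarrow> (\<Sum>s<?r. c s * entry j 0 s l) = 0"
    show "\<forall>s<?r. c s = 0"
    proof (intro allI impI)
      fix s0 assume s0: "s0 < ?r"
      have csh: "?cs ! s0 \<in> homog (j + 2)" using s0 by (intro graded_basis_homog) (simp add: length_graded_basis)
      then obtain g where g: "g \<in> homog j" "?cs ! s0 - conic_monom 0 * g \<in> I" using surj by blast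
      define d where "d = quot_coord I (graded_basis I j) g"
      have gd: "g - (\<Sum>l<?N. Const (d l) * graded_basis I j ! l) \<in> I"
        using quot_coord_spec[OF graded_basis g(1)] by (simp add: d_def length_graded_basis)
      have "(\<Sum>l<?N. d l * entry j 0 s l) = (if s = s0 then 1 else 0)" if s: "s < ?r" for s
      proof -
        have "(\<Sum>l<?N. d l * entry j 0 s l) = quot_coord I ?cs (conic_monom 0 * g) s"
          using quot_coord_conic[OF g(1) gd s] by simp
        also have "\<dots> = (if s = s0 then 1 else 0)"
        proof (rule quot_coord_eqI[OF graded_basis is_ideal])
          show "conic_monom 0 * g \<in> homog (j + 2)"
            using homog_mult[OF homog_conic_monom g(1), of 0] by (simp add: add.commute)
          have "(\<Sum>s<length ?cs. Const (if s = s0 then 1 else 0) * ?cs ! s) =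
              (\<Sum>s<length ?cs. if s = s0 then ?cs ! s else 0)" by (intro sum.cong) auto
          also have "\<dots> = ?cs ! s0" using s0 by (simp add: length_graded_basis)
          finally have "conic_monom 0 * g - (\<Sum>s<length ?cs. Const (if s = s0 then 1 else 0) * ?cs ! s) =
              - 1 * (?cs ! s0 - conic_monom 0 * g)" by simp
          then show "conic_monom 0 * g - (\<Sum>s<length ?cs. Const (if s = s0 then 1 else 0) * ?cs ! s) \<in> I"
            using is_idealD(3)[OF is_ideal g(2), of "- 1"] by (simp only:)
        qed (use s in \<open>simp add: length_graded_basis\<close>)
        finally show ?thesis .
      qed
      then have "(\<Sum>s<?r. c s * (\<Sum>l<?N. d l * entry j 0 s l)) = (\<Sum>s<?r. if s = s0 then c s else 0)"
        by (intro sum.cong) auto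
      also have "\<dots> = c s0" using s0 by simp
      finally have "c s0 = (\<Sum>s<?r. \<Sum>l<?N. d l * (c s * entry j 0 s l))"
        by (simp add: sum_distrib_left mult.left_commute)
      also have "\<dots> = (\<Sum>l<?N. d l * (\<Sum>s<?r. c s * entry j 0 s l))"
        by (subst sum.swap) (simp add: sum_distrib_left)
      also have "\<dots> = 0" using c by simp
      finally show "c s0 = 0" .
    qed
  qed
  then obtain P where P: "P \<subseteq> {..<?N}" "card P = ?r"
    and d: "det (mat ?r ?r (\<lambda>(s, i). entry j 0 s (pick P i))) \<noteq> 0" by (elim exE conjE)
  have "mat ?r ?r (\<lambda>(s, i). entry j 0 s (pick P i)) =
      mat ?r ?r (\<lambda>(i, k). entry j 0 (pick {..<?r} i) (pick P k))"
    by (intro eq_matI) (auto simp: pick_lessThan)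
  then have "eval_mpoly base_conic (det (submatrix (conic_matrix I j) {..<?r} P)) \<noteq> 0"
    using eval_minor[OF subset_refl P(1) _ P(2)] d by simp
  moreover have "?r \<le> ?N" using card_mono[OF _ P(1)] P(2) by simp
  then have "det (submatrix (conic_matrix I j) {..<?r} P) \<in> maximal_minors (conic_matrix I j)"
    unfolding maximal_minors_def conic_matrix_dims
    using P by (intro CollectI exI[of _ "{..<?r}"] exI[of _ P]) (simp add: min_def)
  ultimately show ?thesis by blast
qed

text \<open>A class \<open>w\<close> on which every linear form acts like its value at \<open>p\<close> times \<open>Var 0\<close> lies in the
  kernel of each conic through \<open>p\<close>, so the linear form \<open>conic_at p\<close> divides the maximal minors.\<close>

lemma conic_at_dvd_minors:
  assumes w: "w \<in> homog j" "w \<notin> I" "\<And>v. Var v * w - Const (p v) * (Var 0 * w) \<in> I"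
    and le: "hilbert_fun I j \<le> hilbert_fun I (j + 2)"
    and \<mu>: "\<mu> \<in> maximal_minors (conic_matrix I j)"
  shows "conic_at p dvd \<mu>"
proof -
  let ?r = "hilbert_fun I j" and ?N = "hilbert_fun I (j + 2)" and ?cs = "graded_basis I (j + 2)"
  interpret E: comm_ring_hom "eval_mpoly p :: (3, 'k) mpoly \<Rightarrow> 'k" by (rule comm_ring_hom_eval)
  obtain P Q where PQ: "\<mu> = det (submatrix (conic_matrix I j) P Q)" "P \<subseteq> {..<?N}" "Q \<subseteq> {..<?r}"
    "card P = ?r" "card Q = ?r"
    using \<mu> le unfolding maximal_minors_def conic_matrix_dims by (auto simp: min_def)
  \<comment> \<open>By \<open>le\<close> the matrix has at least as many rows as columns, so a
    maximal minor uses all columns and sees the full coordinate vector of \<open>w\<close>.\<close>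
  have Q: "Q = {..<?r}" using PQ(3,5) by (intro card_subset_eq) auto
  define \<omega> where "\<omega> = quot_coord I (graded_basis I j) w"
  have w\<omega>: "w - (\<Sum>l<?r. Const (\<omega> l) * graded_basis I j ! l) \<in> I"
    using quot_coord_spec[OF graded_basis w(1)] by (simp add: \<omega>_def length_graded_basis)
  have "\<exists>l<?r. \<omega> l \<noteq> 0"
  proof (rule ccontr)
    assume "\<not> ?thesis"
    then have "(\<Sum>l<?r. Const (\<omega> l) * graded_basis I j ! l) = 0" by (intro sum.neutral) auto
    then show False using w\<omega> w(2) by simp
  qed
  then obtain l0 where l0: "l0 < ?r" "\<omega> l0 \<noteq> 0" by blast
  define u where "u = quot_coord I ?cs (conic_monom 0 * w)"
  have q0: "conic_monom t * w - Const (eval_mpoly p (conic_monom t)) * (conic_monom 0 * w) \<in> I" for t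
    using shifted_product[OF w(3)] by (auto simp: conic_monom_def E.hom_mult eval_Var)
  have qt: "(\<Sum>l<?r. \<omega> l * entry j t s l) = eval_mpoly p (conic_monom t) * u s" if s: "s < ?N" for s t
  proof -
    have "(\<Sum>l<?r. \<omega> l * entry j t s l) = quot_coord I ?cs (conic_monom t * w) s"
      using quot_coord_conic[OF w(1) w\<omega> s] by simp
    also have "\<dots> = (\<Sum>l<(1::nat). eval_mpoly p (conic_monom t) * quot_coord I ?cs (conic_monom 0 * w) s)"
      using q0[of t] s homog_mult[OF homog_conic_monom w(1)]
      by (intro quot_coord_sum[OF graded_basis is_ideal]) (auto simp: length_graded_basis add.commute)
    finally show ?thesis by (simp add: u_def)
  qed
  let ?S = "submatrix (conic_matrix I j) P Q"
  have S: "?S = mat ?r ?r (\<lambda>(i, l). \<Sum>t\<in>UNIV. Const (entry j t (pick P i) l) * Var t)"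
    using PQ pick_subset_less[OF PQ(2)]
    by (intro eq_matI) (simp_all add: submatrix_subset conic_matrix_dims conic_matrix_entry Q pick_lessThan)
  have Sc: "?S \<in> carrier_mat ?r ?r" by (simp add: S)
  let ?v = "vec ?r (\<lambda>l. Const (\<omega> l))"
  have Sv: "?S *\<^sub>v ?v = vec ?r (\<lambda>i. conic_at p * Const (u (pick P i)))"
  proof (rule eq_vecI)
    fix i assume "i < dim_vec (vec ?r (\<lambda>i. conic_at p * Const (u (pick P i))))"
    then have i: "i < ?r" by simp
    then have pi: "pick P i < ?N" using pick_subset_less[OF PQ(2)] PQ(4) by simp
    have "(?S *\<^sub>v ?v) $ i = (\<Sum>l = 0..<?r. (\<Sum>t\<in>UNIV. Const (entry j t (pick P i) l) * Var t) * Const (\<omega> l))"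
      using i by (simp add: S scalar_prod_def)
    also have "\<dots> = (\<Sum>l<?r. \<Sum>t\<in>UNIV. Const (\<omega> l * entry j t (pick P i) l) * Var t)"
      by (simp add: lessThan_atLeast0 sum_distrib_left sum_distrib_right Const_mult ac_simps)
    also have "\<dots> = (\<Sum>t\<in>UNIV. \<Sum>l<?r. Const (\<omega> l * entry j t (pick P i) l) * Var t)" by (rule sum.swap)
    also have "\<dots> = (\<Sum>t\<in>UNIV. Const (\<Sum>l<?r. \<omega> l * entry j t (pick P i) l) * Var t)"
      by (simp add: Const_sum sum_distrib_right)
    also have "\<dots> = conic_at p * Const (u (pick P i))"
      unfolding qt[OF pi] conic_at_def by (simp add: Const_mult sum_distrib_left sum_distrib_right ac_simps)
    finally show "(?S *\<^sub>v ?v) $ i = vec ?r (\<lambda>i. conic_at p * Const (u (pick P i))) $ i" using i by simp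
  qed (simp add: S)
  \<comment> \<open>Cramer's rule: the adjugate turns \<open>S v\<close>, divisible by
    \<open>conic_at p\<close>, into \<open>det S\<close> times \<open>v\<close>; the entry
    \<open>\<omega> l0\<close> is an invertible constant.\<close>
  have "adj_mat ?S *\<^sub>v (?S *\<^sub>v ?v) = (adj_mat ?S * ?S) *\<^sub>v ?v"
    using adj_mat(1)[OF Sc] Sc by (intro assoc_mult_mat_vec[symmetric]) auto
  also have "\<dots> = det ?S \<cdot>\<^sub>v ?v"
    unfolding adj_mat(3)[OF Sc] by (intro eq_vecI) auto
  finally have "(adj_mat ?S *\<^sub>v (?S *\<^sub>v ?v)) $ l0 = \<mu> * Const (\<omega> l0)"
    using l0(1) by (simp add: PQ(1))
  moreover have "(adj_mat ?S *\<^sub>v (?S *\<^sub>v ?v)) $ l0 =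
      (\<Sum>i = 0..<?r. adj_mat ?S $$ (l0, i) * (conic_at p * Const (u (pick P i))))"
    unfolding Sv using l0(1) adj_mat(1)[OF Sc] by (auto simp: scalar_prod_def)
  moreover have "conic_at p dvd (\<Sum>i = 0..<?r. adj_mat ?S $$ (l0, i) * (conic_at p * Const (u (pick P i))))"
    by (intro dvd_sum) simp
  ultimately have "conic_at p dvd \<mu> * Const (\<omega> l0)" by simp
  then have "conic_at p dvd \<mu> * Const (\<omega> l0) * Const (inverse (\<omega> l0))" by (rule dvd_mult2)
  then show ?thesis using l0(2) by (simp add: mult.assoc flip: Const_mult)
qed

end

section \<open>Codimension of hypersurfaces\<close>

lemma closedin_proj_space:
  "closedin (proj_space :: ('v, 'k::comm_ring_1) mpoly set topology) Y \<longleftrightarrow>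
    (\<exists>J. homog_ideal J \<and> Y = proj_vanishing J)"
proof -
  have "homog_ideal (UNIV :: ('v, 'k) mpoly set)"
    unfolding homog_ideal_def by (auto intro: is_idealI)
  moreover have "proj_vanishing (UNIV :: ('v, 'k) mpoly set) = {}"
    by (auto simp: proj_vanishing_def proj_points_def)
  ultimately have "openin proj_space (proj_points :: ('v, 'k) mpoly set set)"
    unfolding openin_proj_space by (intro exI[of _ UNIV]) auto
  moreover have "U \<subseteq> proj_points" if "openin proj_space U" for U :: "('v, 'k) mpoly set set"
    using that unfolding openin_proj_space by auto
  ultimately have top: "topspace proj_space = (proj_points :: ('v, 'k) mpoly set set)"
    by (metis openin_subset openin_topspace subset_antisym)
  show ?thesis
  proof
    assume "closedin proj_space Y"
    then have Y: "Y \<subseteq> proj_points" "openin proj_space (proj_points - Y)" by (auto simp: closedin_def top)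
    then obtain J where J: "homog_ideal J" "proj_points - Y = proj_points - proj_vanishing J"
      unfolding openin_proj_space by auto
    have "proj_vanishing J \<subseteq> proj_points" by (auto simp: proj_vanishing_def)
    then have "Y = proj_vanishing J" using J(2) Y(1) by blast
    then show "\<exists>J. homog_ideal J \<and> Y = proj_vanishing J" using J(1) by blast
  next
    assume "\<exists>J. homog_ideal J \<and> Y = proj_vanishing J"
    then obtain J where J: "homog_ideal J" "Y = proj_vanishing J" by blast
    then have "Y \<subseteq> proj_points" by (auto simp: proj_vanishing_def)
    then show "closedin proj_space Y" unfolding closedin_def top openin_proj_space using J by blast
  qed
qed

lemma proj_pointsD:
  assumes "P \<in> proj_points"
  shows "homog_ideal P" "is_ideal P" "1 \<notin> P" "\<And>a b. a * b \<in> P \<Longrightarrow> a \<in> P \<or> b \<in> P"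
  using assms by (auto simp: proj_points_def prime_ideal_def homog_ideal_def)

lemma hcomp_mult_homog:
  fixes f g :: "('v, 'k::comm_ring_1) mpoly"
  assumes "f \<in> homog d"
  shows "hcomp n (f * g) = (if d \<le> n then f * hcomp (n - d) g else 0)"
proof -
  have "f * g = (\<Sum>i\<in>mdeg ` Poly_Mapping.keys g. f * hcomp i g)"
    by (subst mpoly_eq_sum_hcomp[of g]) (simp add: sum_distrib_left)
  then have "hcomp n (f * g) = (\<Sum>i\<in>mdeg ` Poly_Mapping.keys g. hcomp n (f * hcomp i g))"
    by (simp add: hcomp_sum)
  also have "\<dots> = (\<Sum>i\<in>mdeg ` Poly_Mapping.keys g. if i + d = n then f * hcomp i g else 0)"
  proof (intro sum.cong refl)
    fix i
    show "hcomp n (f * hcomp i g) = (if i + d = n then f * hcomp i g else 0)"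
      using hcomp_of_homog[OF homog_mult[OF assms hcomp_homog[of i g]], of n] by (auto simp: add.commute)
  qed
  also have "\<dots> = (if d \<le> n then f * hcomp (n - d) g else 0)"
  proof (cases "d \<le> n")
    case True
    have "(\<Sum>i\<in>mdeg ` Poly_Mapping.keys g. if i + d = n then f * hcomp i g else 0) =
        (\<Sum>i\<in>mdeg ` Poly_Mapping.keys g. if i = n - d then f * hcomp i g else 0)"
      using True by (intro sum.cong) auto
    also have "\<dots> = f * hcomp (n - d) g"
    proof (cases "n - d \<in> mdeg ` Poly_Mapping.keys g")
      case False
      then have "hcomp (n - d) g = 0"
      proof (intro poly_mapping_eqI)
        fix k
        have "k \<notin> Poly_Mapping.keys g" if "mdeg k = n - d" using False that by (metis imageI)
        then show "Poly_Mapping.lookup (hcomp (n - d) g) k = Poly_Mapping.lookup 0 k"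
          by (simp add: lookup_hcomp in_keys_iff)
      qed
      then show ?thesis using False by simp
    qed simp
    finally show ?thesis using True by simp
  next
    case False
    then show ?thesis by (auto intro!: sum.neutral)
  qed
  finally show ?thesis .
qed

definition principal :: "'a::comm_ring_1 \<Rightarrow> 'a set" where
  "principal D = {f. D dvd f}"

lemma is_ideal_principal: "is_ideal (principal D)"
  by (rule is_idealI) (auto simp: principal_def)

lemma homog_ideal_principal:
  assumes "D \<in> homog d"
  shows "homog_ideal (principal D)"
  unfolding homog_ideal_def
  using is_ideal_principal by (auto simp: principal_def hcomp_mult_homog[OF assms] elim!: dvdE)

lemma homog_ideal_zero: "homog_ideal {0}"
  unfolding homog_ideal_def
  by (auto intro!: is_idealI poly_mapping_eqI simp: lookup_hcomp)

text \<open>The generic point of projective space. An order on the variables is asked for because it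
  orders the exponents and thereby excludes zero divisors.\<close>

lemma zero_in_proj_points: "{0} \<in> (proj_points :: ('v::linorder, 'k::field) mpoly set set)"
  using homog_ideal_zero homog_ideal_def Var_neq_0
  by (fastforce simp: proj_points_def prime_ideal_def)

lemma ideal_eqI_hcomp:
  assumes "homog_ideal J" "\<And>f d. f \<in> J \<Longrightarrow> f \<in> homog d \<Longrightarrow> f = 0"
  shows "J \<subseteq> {0}"
proof
  fix f assume f: "f \<in> J"
  have "hcomp d f = 0" for d
  proof (rule assms(2)[OF _ hcomp_homog])
    show "hcomp d f \<in> J" using assms(1) f by (simp add: homog_ideal_def)
  qed
  then have "(\<Sum>d\<in>mdeg ` Poly_Mapping.keys f. hcomp d f) = 0" by simp
  then have "f = 0" by (rule trans[OF mpoly_eq_sum_hcomp])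
  then show "f \<in> {0}" by simp
qed

text \<open>\<open>P\<close> is a generic point: a closed set that contains the point
  \<open>P\<close> contains its whole vanishing set.\<close>

lemma irreducible_proj_vanishing:
  assumes P: "P \<in> proj_points"
  shows "irreducible_closedin proj_space (proj_vanishing P)"
  unfolding irreducible_closedin_def
proof (intro conjI allI impI)
  show "closedin proj_space (proj_vanishing P)"
    unfolding closedin_proj_space using proj_pointsD(1)[OF P] by blast
  have PP: "P \<in> proj_vanishing P" using P by (simp add: proj_vanishing_def)
  then show "proj_vanishing P \<noteq> {}" by blast
  have gen: "proj_vanishing P \<subseteq> F" if F: "closedin proj_space F" "P \<in> F" for F
  proof -
    obtain J where J: "F = proj_vanishing J" using F(1) unfolding closedin_proj_space by blast
    then have "J \<subseteq> P" using F(2) by (simp add: proj_vanishing_def)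
    then show ?thesis unfolding J by (auto simp: proj_vanishing_def)
  qed
  fix F G assume FG: "closedin proj_space F \<and> closedin proj_space G \<and> proj_vanishing P = F \<union> G"
  then show "proj_vanishing P = F \<or> proj_vanishing P = G" using gen[of F] gen[of G] PP by blast
qed

lemma proj_vanishing_zero: "proj_vanishing {0} = proj_points"
  using proj_pointsD(2) is_idealD(1) by (auto simp: proj_vanishing_def)

text \<open>A homogeneous form of minimal degree vanishing on a closed set strictly larger than \<open>V(D)\<close>
  would be a multiple of \<open>D\<close>, with a cofactor of smaller degree which still vanishes there.\<close>

lemma irreducible_above_hypersurface:
  fixes D :: "('v::linorder, 'k::field) mpoly"
  assumes D: "D \<in> homog d" "d > 0" "principal D \<in> proj_points"
    and C: "irreducible_closedin proj_space C" "proj_vanishing (principal D) \<subset> C"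
  shows "C = proj_points"
proof -
  obtain J where J: "homog_ideal J" "C = proj_vanishing J"
    using C(1) unfolding irreducible_closedin_def closedin_proj_space by blast
  have Cp: "C \<subseteq> proj_points" unfolding J by (auto simp: proj_vanishing_def)
  have zero: "q = 0" if "q \<in> homog n" "\<And>P. P \<in> C \<Longrightarrow> q \<in> P" for q n
    using that
  proof (induction n arbitrary: q rule: less_induct)
    case (less n)
    show ?case
    proof (rule ccontr)
      assume q0: "q \<noteq> 0"
      have "principal D \<in> C" using D(3) C(2) by (auto simp: proj_vanishing_def)
      then have "D dvd q" using less.prems(2) by (auto simp: principal_def)
      then obtain q1 where q1: "q = D * q1" by (elim dvdE)
      have "q = hcomp n q" using hcomp_of_homog[OF less.prems(1)] by simp
      then have q2: "q = (if d \<le> n then D * hcomp (n - d) q1 else 0)"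
        unfolding q1 hcomp_mult_homog[OF D(1)] .
      then have dn: "d \<le> n" using q0 by (auto split: if_splits)
      define q' where "q' = hcomp (n - d) q1"
      have q': "q = D * q'" "q' \<in> homog (n - d)" using q2 dn hcomp_homog by (auto simp: q'_def)
      let ?F = "C \<inter> proj_vanishing (principal D)" and ?G = "C \<inter> proj_vanishing (principal q')"
      have cl: "closedin proj_space C" using C(1) by (simp add: irreducible_closedin_def)
      have "closedin proj_space (proj_vanishing (principal D))"
        "closedin proj_space (proj_vanishing (principal q'))"
        unfolding closedin_proj_space using homog_ideal_principal D(1) q'(2) by blast+
      then have FG: "closedin proj_space ?F" "closedin proj_space ?G" using cl by (simp_all add: closedin_Int)
      have CU: "C = ?F \<union> ?G"
      proof -
        have "P \<in> ?F \<union> ?G" if P: "P \<in> C" for P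
        proof -
          have PP: "P \<in> proj_points" using P Cp by blast
          have "D * q' \<in> P" using less.prems(2)[OF P] q'(1) by simp
          then have "D \<in> P \<or> q' \<in> P" using proj_pointsD(4)[OF PP] by blast
          moreover have "principal x \<subseteq> P" if "x \<in> P" for x
            using is_idealD(3)[OF proj_pointsD(2)[OF PP] that] by (auto simp: principal_def mult.commute elim!: dvdE)
          ultimately show ?thesis using P PP by (auto simp: proj_vanishing_def)
        qed
        then show ?thesis by blast
      qed
      have irr: "\<forall>F G. closedin proj_space F \<and> closedin proj_space G \<and> C = F \<union> G \<longrightarrow> C = F \<or> C = G"
        using C(1) unfolding irreducible_closedin_def by (elim conjE)
      have "C = ?F \<or> C = ?G"
        by (rule mp[OF irr[THEN spec, THEN spec, of ?F ?G] conjI[OF FG(1) conjI[OF FG(2) CU]]])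
      moreover have "\<not> C \<subseteq> proj_vanishing (principal D)" using C(2) by (simp add: less_le_not_le)
      then have "C \<noteq> ?F" by (metis inf_le2)
      ultimately have CG: "C = ?G" by simp
      have "q' \<in> P" if "P \<in> C" for P
      proof -
        have "P \<in> proj_vanishing (principal q')" using that by (subst (asm) CG) (rule IntD2)
        then have "principal q' \<subseteq> P" by (simp add: proj_vanishing_def)
        then show ?thesis by (rule subsetD) (simp add: principal_def)
      qed
      then have "q' = 0" using less.IH[of "n - d" q'] D(2) dn q'(2) by simp
      then show False using q0 q'(1) by simp
    qed
  qed
  have "J \<subseteq> {0}"
  proof (rule ideal_eqI_hcomp[OF J(1)])
    fix f n assume "f \<in> J" "f \<in> homog n"
    then show "f = 0" using zero[of f n] J(2) by (auto simp: proj_vanishing_def)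
  qed
  then have "J = {0}" using is_idealD(1) J(1) by (auto simp: homog_ideal_def)
  then show ?thesis using J(2) proj_vanishing_zero by simp
qed

lemma codim_hypersurface_le:
  fixes D :: "('v::linorder, 'k::field) mpoly"
  assumes D: "D \<in> homog d" "d > 0" "principal D \<in> proj_points"
  shows "codim_irreducible proj_space (proj_vanishing (principal D)) \<le> 1"
  unfolding codim_irreducible_def
proof (rule SUP_least)
  fix n assume "n \<in> {n. \<exists>C :: nat \<Rightarrow> ('v, 'k) mpoly set set. C 0 = proj_vanishing (principal D) \<and>
    (\<forall>i\<le>n. irreducible_closedin proj_space (C i)) \<and> (\<forall>i<n. C i \<subset> C (Suc i))}"
  then obtain C :: "nat \<Rightarrow> ('v, 'k) mpoly set set" where C: "C 0 = proj_vanishing (principal D)"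
    "\<forall>i\<le>n. irreducible_closedin proj_space (C i)" "\<forall>i<n. C i \<subset> C (Suc i)" by auto
  have "n \<le> 1"
  proof (rule ccontr)
    assume "\<not> n \<le> 1"
    then have n: "1 \<le> n" "2 \<le> n" "0 < n" "1 < n" by auto
    have "C 1 = proj_points"
      using irreducible_above_hypersurface[OF D, of "C 1"] C(1) C(2)[rule_format, OF n(1)] C(3)[rule_format, OF n(3)] by simp
    moreover have "C 1 \<subset> C 2" using C(3)[rule_format, OF n(4)] by (simp add: numeral_2_eq_2)
    moreover have "C 2 \<subseteq> proj_points"
      using C(2)[rule_format, OF n(2)] unfolding irreducible_closedin_def closedin_proj_space
      by (auto simp: proj_vanishing_def)
    ultimately show False by (simp add: less_le_not_le)
  qed
  then show "enat n \<le> 1" by (simp add: one_enat_def)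
qed

text \<open>The hypersurface of \<open>D\<close> lies in the closed set and has codimension at most
  1. Conversely \<open>f\<close> keeps the generic point \<open>{0}\<close> out, so every
  irreducible subset extends properly to the whole space.\<close>

lemma codim_eq_one:
  fixes D :: "('v::linorder, 'k::field) mpoly"
  assumes D: "D \<in> homog d" "d > 0" "principal D \<in> proj_points"
    and K: "K \<subseteq> principal D" "f \<in> K" "f \<noteq> 0"
  shows "codim_closed proj_space (proj_vanishing K) = 1"
proof (rule antisym)
  have "proj_vanishing (principal D) \<subseteq> proj_vanishing K" using K(1) by (auto simp: proj_vanishing_def)
  then have "proj_vanishing (principal D) \<in> {Y. irreducible_closedin proj_space Y \<and> Y \<subseteq> proj_vanishing K}"
    using irreducible_proj_vanishing[OF D(3)] by simp
  then have "codim_closed proj_space (proj_vanishing K) \<le> codim_irreducible proj_space (proj_vanishing (principal D))"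
    unfolding codim_closed_def by (rule INF_lower)
  also have "\<dots> \<le> 1" by (rule codim_hypersurface_le[OF D])
  finally show "codim_closed proj_space (proj_vanishing K) \<le> 1" .
  show "1 \<le> codim_closed proj_space (proj_vanishing K)"
    unfolding codim_closed_def
  proof (rule INF_greatest)
    fix Y assume "Y \<in> {Y. irreducible_closedin proj_space Y \<and> Y \<subseteq> proj_vanishing K}"
    then have Y: "irreducible_closedin proj_space Y" "Y \<subseteq> proj_vanishing K" by auto
    have 0: "{0} \<in> (proj_points :: ('v, 'k) mpoly set set)" by (rule zero_in_proj_points)
    have irr: "irreducible_closedin proj_space (proj_points :: ('v, 'k) mpoly set set)"
      using irreducible_proj_vanishing[OF 0] by (simp add: proj_vanishing_zero)
    have "{0} \<notin> proj_vanishing K" using K(2,3) by (auto simp: proj_vanishing_def)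
    then have "Y \<subset> proj_points" using Y(2) 0 by (auto simp: proj_vanishing_def)
    then have "1 \<in> {n. \<exists>C :: nat \<Rightarrow> ('v, 'k) mpoly set set. C 0 = Y \<and>
      (\<forall>i\<le>n. irreducible_closedin proj_space (C i)) \<and> (\<forall>i<n. C i \<subset> C (Suc i))}"
      using Y(1) irr by (intro CollectI exI[of _ "\<lambda>i. if i = 0 then Y else proj_points"]) auto
    then have "enat 1 \<le> codim_irreducible proj_space Y" unfolding codim_irreducible_def by (rule SUP_upper)
    then show "1 \<le> codim_irreducible proj_space Y" by (simp add: one_enat_def)
  qed
qed

section \<open>The general algebra\<close>

text \<open>The substitution \<open>\<theta>\<close> sends \<open>Var 0\<close> to
  \<open>Var 0 - D\<close> and fixes the other variables. It kills \<open>D\<close>, because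
  \<open>p 0 = 1\<close> makes the coefficient of \<open>Var 0\<close> in \<open>D\<close> equal to
  1, and it is the identity modulo \<open>D\<close>. So \<open>D\<close> generates the kernel of a
  homomorphism into a domain.\<close>

lemma principal_conic_in_proj_points:
  assumes "p 0 = (1::'k::field)"
  shows "principal (conic_at p) \<in> proj_points"
proof -
  let ?D = "conic_at p"
  define c where "c t = eval_mpoly p (conic_monom t)" for t
  have c0: "c 0 = 1"
  proof -
    interpret E: comm_ring_hom "eval_mpoly p :: (3, 'k) mpoly \<Rightarrow> 'k" by (rule comm_ring_hom_eval)
    show ?thesis using assms by (simp add: c_def conic_monom_def E.hom_mult eval_Var)
  qed
  have D: "?D = (\<Sum>t\<in>UNIV. Const (c t) * Var t)" by (simp add: conic_at_def c_def)
  have Dh: "?D \<in> homog 1" unfolding D by (intro homog_sum homog_scale homog_Var)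
  define \<theta> where "\<theta> t = Var t - (if t = 0 then ?D else 0)" for t :: 6
  interpret C: comm_ring_hom "Const :: 'k \<Rightarrow> (6, 'k) mpoly" by (rule comm_ring_hom_Const)
  interpret S: comm_ring_hom "subst Const \<theta> :: (6, 'k) mpoly \<Rightarrow> (6, 'k) mpoly" by (rule C.comm_ring_hom_subst)
  let ?s = "subst Const \<theta> :: (6, 'k) mpoly \<Rightarrow> (6, 'k) mpoly"
  have sD: "?s ?D = 0"
  proof -
    have "?s ?D = (\<Sum>t\<in>UNIV. Const (c t) * \<theta> t)"
      by (subst D) (simp add: S.hom_sum S.hom_mult C.subst_Const C.subst_Var)
    also have "\<dots> = (\<Sum>t\<in>UNIV. Const (c t) * Var t) - (\<Sum>t\<in>UNIV. if t = 0 then Const (c t) * ?D else 0)"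
      unfolding sum_subtractf[symmetric] by (intro sum.cong) (auto simp: \<theta>_def right_diff_distrib)
    also have "\<dots> = 0" using D by (simp add: c0)
    finally show ?thesis .
  qed
  have cong: "?D dvd f - ?s f" for f
  proof (induction f rule: mpoly_induct)
    case (Const c)
    then show ?case by (simp add: C.subst_Const)
  next
    case (Var t)
    then show ?case by (simp add: C.subst_Var \<theta>_def)
  next
    case (add f g)
    have "f + g - ?s (f + g) = (f - ?s f) + (g - ?s g)" by (simp add: S.hom_add)
    then show ?case using add by (metis dvd_add)
  next
    case (mult f g)
    have "f * g - ?s (f * g) = (f - ?s f) * g + ?s f * (g - ?s g)" by (simp add: S.hom_mult algebra_simps)
    then show ?case using mult by (metis dvd_add dvd_mult dvd_mult2)
  qed
  have ker: "?D dvd f \<longleftrightarrow> ?s f = 0" for f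
  proof
    assume "?D dvd f"
    then show "?s f = 0" by (auto simp: S.hom_mult sD elim!: dvdE)
  next
    assume "?s f = 0"
    then show "?D dvd f" using cong[of f] by simp
  qed
  have "prime_ideal (principal ?D)"
    unfolding prime_ideal_def
  proof (intro conjI allI impI)
    show "1 \<notin> principal ?D" by (simp add: principal_def ker)
    fix a b :: "(6, 'k) mpoly"
    assume "a * b \<in> principal ?D"
    then show "a \<in> principal ?D \<or> b \<in> principal ?D" by (simp add: principal_def ker S.hom_mult)
  qed (rule is_ideal_principal)
  moreover have "Var 1 \<notin> principal ?D"
    using Var_neq_0[of "1::6"] by (simp add: principal_def ker C.subst_Var \<theta>_def)
  ultimately show ?thesis using homog_ideal_principal[OF Dh] by (auto simp: proj_points_def)
qed

definition sq0 :: "3 \<Rightarrow>\<^sub>0 nat" where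
  "sq0 = Poly_Mapping.single 0 1 + Poly_Mapping.single 0 1"

lemma conic_monom_0: "conic_monom 0 = Poly_Mapping.single sq0 1"
  by (simp add: conic_monom_def Var_def mult_single sq0_def)

lemma mdeg_sq0: "mdeg sq0 = 2"
  by (simp add: sq0_def mdeg_add mdeg_single)

lemma act_conic_0: "act (conic_monom 0 * f) \<phi> = mon_shift sq0 (act f \<phi>)"
  by (simp add: conic_monom_0 act_mult act_single fscale_def)

text \<open>Only the lower half of the degrees is listed, where the target \<open>j + 2\<close> is
  at most \<open>e - j\<close>; \<open>conic_surj\<close> supplies the others.\<close>

definition conic_lefschetz :: "nat \<Rightarrow> (3, 'k::field) mpoly set \<Rightarrow> bool" where
  "conic_lefschetz e I \<longleftrightarrow> (\<forall>j f. 2 * j + 2 \<le> e \<longrightarrow> f \<in> homog j \<longrightarrow> conic_monom 0 * f \<in> I \<longrightarrow> f \<in> I)"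

lemma dim_mon_shift_le:
  fixes \<phi> :: "('v::finite \<Rightarrow>\<^sub>0 nat) \<Rightarrow> 'k::field"
  shows "hd_fun (mon_shift m \<phi>) j \<le> hd_fun \<phi> j"
  unfolding inv_sys_mon_shift by (rule fs_fs.dim_image_le_fin_dim[OF linear_mon_shift fin_dim_inv_sys])

context gorenstein_ideal3 begin

text \<open>The shifted functional has as inverse system the image under the square of
  \<open>Var 0\<close>, so injectivity is an equality of dimensions, and lower bounds on dimensions
  can be expressed by minors.\<close>

lemma conic_lefschetz_iff:
  assumes \<phi>: "dual_coords e I \<phi>"
  shows "conic_lefschetz e I \<longleftrightarrow> (\<forall>j. 2 * j + 2 \<le> e \<longrightarrow> hd_fun \<phi> j \<le> hd_fun (mon_shift sq0 \<phi>) j)"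
proof
  assume L: "conic_lefschetz e I"
  show "\<forall>j. 2 * j + 2 \<le> e \<longrightarrow> hd_fun \<phi> j \<le> hd_fun (mon_shift sq0 \<phi>) j"
  proof (intro allI impI)
    fix j assume j: "2 * j + 2 \<le> e"
    have "fs.dim (mon_shift sq0 ` inv_sys \<phi> j) = fs.dim (inv_sys \<phi> j)"
    proof (rule fs_fs.dim_image_eq_fin_dim[OF linear_mon_shift fin_dim_inv_sys subspace_inv_sys])
      fix \<theta> assume "\<theta> \<in> inv_sys \<phi> j" and 0: "mon_shift sq0 \<theta> = 0"
      then obtain f where f: "f \<in> homog j" "\<theta> = act f \<phi>" by (auto simp: inv_sys_def)
      have "act (conic_monom 0 * f) \<phi> = 0" using 0 f(2) by (simp add: act_conic_0)
      then have "conic_monom 0 * f \<in> I"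
        using dual_annihilator[OF \<phi> homog_mult[OF homog_conic_monom f(1)]] by simp
      then have "f \<in> I" using L j f(1) unfolding conic_lefschetz_def by simp
      then show "\<theta> = 0" using dual_annihilator[OF \<phi> f(1)] f(2) by simp
    qed
    then show "hd_fun \<phi> j \<le> hd_fun (mon_shift sq0 \<phi>) j" by (simp add: inv_sys_mon_shift)
  qed
next
  assume H: "\<forall>j. 2 * j + 2 \<le> e \<longrightarrow> hd_fun \<phi> j \<le> hd_fun (mon_shift sq0 \<phi>) j"
  show "conic_lefschetz e I"
    unfolding conic_lefschetz_def
  proof (intro allI impI)
    fix j f assume j: "2 * j + 2 \<le> e" and f: "f \<in> homog j" "conic_monom 0 * f \<in> I"
    have "fs.dim (mon_shift sq0 ` inv_sys \<phi> j) = fs.dim (inv_sys \<phi> j)"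
      using H[rule_format, OF j] dim_mon_shift_le[of sq0 \<phi> j] by (simp add: inv_sys_mon_shift)
    moreover have "act f \<phi> \<in> inv_sys \<phi> j" using f(1) by (auto simp: inv_sys_def)
    moreover have "mon_shift sq0 (act f \<phi>) = 0"
      using dual_annihilator[OF \<phi> homog_mult[OF homog_conic_monom f(1)]] f(2) by (simp add: act_conic_0)
    ultimately have "act f \<phi> = 0"
      by (rule fs.dim_image_eq_imp_inj[OF linear_mon_shift fin_dim_inv_sys subspace_inv_sys])
    then show "f \<in> I" using dual_annihilator[OF \<phi> f(1)] by simp
  qed
qed

text \<open>The image of the square of \<open>Var 0\<close> is the inverse system of the shifted
  functional, which is symmetric about \<open>e - 2\<close>. So its dimension in degree
  \<open>j\<close> can be read in degree \<open>e - 2 - j\<close>, where injectivity holds, and the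
  symmetry of \<open>\<phi>\<close> identifies it with that of the target.\<close>

lemma conic_surj:
  assumes \<phi>: "dual_coords e I \<phi>" and L: "conic_lefschetz e I"
    and j: "j + 2 \<le> e" "e \<le> 2 * j + 2" and f: "f \<in> homog (j + 2)"
  shows "\<exists>g\<in>homog j. f - conic_monom 0 * g \<in> I"
proof -
  have sup: "supported e \<phi>" by (rule dual_supported[OF \<phi>])
  have sup2: "supported (e - 2) (mon_shift sq0 \<phi>)"
  proof (rule supported_mon_shift)
    have "mdeg sq0 + (e - 2) = e" using j by (simp add: mdeg_sq0)
    then show "supported (mdeg sq0 + (e - 2)) \<phi>" using sup by simp
  qed
  have jj: "2 * (e - 2 - j) + 2 \<le> e" using j by simp
  have "hd_fun (mon_shift sq0 \<phi>) j = hd_fun (mon_shift sq0 \<phi>) (e - 2 - j)"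
    using hd_fun_symmetric[OF sup2, of j] j by simp
  also have "\<dots> = hd_fun \<phi> (e - 2 - j)"
    using conic_lefschetz_iff[OF \<phi>] L jj dim_mon_shift_le[of sq0 \<phi> "e - 2 - j"] by (simp add: le_antisym)
  also have "\<dots> = hd_fun \<phi> (j + 2)"
    using hd_fun_symmetric[OF sup, of "j + 2"] j by (simp add: diff_diff_left add.commute)
  finally have dims: "hd_fun (mon_shift sq0 \<phi>) j = hd_fun \<phi> (j + 2)" .
  have "inv_sys (mon_shift sq0 \<phi>) j \<subseteq> inv_sys \<phi> (j + 2)"
    unfolding inv_sys_mon_shift using mon_shift_inv_sys[of _ \<phi> j sq0] by (auto simp: mdeg_sq0)
  then have "inv_sys \<phi> (j + 2) = inv_sys (mon_shift sq0 \<phi>) j"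
    using dims by (intro fs.subspace_eq_of_dim_le subspace_inv_sys fin_dim_inv_sys) auto
  moreover have "act f \<phi> \<in> inv_sys \<phi> (j + 2)" unfolding inv_sys_def by (rule imageI[OF f])
  ultimately have "act f \<phi> \<in> mon_shift sq0 ` inv_sys \<phi> j" by (simp only: inv_sys_mon_shift)
  then obtain g where g: "g \<in> homog j" "act f \<phi> = mon_shift sq0 (act g \<phi>)" by (auto simp: inv_sys_def)
  have "act (f - conic_monom 0 * g) \<phi> = 0" by (simp add: act_diff act_conic_0 g(2))
  moreover have "conic_monom 0 * g \<in> homog (j + 2)"
    using homog_mult[OF homog_conic_monom g(1), of 0] by (simp add: add.commute)
  then have "f - conic_monom 0 * g \<in> homog (j + 2)" by (rule homog_diff[OF f])
  ultimately have "f - conic_monom 0 * g \<in> I" using dual_annihilator[OF \<phi>] by simp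
  then show ?thesis by (rule bexI[OF _ g(1)])
qed

text \<open>The product of one suitable minor per degree lies in every ideal of the intersection and
  does not vanish at \<open>base_conic\<close>.\<close>

lemma conic_ideal_nonzero:
  assumes L: "conic_lefschetz e I"
  shows "\<exists>F\<in>conic_ideal e I. F \<noteq> 0"
proof -
  obtain \<phi> where \<phi>: "dual_coords e I \<phi>" using exists_dual by (elim exE)
  have "\<exists>\<mu>. \<mu> \<in> maximal_minors (conic_matrix I j) \<and> eval_mpoly base_conic \<mu> \<noteq> 0" if j: "j + 2 \<le> e" for j
  proof (cases "2 * j + 2 \<le> e")
    case True
    then have "\<exists>\<mu>\<in>maximal_minors (conic_matrix I j). eval_mpoly base_conic \<mu> \<noteq> 0"
      using L unfolding conic_lefschetz_def by (intro minor_nonzero_of_inj) auto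
    then show ?thesis by (simp only: Bex_def)
  next
    case False
    have "\<exists>\<mu>\<in>maximal_minors (conic_matrix I j). eval_mpoly base_conic \<mu> \<noteq> 0"
      by (rule minor_nonzero_of_surj[OF conic_surj[OF \<phi> L j]]) (use False in simp)
    then show ?thesis by (simp only: Bex_def)
  qed
  then obtain \<mu> where \<mu>: "\<And>j. j + 2 \<le> e \<Longrightarrow> \<mu> j \<in> maximal_minors (conic_matrix I j)"
    "\<And>j. j + 2 \<le> e \<Longrightarrow> eval_mpoly base_conic (\<mu> j) \<noteq> 0" by metis
  let ?A = "{j. j + 2 \<le> e}"
  have fin: "finite ?A" by (rule finite_subset[of _ "{..e}"]) auto
  let ?F = "\<Prod>j\<in>?A. \<mu> j"
  interpret E: comm_ring_hom "eval_mpoly base_conic :: (6, 'k) mpoly \<Rightarrow> 'k" by (rule comm_ring_hom_eval)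
  have "eval_mpoly base_conic ?F = (\<Prod>j\<in>?A. eval_mpoly base_conic (\<mu> j))" by (rule E.hom_prod)
  also have "\<dots> \<noteq> 0" using \<mu>(2) fin by (simp add: prod_zero_iff)
  finally have "?F \<noteq> 0" by auto
  moreover have "?F \<in> conic_ideal_at I j" if j: "j \<in> ?A" for j
  proof -
    have id: "is_ideal (conic_ideal_at I j)"
      unfolding is_ideal_def conic_ideal_at_def ideal_generated_def by (rule module.subspace_span[OF module_times])
    have "\<mu> j \<in> conic_ideal_at I j"
      unfolding conic_ideal_at_def ideal_generated_def using \<mu>(1) j by (intro module.span_base[OF module_times]) simp
    then have "(\<Prod>i\<in>?A - {j}. \<mu> i) * \<mu> j \<in> conic_ideal_at I j" by (rule is_idealD(3)[OF id])
    then show ?thesis using prod.remove[OF fin j, of \<mu>] by (simp add: mult.commute)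
  qed
  then have "?F \<in> conic_ideal e I" unfolding conic_ideal_def by blast
  ultimately show ?thesis by blast
qed

lemma conic_ideal_subset:
  assumes w: "w \<in> homog j" "w \<notin> I" "\<And>v. Var v * w - Const (p v) * (Var 0 * w) \<in> I"
    and le: "hilbert_fun I j \<le> hilbert_fun I (j + 2)" and j: "j + 2 \<le> e"
  shows "conic_ideal e I \<subseteq> principal (conic_at p)"
proof -
  have "maximal_minors (conic_matrix I j) \<subseteq> principal (conic_at p)"
    using conic_at_dvd_minors[OF w le] by (auto simp: principal_def)
  then have "conic_ideal_at I j \<subseteq> principal (conic_at p)"
    unfolding conic_ideal_at_def ideal_generated_def
    by (rule module.span_minimal[OF module_times]) (use is_ideal_principal in \<open>simp add: is_ideal_def\<close>)
  moreover have "conic_ideal e I \<subseteq> conic_ideal_at I j" unfolding conic_ideal_def using j by blast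
  ultimately show ?thesis by blast
qed

lemma codim_conics:
  assumes L: "conic_lefschetz e I"
    and w: "w \<in> homog j" "w \<notin> I" "\<And>v. Var v * w - Const (p v) * (Var 0 * w) \<in> I" and p: "p 0 = 1"
    and le: "hilbert_fun I j \<le> hilbert_fun I (j + 2)" and j: "j + 2 \<le> e"
  shows "codim_closed proj_space (non_lefschetz_conics e I) = 1"
proof -
  have Dh: "conic_at p \<in> homog 1" unfolding conic_at_def by (intro homog_sum homog_scale homog_Var)
  obtain F where F: "F \<in> conic_ideal e I" "F \<noteq> 0" using conic_ideal_nonzero[OF L] by blast
  show ?thesis unfolding non_lefschetz_conics_def
    by (rule codim_eq_one[OF Dh _ principal_conic_in_proj_points[where p = p, OF p] conic_ideal_subset[OF w le j] F]) simp
qed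

end

section \<open>Openness of the Lefschetz condition\<close>

lemma homog_det:
  assumes "\<And>a b. a < r \<Longrightarrow> b < r \<Longrightarrow> M a b \<in> homog 1"
  shows "det (mat r r (\<lambda>(a, b). M a b)) \<in> (homog r :: ('v, 'k::comm_ring_1) mpoly set)"
proof -
  have sg: "signof p \<in> (homog 0 :: ('v, 'k) mpoly set)" for p :: "nat \<Rightarrow> nat"
    using homog_Const[of 1] homog_Const[of "- 1"] by (auto simp: sign_def Const_uminus)
  have "signof p * (\<Prod>i = 0..<r. mat r r (\<lambda>(a, b). M a b) $$ (i, p i)) \<in> homog r" if "p permutes {0..<r}" for p
  proof -
    have "(\<Prod>i = 0..<r. mat r r (\<lambda>(a, b). M a b) $$ (i, p i)) \<in> homog (\<Sum>i = 0..<r. 1)"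
    proof (rule homog_prod)
      fix i assume i: "i \<in> {0..<r}"
      then have "p i < r" using permutes_in_image[OF that, of i] by simp
      then show "mat r r (\<lambda>(a, b). M a b) $$ (i, p i) \<in> homog 1" using i assms by simp
    qed
    then show ?thesis using homog_mult[OF sg] by fastforce
  qed
  then show ?thesis by (simp add: det_def) (intro homog_sum, simp)
qed

text \<open>A catalecticant minor of the shifted functional as a polynomial in the dual coordinates;
  its variables are therefore indexed by the exponents of monomials of \<open>R\<close>.\<close>

definition generic_minor ::
    "nat \<Rightarrow> (nat \<Rightarrow> 3 \<Rightarrow>\<^sub>0 nat) \<Rightarrow> (nat \<Rightarrow> 3 \<Rightarrow>\<^sub>0 nat) \<Rightarrow> ((3 \<Rightarrow>\<^sub>0 nat), 'k::field) mpoly" where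
  "generic_minor r m n = det (mat r r (\<lambda>(a, b). Var (sq0 + (m a + n b))))"

lemma eval_generic_minor:
  "eval_mpoly \<phi> (generic_minor r m n) = det (mat r r (\<lambda>(a, b). mon_shift sq0 \<phi> (m a + n b)))"
proof -
  interpret E: comm_ring_hom "eval_mpoly \<phi> :: (_, 'a) mpoly \<Rightarrow> 'a" by (rule comm_ring_hom_eval)
  have "map_mat (eval_mpoly \<phi>) (mat r r (\<lambda>(a, b). Var (sq0 + (m a + n b)))) =
      mat r r (\<lambda>(a, b). mon_shift sq0 \<phi> (m a + n b))"
    by (intro eq_matI) (auto simp: eval_Var mon_shift_def)
  then show ?thesis
    using E.hom_det[of "mat r r (\<lambda>(a, b). Var (sq0 + (m a + n b)))"] by (simp add: generic_minor_def)
qed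

lemma gorenstein_ideal3_family:
  assumes "I \<in> gorenstein_family h" "h e > 0" "\<forall>d>e. h d = 0"
  shows "gorenstein_ideal3 I e"
  using assms by unfold_locales (auto simp: gorenstein_family_def hilbert_fun_def)

text \<open>\<open>B\<close> consists of the products of one minor of size \<open>h j\<close> for
  each tested degree \<open>j\<close>. Some product is nonzero at \<open>\<phi>\<close> exactly when
  all the ranks reach \<open>h j\<close> simultaneously.\<close>

lemma zariski_open_conic_lefschetz:
  assumes h: "h e > 0" "\<forall>d>e. h d = 0"
  shows "zariski_open_in_family e h {I \<in> gorenstein_family h. conic_lefschetz e (I :: (3, 'k::field) mpoly set)}"
proof -
  let ?J = "{j. 2 * j + 2 \<le> e}"
  let ?ok = "\<lambda>m :: nat \<Rightarrow> nat \<Rightarrow> 3 \<Rightarrow>\<^sub>0 nat. \<forall>j\<in>?J. \<forall>a<h j. mdeg (m j a) = j"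
  define B :: "((3 \<Rightarrow>\<^sub>0 nat), 'k) mpoly set"
    where "B = {\<Prod>j\<in>?J. generic_minor (h j) (m j) (n j) | m n. ?ok m}"
  have fin: "finite ?J" by (rule finite_subset[of _ "{..e}"]) auto
  have "(\<Prod>j\<in>?J. generic_minor (h j) (m j) (n j)) \<in> (homog (\<Sum>j\<in>?J. h j) :: ((3 \<Rightarrow>\<^sub>0 nat), 'k) mpoly set)" for m n
    unfolding generic_minor_def by (intro homog_prod homog_det homog_Var)
  then have Bh: "B \<subseteq> (\<Union>d. homog d)" unfolding B_def by blast
  have iff: "conic_lefschetz e I \<longleftrightarrow> (\<exists>p\<in>B. eval_mpoly \<phi> p \<noteq> 0)"
    if I: "I \<in> gorenstein_family h" and \<phi>: "dual_coords e I \<phi>" for I \<phi>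
  proof -
    interpret gorenstein_ideal3 I e by (rule gorenstein_ideal3_family[OF I h])
    interpret E: comm_ring_hom "eval_mpoly \<phi> :: ((3 \<Rightarrow>\<^sub>0 nat), 'k) mpoly \<Rightarrow> 'k" by (rule comm_ring_hom_eval)
    have hd: "hd_fun \<phi> j = h j" for j
      using quot_basis_homog(3)[OF \<phi>, of j] I by (simp add: gorenstein_family_def)
    have ev: "eval_mpoly \<phi> (\<Prod>j\<in>?J. generic_minor (h j) (m j) (n j)) \<noteq> 0 \<longleftrightarrow>
        (\<forall>j\<in>?J. det (mat (h j) (h j) (\<lambda>(a, b). mon_shift sq0 \<phi> (m j a + n j b))) \<noteq> 0)" for m n
      unfolding E.hom_prod eval_generic_minor prod_zero_iff[OF fin] by auto
    have "conic_lefschetz e I \<longleftrightarrow> (\<forall>j\<in>?J. \<exists>m n. (\<forall>a<h j. mdeg (m a) = j) \<and>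
        det (mat (h j) (h j) (\<lambda>(a, b). mon_shift sq0 \<phi> (m a + n b))) \<noteq> 0)"
      unfolding conic_lefschetz_iff[OF \<phi>] hd le_hd_fun_iff_minor by simp
    also have "\<dots> \<longleftrightarrow> (\<exists>m n. \<forall>j\<in>?J. (\<forall>a<h j. mdeg (m j a) = j) \<and>
        det (mat (h j) (h j) (\<lambda>(a, b). mon_shift sq0 \<phi> (m j a + n j b))) \<noteq> 0)"
      by (simp only: bchoice_iff)
    also have "\<dots> \<longleftrightarrow> (\<exists>m n. ?ok m \<and> eval_mpoly \<phi> (\<Prod>j\<in>?J. generic_minor (h j) (m j) (n j)) \<noteq> 0)"
      unfolding ev by (simp only: ball_conj_distrib)
    also have "\<dots> \<longleftrightarrow> (\<exists>p\<in>B. eval_mpoly \<phi> p \<noteq> 0)" unfolding B_def by auto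
    finally show ?thesis .
  qed
  show ?thesis
    unfolding zariski_open_in_family_def using Bh iff by (intro conjI exI[of _ B]) auto
qed

lemma dual_coords_ann:
  fixes \<phi> :: "('v \<Rightarrow>\<^sub>0 nat) \<Rightarrow> 'k::field"
  assumes "supported e \<phi>"
  shows "dual_coords e (ann \<phi>) \<phi>"
  unfolding dual_coords_def
proof (intro conjI allI impI ballI)
  show "mdeg m \<noteq> e \<Longrightarrow> \<phi> m = 0" for m using assms by (simp add: supported_def)
  fix f :: "('v, 'k) mpoly" assume f: "f \<in> homog e"
  have "act f \<phi> n = 0" if "n \<noteq> 0" for n
  proof -
    have "mdeg n \<noteq> 0" using mdeg_eq_0 that by auto
    then have "\<phi> (m + n) = 0" if "m \<in> Poly_Mapping.keys f" for m
      using f that assms by (auto simp: homog_def supported_def mdeg_add)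
    then show ?thesis by (simp add: act_apply)
  qed
  then have "act f \<phi> = 0 \<longleftrightarrow> act f \<phi> 0 = 0" by (auto simp: fun_eq_iff) metis
  then show "f \<in> ann \<phi> \<longleftrightarrow> (\<Sum>m\<in>Poly_Mapping.keys f. Poly_Mapping.lookup f m * \<phi> m) = 0"
    by (simp add: ann_def act_at_0)
qed

section \<open>Existence of a Lefschetz algebra, and the flat step\<close>

lemma hilbert_fun_eq_sum_g_vector: "int (h d) = (\<Sum>j\<le>d. g_vector h j)"
  by (induction d) (auto simp: g_vector_def)

text \<open>The diagonal of degree \<open>n\<close> receives the pairs \<open>(a, n - a)\<close>
  with \<open>a < g n\<close>. Where \<open>g n = n + 1\<close> this is the full diagonal, and from
  \<open>s - 1\<close> on \<open>g\<close> does not increase; together this makes the set closed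
  under lowering coordinates.\<close>

lemma exists_points_with_g_vector:
  assumes g0: "g_vector h 0 = 1"
    and shape: "\<And>i. i < s \<Longrightarrow> i \<le> k \<Longrightarrow> g_vector h i = int i + 1"
      "\<And>i. s \<le> Suc i \<Longrightarrow> Suc i \<le> k \<Longrightarrow> g_vector h (Suc i) \<le> g_vector h i"
      "\<And>i. i \<le> k \<Longrightarrow> 0 \<le> g_vector h i"
    and s: "s > 0"
  shows "\<exists>\<Gamma>. lower_set \<Gamma> \<and> (\<forall>d\<le>k. card (lower_set.upto \<Gamma> d) = h d)"
proof -
  define g where "g = g_vector h"
  have mono: "g j \<le> g i" if "s \<le> Suc i" "i \<le> j" "j \<le> k" for i j
    using that(2,3)
  proof (induction rule: dec_induct)
    case (step n)
    then show ?case using shape(2)[of n] that(1) by (simp add: g_def)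
  qed simp
  \<comment> \<open>The diagonal of degree \<open>i\<close> has only \<open>i + 1\<close>
    places.\<close>
  have le: "g i \<le> int i + 1" if "i \<le> k" for i
  proof (cases "i < s")
    case False
    then have "g i \<le> g (s - 1)" using s that by (intro mono) auto
    then show ?thesis using shape(1)[of "s - 1"] s False that by (simp add: g_def)
  qed (use shape(1) that in \<open>simp add: g_def\<close>)
  define \<Gamma> where "\<Gamma> = {(a, b). a + b \<le> k \<and> int a < g (a + b)}"
  have ls: "lower_set \<Gamma>"
  proof
    show "finite \<Gamma>" by (rule finite_subset[of _ "{..k} \<times> {..k}"]) (auto simp: \<Gamma>_def)
    fix a b a' b' assume ab: "(a, b) \<in> \<Gamma>" "a' \<le> a" "b' \<le> b"
    then have n: "a + b \<le> k" "int a < g (a + b)" by (auto simp: \<Gamma>_def)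
    have "int a' < g (a' + b')"
    proof (cases "a' + b' < s")
      case True
      then show ?thesis using shape(1)[of "a' + b'"] n(1) ab by (simp add: g_def)
    next
      case False
      then have "g (a + b) \<le> g (a' + b')" using n(1) ab by (intro mono) auto
      then show ?thesis using n(2) ab(2) by linarith
    qed
    then show "(a', b') \<in> \<Gamma>" using n(1) ab by (auto simp: \<Gamma>_def)
  qed
  interpret lower_set \<Gamma> by (rule ls)
  have diag: "card {p \<in> \<Gamma>. fst p + snd p = j} = nat (g j)" if j: "j \<le> k" for j
  proof -
    have "{p \<in> \<Gamma>. fst p + snd p = j} = (\<lambda>a. (a, j - a)) ` {..<nat (g j)}"
      using le[OF j] j by (force simp: \<Gamma>_def image_iff)
    moreover have "inj_on (\<lambda>a. (a, j - a)) {..<nat (g j)}" by (auto intro: inj_onI)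
    ultimately show ?thesis by (simp add: card_image)
  qed
  have "int (card (upto d)) = int (h d)" if "d \<le> k" for d
    using that
  proof (induction d)
    case 0
    have "upto 0 = {p \<in> \<Gamma>. fst p + snd p = 0}" by (auto simp: upto_def)
    then show ?case using diag[of 0] g0 by (simp add: g_def g_vector_def)
  next
    case (Suc d)
    have "upto (Suc d) = upto d \<union> {p \<in> \<Gamma>. fst p + snd p = Suc d}" by (auto simp: upto_def)
    moreover have "upto d \<inter> {p \<in> \<Gamma>. fst p + snd p = Suc d} = {}" by (auto simp: upto_def)
    ultimately have "card (upto (Suc d)) = card (upto d) + nat (g (Suc d))"
      using diag[OF Suc.prems] fin finite_upto by (simp add: card_Un_disjoint)
    then show ?case using Suc shape(3)[of "Suc d"] by (simp add: g_def g_vector_def)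
  qed
  then show ?thesis using ls by (intro exI[of _ \<Gamma>]) auto
qed

text \<open>After the last index \<open>t\<close> with the peak value, \<open>g\<close> drops
  strictly. If no drop were followed by an equality, the drops would continue up to \<open>k\<close>
  and \<open>g\<close> would be of decreasing type.\<close>

lemma not_decreasing_type_flat_step:
  assumes g1: "g 0 = 1" "g 1 = 2" "1 \<le> k"
    and shape: "\<And>i. i < s \<Longrightarrow> i \<le> k \<Longrightarrow> g i = int i + 1"
      "\<And>i. s \<le> Suc i \<Longrightarrow> Suc i \<le> k \<Longrightarrow> g (Suc i) \<le> g i"
    and nd: "\<not> decreasing_type k g"
  shows "\<exists>m. Suc (Suc m) \<le> k \<and> g (Suc m) < g m \<and> g (Suc (Suc m)) = g (Suc m) \<and> s \<le> Suc m"
proof (rule ccontr)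
  assume neg: "\<not> ?thesis"
  \<comment> \<open>The last index of the growth \<open>i + 1\<close>, cut off at \<open>k\<close>
    in case the growth never stops.\<close>
  define \<sigma> where "\<sigma> = min (s - 1) k"
  have s2: "2 \<le> s"
  proof (rule ccontr)
    assume "\<not> 2 \<le> s"
    then have "g 1 \<le> g 0" using shape(2)[of 0] g1(3) by simp
    then show False using g1 by simp
  qed
  have \<sigma>1: "1 \<le> \<sigma>" "\<sigma> \<le> k" using s2 g1(3) by (auto simp: \<sigma>_def)
  have up: "g i = int i + 1" if "i \<le> \<sigma>" for i
  proof -
    have "i < s" "i \<le> k" using that s2 by (auto simp: \<sigma>_def)
    then show ?thesis by (rule shape(1))
  qed
  have stp: "g (Suc i) \<le> g i" if "\<sigma> \<le> i" "Suc i \<le> k" for i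
    using shape(2)[of i] that by (simp add: \<sigma>_def min_def split: if_splits)
  have mono: "g j \<le> g i" if "\<sigma> \<le> i" "i \<le> j" "j \<le> k" for i j
    using that(2,3)
  proof (induction rule: dec_induct)
    case (step n)
    then show ?case using stp[of n] that(1) by simp
  qed simp
  let ?T = "{i. \<sigma> \<le> i \<and> i \<le> k \<and> g i = g \<sigma>}"
  have T: "finite ?T" "\<sigma> \<in> ?T" using \<sigma>1 by (auto intro: finite_subset[of _ "{..k}"])
  define t where "t = Max ?T"
  have "t \<in> ?T" unfolding t_def using T by (intro Max_in) auto
  then have t: "\<sigma> \<le> t" "t \<le> k" "g t = g \<sigma>" by auto
  have tmax: "i \<le> t" if "i \<in> ?T" for i unfolding t_def using T(1) that by (rule Max_ge)
  have const: "g i = g \<sigma>" if "\<sigma> \<le> i" "i \<le> t" for i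
    using mono[of \<sigma> i] mono[of i t] that t by simp
  have dec: "g (Suc i) < g i" if "t \<le> i" "i < k" for i
    using that
  proof (induction rule: dec_induct)
    case base
    have "Suc t \<notin> ?T" using tmax[of "Suc t"] by auto
    then have "g (Suc t) \<noteq> g t" using t base by simp
    then show ?case using stp[of t] t(1) base by simp
  next
    case (step n)
    have "g (Suc n) < g n" using step by simp
    moreover have "s \<le> Suc n" using step(1) step(3) t(1) step.prems by (auto simp: \<sigma>_def min_def split: if_splits)
    ultimately have "g (Suc (Suc n)) \<noteq> g (Suc n)" using neg step(3) step.prems by auto
    then show ?case
      using stp[of "Suc n"] t(1) step by simp
  qed
  have "decreasing_type k g"
    unfolding decreasing_type_def
    by (rule exI[of _ \<sigma>], rule exI[of _ t]) (use \<sigma>1 t up const dec in auto)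
  then show False using nd by contradiction
qed

lemma codim_conics_of_flat_step:
  fixes I :: "(3, 'k::{alg_closed_field, field_char_0}) mpoly set"
  assumes "gorenstein_ideal3 I e"
    and L: "conic_lefschetz e I" and \<phi>: "dual_coords e I \<phi>"
    and m: "2 * Suc (Suc m) \<le> e" and d: "d \<le> m"
    and dim1: "hd_fun \<phi> (Suc m) = hd_fun \<phi> m + d"
    and dim2: "hd_fun \<phi> (Suc (Suc m)) = hd_fun \<phi> (Suc m) + d"
    and big: "hd_fun \<phi> m > (\<Sum>l\<le>m. min d (Suc l))"
  shows "codim_closed proj_space (non_lefschetz_conics e I) = 1"
proof -
  interpret gorenstein_ideal3 I e by fact
  \<comment> \<open>The bound on \<open>m\<close> is exactly what \<open>j \<le> Suc m\<close> needs
    for \<open>2 * j + 2 \<le> e\<close>. A kernel element of \<open>contract 0\<close> is also one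
    of its square, which is injective there.\<close>
  have inj: "\<theta> = 0" if j: "j \<le> Suc m" "\<theta> \<in> inv_sys \<phi> j" "contract 0 \<theta> = 0" for j \<theta>
  proof -
    have "2 * j + 2 \<le> e" using j(1) m by simp
    then have le: "hd_fun \<phi> j \<le> hd_fun (mon_shift sq0 \<phi>) j" using L unfolding conic_lefschetz_iff[OF \<phi>] by simp
    have "fs.dim (mon_shift sq0 ` inv_sys \<phi> j) = fs.dim (inv_sys \<phi> j)"
      using le dim_mon_shift_le[of sq0 \<phi> j] by (simp add: inv_sys_mon_shift)
    moreover have "mon_shift sq0 \<theta> = contract 0 (contract 0 \<theta>)"
      by (simp add: sq0_def contract_def mon_shift_shift)
    then have "mon_shift sq0 \<theta> = 0" using j(3) by (simp add: contract_def mon_shift_def fun_eq_iff)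
    ultimately show ?thesis
      using fs.dim_image_eq_imp_inj[OF linear_mon_shift fin_dim_inv_sys subspace_inv_sys, of sq0 \<phi> j \<theta>] j(2) by simp
  qed
  have "\<exists>w\<in>inv_sys \<phi> m. w \<noteq> 0 \<and>
      (\<exists>a b. contract 1 w = fscale a (contract 0 w) \<and> contract 2 w = fscale b (contract 0 w))"
    using common_eigenvector[OF co.comm_ops_axioms, of m \<phi> d] inj d dim1 dim2 big
    unfolding inv_sys_eq_op_span by blast
  then obtain \<theta> a b where \<theta>: "\<theta> \<in> inv_sys \<phi> m" "\<theta> \<noteq> 0"
    "contract 1 \<theta> = fscale a (contract 0 \<theta>)" "contract 2 \<theta> = fscale b (contract 0 \<theta>)" by blast
  from \<theta>(1) obtain w where w: "w \<in> homog m" "\<theta> = act w \<phi>" by (auto simp: inv_sys_def)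
  define p where "p v = (if v = 0 then 1 else if v = 1 then a else b)" for v :: 3
  have "w \<notin> I" using dual_annihilator[OF \<phi> w(1)] w(2) \<theta>(2) by simp
  moreover have "Var v * w - Const (p v) * (Var 0 * w) \<in> I" for v
  proof -
    have "contract v \<theta> = fscale (p v) (contract 0 \<theta>)"
      using cases_3[of v] \<theta>(3,4) by (auto simp: p_def)
    then have "act (Var v * w - Const (p v) * (Var 0 * w)) \<phi> = 0"
      by (simp add: act_diff act_mult act_Var act_Const flip: w(2))
    moreover have "Var v * w - Const (p v) * (Var 0 * w) \<in> homog (1 + m)"
      by (intro homog_diff homog_scale homog_mult homog_Var w(1))
    ultimately show ?thesis using dual_annihilator[OF \<phi>] by simp
  qed
  moreover have "p 0 = 1" by (simp add: p_def)
  moreover have "hilbert_fun I m \<le> hilbert_fun I (m + 2)"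
    using dim1 dim2 by (simp add: quot_basis_homog(3)[OF \<phi>])
  moreover have "m + 2 \<le> e" using m by simp
  ultimately show ?thesis by (intro codim_conics[OF L w(1)])
qed

text \<open>All points have first coordinate 1, so contracting twice by \<open>Var 0\<close> turns
  the functional for exponent \<open>e\<close> into the one for \<open>e - 2\<close> on the same
  points. In the tested degrees both have dimension \<open>card (upto j)\<close>, so no rank is
  lost.\<close>

lemma exists_conic_lefschetz:
  fixes \<phi> :: "(3 \<Rightarrow>\<^sub>0 nat) \<Rightarrow> 'k::field_char_0"
  assumes \<phi>: "supported e \<phi>" "\<And>d. hd_fun \<phi> d = h d" and h: "h 0 = 1" "h e > 0" "\<forall>d>e. h d = 0"
  shows "\<exists>I :: (3, 'k) mpoly set. I \<in> gorenstein_family h \<and> conic_lefschetz e I"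
proof -
  have hd: "hd_fun \<phi> = h" using \<phi>(2) by (rule ext)
  obtain s where s: "\<forall>i<s. i \<le> e div 2 \<longrightarrow> g_vector h i = int i + 1"
    "\<forall>i. s \<le> Suc i \<and> Suc i \<le> e div 2 \<longrightarrow> g_vector h (Suc i) \<le> g_vector h i"
    "\<forall>i\<le>e div 2. 0 \<le> g_vector h i" "s = 0 \<longrightarrow> g_vector h 0 = 0"
    using g_vector_shape[OF \<phi>(1)] unfolding hd by (elim exE conjE)
  have g0: "g_vector h 0 = 1" using h(1) by (simp add: g_vector_def)
  have "\<exists>\<Gamma>. lower_set \<Gamma> \<and> (\<forall>d\<le>e div 2. card (lower_set.upto \<Gamma> d) = h d)"
    by (rule exists_points_with_g_vector[OF g0, of s]) (use s g0 in auto)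
  then obtain \<Gamma> where \<Gamma>: "lower_set \<Gamma>" "\<forall>d\<le>e div 2. card (lower_set.upto \<Gamma> d) = h d" by (elim exE conjE)
  interpret lower_set \<Gamma> by (rule \<Gamma>(1))
  let ?p = "points_fun \<Gamma> e :: _ \<Rightarrow> 'k"
  have sup: "supported e ?p" by (rule supported_points_fun)
  have low: "hd_fun ?p d = h d" if "2 * d \<le> e" for d
  proof -
    have "d \<le> e div 2" using that by simp
    then show ?thesis using hd_fun_points_fun[OF that] \<Gamma>(2) by simp
  qed
  have all: "hd_fun ?p d = h d" for d
  proof (cases "d \<le> e")
    case True
    show ?thesis
    proof (cases "2 * d \<le> e")
      case False
      then have "hd_fun ?p (e - d) = h (e - d)" by (intro low) simp
      moreover have "hd_fun ?p (e - d) = hd_fun ?p d" by (rule hd_fun_symmetric[OF sup True])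
      moreover have "h (e - d) = h d" using hd_fun_symmetric[OF \<phi>(1) True] by (simp add: \<phi>(2))
      ultimately show ?thesis by simp
    qed (rule low)
  next
    case False
    then show ?thesis using inv_sys_above[OF sup, of d] h(3) by (simp add: fs.dim_zero)
  qed
  have "?p \<noteq> 0"
  proof
    assume "?p = 0"
    then have "inv_sys ?p 0 \<subseteq> {0}" by (auto simp: inv_sys_def act_zero_right)
    then have "hd_fun ?p 0 = 0" using fs.dim_eq_0_iff_fin_dim[OF fin_dim_inv_sys] by blast
    then show False using all[of 0] h(1) by simp
  qed
  then have fam: "ann ?p \<in> gorenstein_family h"
    unfolding gorenstein_family_def using artinian_gorenstein_ann[OF sup] by (simp add: hilbert_fun_ann all)
  interpret gorenstein_ideal3 "ann ?p" e by (rule gorenstein_ideal3_family[OF fam h(2,3)])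
  have "conic_lefschetz e (ann ?p)"
    unfolding conic_lefschetz_iff[OF dual_coords_ann[OF sup]]
  proof (intro allI impI)
    fix j assume j: "2 * j + 2 \<le> e"
    then obtain e' where e': "e = Suc (Suc e')" by (metis add_2_eq_Suc' le_Suc_ex plus_nat.simps(2) add.commute)
    have "mon_shift sq0 ?p = contract 0 (contract 0 ?p)" by (simp add: sq0_def contract_def mon_shift_shift)
    then have "mon_shift sq0 ?p = points_fun \<Gamma> e'" by (simp add: e' contract_points_fun)
    then have "hd_fun (mon_shift sq0 ?p) j = card (upto j)" using hd_fun_points_fun[of j e'] j e' by simp
    moreover have "hd_fun ?p j = card (upto j)" using j by (intro hd_fun_points_fun) simp
    ultimately show "hd_fun ?p j \<le> hd_fun (mon_shift sq0 ?p) j" by simp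
  qed
  then show ?thesis using fam by blast
qed

theorem proposition8p3:
  fixes h :: "nat \<Rightarrow> nat" and e :: nat
  assumes "h 0 = 1" and "h 1 = 3"
    and "h e > 0" and "\<forall>d>e. h d = 0"
    and "(gorenstein_family h :: (3, 'k::{alg_closed_field, field_char_0}) mpoly set set) \<noteq> {}"
    and "\<not> decreasing_type (e div 2) (g_vector h)"
  shows "\<exists>U :: (3, 'k) mpoly set set. zariski_open_in_family e h U \<and> U \<noteq> {} \<and>
           (\<forall>I\<in>U. codim_closed proj_space (non_lefschetz_conics e I) = 1)"
proof -
  have dual: "\<exists>\<phi>. dual_coords e I \<phi> \<and> supported e \<phi> \<and> (\<forall>d. hd_fun \<phi> d = h d)"
    if I: "I \<in> gorenstein_family h" for I :: "(3, 'k) mpoly set"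
  proof -
    interpret gorenstein_ideal3 I e by (rule gorenstein_ideal3_family[OF I assms(3,4)])
    obtain \<phi> where \<phi>: "dual_coords e I \<phi>" using exists_dual by (elim exE)
    have "hd_fun \<phi> d = h d" for d using quot_basis_homog(3)[OF \<phi>, of d] I by (simp add: gorenstein_family_def)
    then show ?thesis using \<phi> dual_supported[OF \<phi>] by blast
  qed
  obtain I0 :: "(3, 'k) mpoly set" where I0: "I0 \<in> gorenstein_family h" using assms(5) by blast
  obtain \<phi>0 where "dual_coords e I0 \<phi>0 \<and> supported e \<phi>0 \<and> (\<forall>d. hd_fun \<phi>0 d = h d)"
    using dual[OF I0] by (elim exE)
  then have \<phi>0: "supported e \<phi>0" "\<And>d. hd_fun \<phi>0 d = h d" by simp_all
  have hd: "hd_fun \<phi>0 = h" using \<phi>0(2) by (rule ext)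
  let ?g = "g_vector h" and ?k = "e div 2"
  \<comment> \<open>Gives \<open>1 \<le> e div 2\<close>, so that \<open>g 1 = 2\<close> belongs to
    the g-vector; for \<open>e = 1\<close> symmetry would force \<open>h 1 = h 0\<close>.\<close>
  have e2: "2 \<le> e"
  proof (rule ccontr)
    assume "\<not> 2 \<le> e"
    then have "e = 0 \<or> e = 1" by auto
    then show False
    proof
      assume "e = 0"
      then show False using assms(2,4) by simp
    next
      assume "e = 1"
      then show False using hd_fun_symmetric[OF \<phi>0(1), of 0] assms(1,2) by (simp add: \<phi>0(2))
    qed
  qed
  obtain s where s: "\<forall>i<s. i \<le> ?k \<longrightarrow> ?g i = int i + 1"
    "\<forall>i. s \<le> Suc i \<and> Suc i \<le> ?k \<longrightarrow> ?g (Suc i) \<le> ?g i"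
    "\<forall>i\<le>?k. 0 \<le> ?g i" "s = 0 \<longrightarrow> ?g 0 = 0"
    using g_vector_shape[OF \<phi>0(1)] unfolding hd by (elim exE conjE)
  have g01: "?g 0 = 1" "?g 1 = 2" using assms(1,2) by (simp_all add: g_vector_def)
  have "\<exists>m. Suc (Suc m) \<le> ?k \<and> ?g (Suc m) < ?g m \<and> ?g (Suc (Suc m)) = ?g (Suc m) \<and> s \<le> Suc m"
    by (rule not_decreasing_type_flat_step[OF g01 _ _ _ assms(6)]) (use s e2 in auto)
  then obtain m where m: "Suc (Suc m) \<le> ?k" "?g (Suc m) < ?g m" "?g (Suc (Suc m)) = ?g (Suc m)" "s \<le> Suc m"
    by (elim exE conjE)
  have mono: "?g j \<le> ?g i" if "s \<le> Suc i" "i \<le> j" "j \<le> ?k" for i j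
    using that(2,3)
  proof (induction rule: dec_induct)
    case (step n)
    then show ?case using s(2)[rule_format, of n] that(1) by simp
  qed simp
  define d where "d = nat (?g (Suc m))"
  have gd: "?g (Suc m) = int d" using s(3) m(1) by (simp add: d_def)
  have h1: "h (Suc m) = h m + d" using gd by (simp add: g_vector_def)
  have h2: "h (Suc (Suc m)) = h (Suc m) + d" using gd m(3) by (simp add: g_vector_def)
  have gl: "int (min d (Suc l)) \<le> ?g l" if "l \<le> m" for l
  proof (cases "l < s")
    case True
    then show ?thesis using s(1) that m(1) by simp
  next
    case False
    then have "?g (Suc m) \<le> ?g l" using that m(1) by (intro mono) auto
    then show ?thesis using gd by simp
  qed
  have s0: "0 < s" using s(4) g01(1) by (cases "s = 0") auto
  \<comment> \<open>\<open>d\<close> is below \<open>g\<close> at \<open>m\<close>, which is at most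
    \<open>m + 1\<close>: there are relations modulo \<open>Var 0\<close> in degree
    \<open>m + 1\<close>, as extremal growth presupposes.\<close>
  have dm: "d \<le> m"
  proof (cases "m < s")
    case True
    then show ?thesis using s(1)[rule_format, of m] m(1,2) gd by simp
  next
    case False
    then have "?g m \<le> ?g (s - 1)" using s0 m(1) by (intro mono) auto
    also have "\<dots> = int s" using s(1)[rule_format, of "s - 1"] s0 False m(1) by simp
    finally show ?thesis using m(2) gd False by simp
  qed
  \<comment> \<open>Termwise comparison with the first differences of the Hilbert function of a
    plane curve of degree \<open>d\<close>; it is strict at \<open>l = m\<close>, just before the
    drop of the g-vector to \<open>d\<close>.\<close>
  have "int (\<Sum>l\<le>m. min d (Suc l)) < (\<Sum>l\<le>m. ?g l)"
    unfolding of_nat_sum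
  proof (rule sum_strict_mono_ex1)
    show "\<exists>l\<in>{..m}. int (min d (Suc l)) < ?g l" using m(2) gd by (intro bexI[of _ m]) auto
  qed (use gl in auto)
  then have big: "(\<Sum>l\<le>m. min d (Suc l)) < h m" using hilbert_fun_eq_sum_g_vector[of h m] by linarith
  let ?U = "{I \<in> gorenstein_family h. conic_lefschetz e (I :: (3, 'k) mpoly set)}"
  have "zariski_open_in_family e h ?U" by (rule zariski_open_conic_lefschetz[OF assms(3,4)])
  moreover have "?U \<noteq> {}" using exists_conic_lefschetz[OF \<phi>0 assms(1,3,4)] by blast
  moreover have "codim_closed proj_space (non_lefschetz_conics e I) = 1" if "I \<in> ?U" for I
  proof -
    have I: "I \<in> gorenstein_family h" "conic_lefschetz e I" using that by auto
    obtain \<phi> where "dual_coords e I \<phi> \<and> supported e \<phi> \<and> (\<forall>d. hd_fun \<phi> d = h d)"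
      using dual[OF I(1)] by (elim exE)
    then have \<phi>: "dual_coords e I \<phi>" "\<And>d. hd_fun \<phi> d = h d" by simp_all
    show ?thesis
      by (rule codim_conics_of_flat_step[OF gorenstein_ideal3_family[OF I(1) assms(3,4)] I(2) \<phi>(1) _ dm])
        (use m(1) h1 h2 big in \<open>simp_all add: \<phi>(2)\<close>)
  qed
  ultimately show ?thesis by blast
qed

end
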